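(* For the two-urn process with power reinforcement $W(n)=n^\alpha$, $\alpha>1$, the map $\alpha\mapsto p_\alpha$ is not nondecreasing. More precisely, $$p_{5/2}>\frac{31}{100}>p_3.$$
   Context: There are two urns containing black and red balls; $B_n(i),R_n(i)$ are the numbers of black and red balls in urn $i\in\{1,2\}$ at time $n\ge0$. The initial configuration is deterministic and fixed, with $R_0(1)\ge1$ and $B_0(2)\ge1$. Put $B_n^*=B_n(1)+B_n(2)$, $R_n^*=R_n(1)+R_n(2)$, $\mathcal G_n=\sigma\{B_m(i),R_m(i):0\le m\le n,\ i=1,2\}$. Let $\alpha>1$, $W(n)=n^\alpha$ and $p\in[0,1]$. Conditionally on $\mathcal G_n$, $\xi_{n+1}(1),\xi_{n+1}(2)$ are independent Bernoulli variables with $$\mathbb P(\xi_{n+1}(i)=1\mid\mathcal G_n)=p\frac{W(B_n^* )}{W(B_n^* )+W(R_n^* )}+(1-p)\frac{W(B_n(i))}{W(B_n(i))+W(R_n(i))},$$ and $B_{n+1}(i)=B_n(i)+\xi_{n+1}(i)$, $R_{n+1}(i)=R_n(i)+1-\xi_{n+1}(i)$. The law of the process is denoted $\mathbb P_p^{(\alpha)}$. Set $x_n=\frac{B_n(1)}{n+B_0(1)+R_0(1)}$, $y_n=\frac{B_n(2)}{n+B_0(2)+R_0(2)}$, and $$\mathcal D=\left\{\lim_{n\to\infty}(x_n,y_n)=(0,0)\right\}\cup\left\{\lim_{n\to\infty}(x_n,y_n)=(1,1)\right\}.$$ The critical parameter is $$p_\alpha=\inf\{q\in[0,1]:\mathbb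 P_p^{(\alpha)}(\mathcal D)=1\text{ for every }p\in[q,1]\}.$$ *)

theory Defs
  imports "HOL-Probability.Probability"
begin

text \<open>An urn is a pair (number of black balls, number of red balls); a configuration is the pair
  (urn 1, urn 2).\<close>

type_synonym urn = "nat \<times> nat"
type_synonym config = "urn \<times> urn"

abbreviation black :: "urn \<Rightarrow> nat" where "black \<equiv> fst"
abbreviation red :: "urn \<Rightarrow> nat" where "red \<equiv> snd"

definition pooled :: "config \<Rightarrow> urn" where
  "pooled s = (black (fst s) + black (snd s), red (fst s) + red (snd s))"

text \<open>The weight is \<open>W(n) = n\<^sup>\<alpha>\<close>; since \<open>0 powr \<alpha> = 0\<close>, this also gives \<open>W(0) = 0\<close>.\<close>

definition weight :: "real \<Rightarrow> nat \<Rightarrow> real" where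
  "weight \<alpha> n = real n powr \<alpha>"

definition black_share :: "real \<Rightarrow> urn \<Rightarrow> real" where
  "black_share \<alpha> u = weight \<alpha> (black u) / (weight \<alpha> (black u) + weight \<alpha> (red u))"

definition draw_prob :: "real \<Rightarrow> real \<Rightarrow> config \<Rightarrow> urn \<Rightarrow> real" where
  "draw_prob \<alpha> p s u = p * black_share \<alpha> (pooled s) + (1 - p) * black_share \<alpha> u"

definition add_ball :: "bool \<Rightarrow> urn \<Rightarrow> urn" where
  "add_ball \<xi> u = (black u + of_bool \<xi>, red u + (1 - of_bool \<xi>))"

definition step :: "real \<Rightarrow> real \<Rightarrow> config \<Rightarrow> config pmf" where
  "step \<alpha> p s = map_pmf (\<lambda>(\<xi>1, \<xi>2). (add_ball \<xi>1 (fst s), add_ball \<xi>2 (snd s)))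
     (pair_pmf (bernoulli_pmf (draw_prob \<alpha> p s (fst s))) (bernoulli_pmf (draw_prob \<alpha> p s (snd s))))"

text \<open>The library clips the parameter of \<open>bernoulli_pmf\<close> to the unit interval; no clipping occurs
  in \<open>step\<close> for \<open>p \<in> {0..1}\<close>.\<close>

lemma draw_prob_bounds:
  assumes "p \<in> {0..1}"
  shows "draw_prob \<alpha> p s u \<in> {0..1}"
proof -
  have "black_share \<alpha> v \<in> {0..1}" for v
    by (auto simp: black_share_def weight_def divide_simps)
       (smt (verit) powr_ge_zero)+
  then show ?thesis
    using convexD_alt[of "{0..1::real}" "black_share \<alpha> u" "black_share \<alpha> (pooled s)" p] assms
    by (simp add: draw_prob_def add.commute)
qed

text \<open>\<open>history_kernel s0 \<alpha> p n \<omega>\<close> is the conditional law of the configuration at time \<open>n\<close> given the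
  configurations \<open>\<omega> 0, \<dots>, \<omega> (n - 1)\<close>; the Ionescu-Tulcea theorem glues these laws to a measure on
  trajectories.\<close>

definition history_kernel ::
    "config \<Rightarrow> real \<Rightarrow> real \<Rightarrow> nat \<Rightarrow> (nat \<Rightarrow> config) \<Rightarrow> config measure" where
  "history_kernel s0 \<alpha> p n \<omega> =
     measure_pmf (case n of 0 \<Rightarrow> return_pmf s0 | Suc m \<Rightarrow> step \<alpha> p (\<omega> m))"

definition urn_law :: "config \<Rightarrow> real \<Rightarrow> real \<Rightarrow> (nat \<Rightarrow> config) measure" where
  "urn_law s0 \<alpha> p =
     projective_family.lim UNIV
       (Ionescu_Tulcea.CI (history_kernel s0 \<alpha> p) (\<lambda>_. count_space UNIV)) (\<lambda>_. count_space UNIV)"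

definition x_frac :: "config \<Rightarrow> (nat \<Rightarrow> config) \<Rightarrow> nat \<Rightarrow> real" where
  "x_frac s0 \<omega> n = real (black (fst (\<omega> n))) / real (n + black (fst s0) + red (fst s0))"

definition y_frac :: "config \<Rightarrow> (nat \<Rightarrow> config) \<Rightarrow> nat \<Rightarrow> real" where
  "y_frac s0 \<omega> n = real (black (snd (\<omega> n))) / real (n + black (snd s0) + red (snd s0))"

definition dominance :: "config \<Rightarrow> (nat \<Rightarrow> config) set" where
  "dominance s0 =
     {\<omega>. (\<lambda>n. (x_frac s0 \<omega> n, y_frac s0 \<omega> n)) \<longlonglongrightarrow> (0, 0)} \<union>
     {\<omega>. (\<lambda>n. (x_frac s0 \<omega> n, y_frac s0 \<omega> n)) \<longlonglongrightarrow> (1, 1)}"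

definition p_crit :: "config \<Rightarrow> real \<Rightarrow> real" where
  "p_crit s0 \<alpha> =
     Inf {q \<in> {0..1}. \<forall>p\<in>{q..1}. measure (urn_law s0 \<alpha> p) (dominance s0) = 1}"

lemma Ionescu_Tulcea_history_kernel:
  "Ionescu_Tulcea (history_kernel s0 \<alpha> p) (\<lambda>_. count_space UNIV)"
proof (rule Ionescu_Tulcea.intro)
  show "history_kernel s0 \<alpha> p n \<in>
      measurable (PiM {0..<n} (\<lambda>_. count_space UNIV)) (subprob_algebra (count_space UNIV))" for n
  proof (cases n)
    case 0
    then show ?thesis
      by (simp add: history_kernel_def[abs_def] measure_pmf_in_subprob_algebra)
  next
    case (Suc m)
    have "(\<lambda>s. measure_pmf (step \<alpha> p s)) \<in>
        measurable (count_space UNIV) (subprob_algebra (count_space UNIV))"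
      by (simp add: measure_pmf_in_subprob_algebra)
    moreover have "(\<lambda>\<omega>. \<omega> m) \<in> measurable (PiM {0..<n} (\<lambda>_. count_space UNIV)) (count_space UNIV)"
      using Suc by (intro measurable_component_singleton) auto
    ultimately show ?thesis
      using Suc by (simp add: history_kernel_def[abs_def] measurable_compose)
  qed
  show "prob_space (history_kernel s0 \<alpha> p n \<omega>)" for n \<omega>
    by (simp add: history_kernel_def prob_space_measure_pmf)
qed

lemma prob_space_urn_law: "prob_space (urn_law s0 \<alpha> p)"
  and sets_urn_law: "sets (urn_law s0 \<alpha> p) = sets (PiM UNIV (\<lambda>_. count_space UNIV))"
  and space_urn_law: "space (urn_law s0 \<alpha> p) = UNIV"
proof -
  interpret IT: Ionescu_Tulcea "history_kernel s0 \<alpha> p" "\<lambda>_. count_space UNIV"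
    by (rule Ionescu_Tulcea_history_kernel)
  show s: "sets (urn_law s0 \<alpha> p) = sets (PiM UNIV (\<lambda>_. count_space UNIV))"
    by (simp add: urn_law_def)
  show sp: "space (urn_law s0 \<alpha> p) = UNIV"
    using sets_eq_imp_space_eq[OF s] by (simp add: space_PiM PiE_def)
  have "emeasure IT.PF.lim (IT.PF.emb UNIV {} {\<lambda>_. undefined}) = emeasure (IT.CI {}) {\<lambda>_. undefined}"
    by (rule IT.lim) (simp_all add: sets_PiM_empty)
  moreover have "IT.PF.emb UNIV {} {\<lambda>_. undefined} = UNIV"
    by (auto simp: prod_emb_def space_PiM PiE_def)
  moreover have "emeasure (IT.CI {}) {\<lambda>_. undefined} = 1"
    using prob_space.emeasure_space_1[OF IT.PF.prob_space_P[of "{}"]]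
    by (simp add: IT.CI_def space_PiM)
  ultimately show "prob_space (urn_law s0 \<alpha> p)"
    using sp by (intro prob_spaceI) (simp add: urn_law_def)
qed

text \<open>The probabilities of finite trajectories determine the law: the process starts in \<open>s0\<close>
  and, given the configurations up to time \<open>n\<close>, the next one has distribution \<open>step\<close>.\<close>

lemma urn_law_path:
  "measure (urn_law s0 \<alpha> p) {\<omega>. \<forall>i\<le>n. \<omega> i = s i} =
     (if s 0 = s0 then (\<Prod>i<n. pmf (step \<alpha> p (s i)) (s (Suc i))) else 0)"
proof -
  interpret IT: Ionescu_Tulcea "history_kernel s0 \<alpha> p" "\<lambda>_. count_space UNIV"
    by (rule Ionescu_Tulcea_history_kernel)
  let ?M = "\<lambda>_::nat. count_space (UNIV :: config set)"
  let ?r = "\<lambda>n. restrict s {0..<n}"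
  have sp: "space (PiM {0..<n} ?M) = {0..<n} \<rightarrow>\<^sub>E UNIV" for n
    by (simp add: space_PiM)
  have sing[measurable]: "{?r n} \<in> sets (PiM {0..<n} ?M)" for n
  proof -
    have "{?r n} = PiE {0..<n} (\<lambda>i. {s i})"
      by (auto simp: PiE_iff extensional_def restrict_def fun_eq_iff)
    then show ?thesis
      by (simp add: sets_PiM_I_finite)
  qed
  have C_step: "emeasure (IT.C 0 (Suc n) (\<lambda>_. undefined)) {?r (Suc n)} =
      emeasure (IT.C 0 n (\<lambda>_. undefined)) {?r n} * emeasure (history_kernel s0 \<alpha> p n (?r n)) {s n}" for n
  proof -
    have e: "emeasure (IT.eP n \<omega>) {?r (Suc n)} =
        emeasure (history_kernel s0 \<alpha> p n (?r n)) {s n} * indicator {?r n} \<omega>"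
      if \<omega>: "\<omega> \<in> space (PiM {0..<n} ?M)" for \<omega>
    proof -
      have "(fun_upd \<omega> n) -` {?r (Suc n)} = (if \<omega> = ?r n then {s n} else {})"
      proof (cases "\<omega> = ?r n")
        case True
        then have "fun_upd \<omega> n x = ?r (Suc n) \<longleftrightarrow> x = s n" for x
          by (auto simp: fun_eq_iff restrict_def less_Suc_eq dest: spec[of _ n])
        then show ?thesis
          using True by (simp add: vimage_def)
      next
        case False
        then obtain j where j: "\<omega> j \<noteq> ?r n j"
          by (auto simp: fun_eq_iff)
        then have "j < n"
          using \<omega> by (auto simp: sp PiE_iff extensional_def restrict_def split: if_splits)
        then have "fun_upd \<omega> n x j \<noteq> ?r (Suc n) j" for x
          using j by simp
        then have "fun_upd \<omega> n x \<noteq> ?r (Suc n)" for x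
          by metis
        then show ?thesis
          using False by auto
      qed
      then show ?thesis
        using IT.emeasure_eP[OF \<omega> sing] by simp
    qed
    have x: "(\<lambda>_. undefined) \<in> space (PiM {0..<0} ?M)"
      by simp
    note [measurable_cong] = IT.sets_C[OF x]
    have "emeasure (IT.C 0 (Suc n) (\<lambda>_. undefined)) {?r (Suc n)} =
        (\<integral>\<^sup>+\<omega>. emeasure (IT.eP n \<omega>) {?r (Suc n)} \<partial>IT.C 0 n (\<lambda>_. undefined))"
      using IT.measurable_eP[of n] IT.space_C[OF x, of n] IT.sets_C[OF x, of n]
      by (simp, subst emeasure_bind[where N="PiM {0..<Suc n} ?M"])
         (auto simp: measurable_cong_sets[OF IT.sets_C[OF x, of n] refl] simp del: atLeastLessThanSuc)
    also have "\<dots> = (\<integral>\<^sup>+\<omega>. emeasure (history_kernel s0 \<alpha> p n (?r n)) {s n} * indicator {?r n} \<omega>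
        \<partial>IT.C 0 n (\<lambda>_. undefined))"
      using IT.space_C[OF x, of n] by (intro nn_integral_cong e) simp
    also have "\<dots> = emeasure (IT.C 0 n (\<lambda>_. undefined)) {?r n} *
        emeasure (history_kernel s0 \<alpha> p n (?r n)) {s n}"
      using sing[of n] IT.sets_C[OF x, of n]
      by (subst nn_integral_cmult_indicator) (auto simp: mult.commute)
    finally show ?thesis .
  qed
  have C: "emeasure (IT.C 0 (Suc n) (\<lambda>_. undefined)) {?r (Suc n)} =
      ennreal (if s 0 = s0 then (\<Prod>i<n. pmf (step \<alpha> p (s i)) (s (Suc i))) else 0)"
  proof (induction n)
    case 0
    have "emeasure (IT.C 0 0 (\<lambda>_. undefined)) {?r 0} = 1"
      using sing[of 0] by (simp add: restrict_def)
    then show ?case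
      by (subst C_step) (simp add: history_kernel_def emeasure_pmf_single pmf_return del: IT.C.simps)
  next
    case (Suc n)
    show ?case
      by (subst C_step, subst Suc)
         (auto simp: history_kernel_def emeasure_pmf_single ennreal_mult prod_nonneg mult.commute)
  qed
  have emb: "IT.PF.emb UNIV {0..<Suc n} {?r (Suc n)} = {\<omega>. \<forall>i\<le>n. \<omega> i = s i}"
    by (auto simp: prod_emb_def space_PiM PiE_def fun_eq_iff restrict_def less_Suc_eq_le; metis)
  have self: "IT.PF.emb {0..<Suc n} {0..<Suc n} {?r (Suc n)} = {?r (Suc n)}"
    using sing[of "Suc n"] by (intro prod_emb_id) (auto simp: PiE_def)
  have "emeasure (urn_law s0 \<alpha> p) {\<omega>. \<forall>i\<le>n. \<omega> i = s i} =
      emeasure (IT.CI {0..<Suc n}) {?r (Suc n)}"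
    using IT.lim[of "{0..<Suc n}" "{?r (Suc n)}"] sing[of "Suc n"] by (simp add: urn_law_def emb)
  also have "\<dots> = emeasure (IT.C 0 (Suc n) (\<lambda>_. undefined)) {?r (Suc n)}"
    using IT.emeasure_CI[of "{0..<Suc n}" "Suc n" "{?r (Suc n)}"] sing[of "Suc n"] self by simp
  finally show ?thesis
    unfolding C by (simp add: measure_def prod_nonneg)
qed

lemma dominance_in_sets: "dominance s0 \<in> sets (urn_law s0 \<alpha> p)"
proof -
  let ?N = "PiM UNIV (\<lambda>_::nat. count_space (UNIV :: config set))"
  have c: "(\<lambda>\<omega>. f (\<omega> n)) \<in> borel_measurable ?N" for n and f :: "config \<Rightarrow> real"
    by (rule measurable_compose[OF measurable_component_singleton]) auto
  have [measurable]: "(\<lambda>\<omega>. x_frac s0 \<omega> n) \<in> borel_measurable ?N"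
      "(\<lambda>\<omega>. y_frac s0 \<omega> n) \<in> borel_measurable ?N" for n
    unfolding x_frac_def y_frac_def by (intro c)+
  have "{\<omega> \<in> space ?N. (\<lambda>n. (x_frac s0 \<omega> n, y_frac s0 \<omega> n)) \<longlonglongrightarrow> z} \<in> sets ?N" for z
    by measurable
  then have "{\<omega>. (\<lambda>n. (x_frac s0 \<omega> n, y_frac s0 \<omega> n)) \<longlonglongrightarrow> z} \<in> sets ?N" for z
    by (simp add: space_PiM PiE_def)
  then show ?thesis
    unfolding dominance_def sets_urn_law by blast
qed

end

theory Submission
  imports Defs "HOL-Real_Asymp.Real_Asymp"
begin

text \<open>Write \<open>x\<close>, \<open>y\<close> for the black fractions and \<open>g\<close> for the share function. The mean-field drift is
  \<open>F = (p g(m) + (1 - p) g(x) - x, p g(m) + (1 - p) g(y) - y)\<close> with \<open>m = (x + y) / 2\<close>, a gradient field.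

  For \<open>\<alpha> = 5/2\<close> and \<open>p = 0.3101\<close> the antisymmetric equilibrium \<open>(x0, 1 - x0)\<close> is still stable: the drift
  contracts the Euclidean distance to it, so a supermartingale bound keeps the process near it with positive
  probability once it has been reached, and dominance fails.

  For \<open>\<alpha> = 3\<close> and \<open>p \<ge> 0.309\<close> every equilibrium other than the two sinks lies on \<open>x + y = 1\<close> and is unstable in
  the direction of \<open>W = x + y - 1\<close>. The potential of \<open>F\<close> plus \<open>ln (A + n W\<^sup>2) / ln n\<close> is then bounded and grows
  on average by at least \<open>const / (n ln n)\<close> away from the sinks. As this is not summable, the process almost
  surely comes close to a sink at arbitrarily late times, and each time it is absorbed with probability at least
  \<open>1/2\<close>. Hence dominance has conditional probability at least \<open>1/2\<close> given any initial segment, that is,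
  probability 1. For \<open>p = 1\<close> the same argument works for all \<open>\<alpha> \<ge> 2\<close>, so that the infimum defining the critical
  parameter at \<open>5/2\<close> is over a nonempty set.\<close>

section \<open>Markov property and supermartingales\<close>

text \<open>The constants 0.3101 and 0.309 lie on either side of 0.31 for different reasons. As the
  slope of \<open>g\<close> at 1/2 is \<alpha>, the antisymmetric equilibrium is linearly stable
  along W while p \<alpha> + (1 - p) g'(x0) < 1. For \<alpha> = 3 this already fails for p above
  about 0.301, but equilibria with x \<noteq> y and x + y \<noteq> 1 survive up to about 0.307;
  excluding them takes the sharper polynomial estimate. The quantifier in \<open>p_crit\<close>
  makes the bounds unequal in effort: one bad p settles 5/2, whereas 3 needs every p from 0.309 to
  1. The obstacle there is that the potential of F gains only |F|^2 / n up to O(1 / n^2), hence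
  nothing at an equilibrium. The term ln (A + n W^2) also sees the noise of the draws and grows even
  at W = 0; being of size ln n it is divided by ln n to keep the sum bounded, and the surviving gain
  1 / (n ln n) just fails to be summable. Approach to equilibria and escape from unstable ones are
  thus handled by one function. Conditional probabilities appear as bounds over all events that
  depend on finitely many coordinates.\<close>

definition past :: "nat \<Rightarrow> (nat \<Rightarrow> config) set \<Rightarrow> bool" where
  "past n A \<longleftrightarrow> (\<forall>\<omega> \<omega>'. (\<forall>i\<le>n. \<omega> i = \<omega>' i) \<longrightarrow> \<omega> \<in> A \<longrightarrow> \<omega>' \<in> A)"

lemma past_cong: "past n A \<Longrightarrow> (\<And>i. i \<le> n \<Longrightarrow> \<omega> i = \<omega>' i) \<Longrightarrow> \<omega> \<in> A \<longleftrightarrow> \<omega>' \<in> A"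
  unfolding past_def by metis

lemma past_mono: "past n A \<Longrightarrow> n \<le> m \<Longrightarrow> past m A"
  unfolding past_def by (meson order_trans)

lemma past_Int: "past n A \<Longrightarrow> past n B \<Longrightarrow> past n (A \<inter> B)"
  unfolding past_def by blast

lemma past_Compl: "past n A \<Longrightarrow> past n (- A)"
  unfolding past_def by (metis ComplD ComplI)

lemma past_Collect: "(\<And>\<omega> \<omega>'. (\<And>i. i \<le> n \<Longrightarrow> \<omega> i = \<omega>' i) \<Longrightarrow> P \<omega> = P \<omega>') \<Longrightarrow> past n {\<omega>. P \<omega>}"
  unfolding past_def by blast

lemma past_Union: "(\<And>i. i \<in> I \<Longrightarrow> past n (A i)) \<Longrightarrow> past n (\<Union>i\<in>I. A i)"
  unfolding past_def by blast

lemma measurable_urn_law_state: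
  "(\<lambda>\<omega>. f (\<omega> n)) \<in> measurable (urn_law s0 \<alpha> p) N" if "\<And>s. f s \<in> space N" for f :: "config \<Rightarrow> 'a"
proof -
  have "(\<lambda>\<omega>. \<omega> n) \<in> measurable (urn_law s0 \<alpha> p) (count_space UNIV)"
    unfolding measurable_cong_sets[OF sets_urn_law refl]
    by (rule measurable_component_singleton) simp
  moreover have "f \<in> measurable (count_space UNIV) N"
    using that by simp
  ultimately show ?thesis
    by (rule measurable_compose)
qed

lemma sets_Collect_state: "{\<omega>. P (\<omega> n)} \<in> sets (urn_law s0 \<alpha> p)"
proof -
  have "{\<omega> \<in> space (urn_law s0 \<alpha> p). P (\<omega> n)} \<in> sets (urn_law s0 \<alpha> p)"
    by (rule measurable_sets_Collect[where N="count_space UNIV" and P="\<lambda>x. x"],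
        rule measurable_urn_law_state[of P], simp_all)
  then show ?thesis
    by (simp add: space_urn_law)
qed

definition cyl :: "config list \<Rightarrow> (nat \<Rightarrow> config) set" where
  "cyl l = {\<omega>. \<forall>i<length l. \<omega> i = l ! i}"

lemma sets_cyl: "cyl l \<in> sets (urn_law s0 \<alpha> p)"
proof -
  have "cyl l = space (urn_law s0 \<alpha> p) \<inter> (\<Inter>i<length l. {\<omega>. \<omega> i = l ! i})"
    by (auto simp: cyl_def space_urn_law)
  also have "\<dots> \<in> sets (urn_law s0 \<alpha> p)"
    proof (cases "l = []")
    case False
    then show ?thesis
      by (intro sets.Int sets.top sets.finite_INT) (auto intro: sets_Collect_state[of "\<lambda>s. s = _"])
  qed (simp add: sets.top)
  finally show ?thesis .
qed

text \<open>Configurations are countable, so an event decided by time \<open>n\<close> is a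
  countable disjoint union of path cylinders. Measurability and equality of measures on such events
  can therefore be checked on cylinders alone.\<close>

lemma past_eq_Union_cyl:
  assumes "past n A"
  defines "I \<equiv> (\<lambda>\<omega>. map \<omega> [0..<Suc n]) ` A"
  shows "A = (\<Union>l\<in>I. cyl l)" and "countable I" and "disjoint_family_on cyl I"
    and "\<And>l. l \<in> I \<Longrightarrow> length l = Suc n"
proof -
  have c: "\<omega>' \<in> cyl (map \<omega> [0..<Suc n]) \<longleftrightarrow> (\<forall>i\<le>n. \<omega>' i = \<omega> i)" for \<omega> \<omega>' :: "nat \<Rightarrow> config"
    by (auto simp: cyl_def less_Suc_eq_le simp del: upt_Suc)
  show "A = (\<Union>l\<in>I. cyl l)"
  proof (intro equalityI subsetI)
    fix \<omega> assume "\<omega> \<in> A"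
    moreover have "\<omega> \<in> cyl (map \<omega> [0..<Suc n])"
      unfolding c by simp
    ultimately show "\<omega> \<in> (\<Union>l\<in>I. cyl l)"
      unfolding I_def by blast
  next
    fix \<omega> assume "\<omega> \<in> (\<Union>l\<in>I. cyl l)"
    then obtain \<omega>' where "\<omega>' \<in> A" "\<omega> \<in> cyl (map \<omega>' [0..<Suc n])"
      unfolding I_def by blast
    then show "\<omega> \<in> A"
      using past_cong[OF assms(1), of \<omega> \<omega>'] unfolding c by blast
  qed
  show "countable I"
    by simp
  show l: "\<And>l. l \<in> I \<Longrightarrow> length l = Suc n"
    by (auto simp: I_def)
  show "disjoint_family_on cyl I"
    unfolding disjoint_family_on_def
  proof (intro ballI impI)
    fix a b assume ab: "a \<in> I" "b \<in> I" "a \<noteq> b"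
    then obtain i where "i < Suc n" "a ! i \<noteq> b ! i"
      using nth_equalityI[of a b] l by metis
    then show "cyl a \<inter> cyl b = {}"
      using l ab by (auto simp: cyl_def)
  qed
qed

lemma sets_past: "past n A \<Longrightarrow> A \<in> sets (urn_law s0 \<alpha> p)"
  by (subst past_eq_Union_cyl(1), assumption, intro sets.countable_UN'' past_eq_Union_cyl(2) sets_cyl)

text \<open>The Markov property. Both sides are values at \<open>A\<close> of measures with a
  density; on a cylinder of length \<open>Suc n\<close> they agree because
  \<open>urn_law_path\<close> at times \<open>n\<close> and \<open>Suc n\<close> differs by exactly
  one transition factor.\<close>

lemma emeasure_past_next:
  assumes A: "past n A"
  shows "emeasure (urn_law s0 \<alpha> p) (A \<inter> {\<omega>. \<omega> (Suc n) = t}) =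
    (\<integral>\<^sup>+\<omega>. indicator A \<omega> * ennreal (pmf (step \<alpha> p (\<omega> n)) t) \<partial>urn_law s0 \<alpha> p)"
proof -
  let ?M = "urn_law s0 \<alpha> p"
  interpret prob_space ?M by (rule prob_space_urn_law)
  define f where "f = (\<lambda>\<omega>::nat \<Rightarrow> config. indicator {\<omega>. \<omega> (Suc n) = t} \<omega> :: ennreal)"
  define g where "g = (\<lambda>\<omega>::nat \<Rightarrow> config. ennreal (pmf (step \<alpha> p (\<omega> n)) t))"
  have [measurable]: "f \<in> borel_measurable ?M" "g \<in> borel_measurable ?M"
    unfolding f_def g_def
    by (rule borel_measurable_indicator, rule sets_Collect_state[of "\<lambda>s. s = t"],
        rule measurable_urn_law_state[of "\<lambda>s. ennreal (pmf (step \<alpha> p s) t)"], simp)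
  have cyl: "emeasure (density ?M f) (cyl l) = emeasure (density ?M g) (cyl l)"
    if l: "length l = Suc n" for l
  proof -
    have path: "emeasure ?M (cyl l) =
        ennreal (if l ! 0 = s0 then \<Prod>i<n. pmf (step \<alpha> p (l ! i)) (l ! Suc i) else 0)"
      using urn_law_path[of s0 \<alpha> p n "\<lambda>i. l ! i"] l
      by (simp add: cyl_def less_Suc_eq_le emeasure_eq_measure)
    have prod: "(\<Prod>i<n. pmf (step \<alpha> p ((l @ [t]) ! i)) ((l @ [t]) ! Suc i)) =
        (\<Prod>i<n. pmf (step \<alpha> p (l ! i)) (l ! Suc i))"
      using l by (intro prod.cong) (auto simp: nth_append)
    have "(l @ [t]) ! 0 = l ! 0" "(l @ [t]) ! n = l ! n" "(l @ [t]) ! Suc n = t"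
      using l by (auto simp: nth_append)
    then have path': "emeasure ?M (cyl (l @ [t])) =
        ennreal (if l ! 0 = s0 then (\<Prod>i<n. pmf (step \<alpha> p (l ! i)) (l ! Suc i)) * pmf (step \<alpha> p (l ! n)) t else 0)"
      using urn_law_path[of s0 \<alpha> p "Suc n" "\<lambda>i. (l @ [t]) ! i"] l
      by (simp add: cyl_def less_Suc_eq_le emeasure_eq_measure prod)
    have "emeasure (density ?M f) (cyl l) = emeasure ?M (cyl (l @ [t]))"
    proof -
      have "cyl l \<inter> {\<omega>. \<omega> (Suc n) = t} = cyl (l @ [t])"
        using l by (auto simp: cyl_def nth_append less_Suc_eq)
      moreover have "f \<omega> * indicator (cyl l) \<omega> = indicator (cyl l \<inter> {\<omega>. \<omega> (Suc n) = t}) \<omega>" for \<omega>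
        by (auto simp: f_def indicator_def)
      ultimately show ?thesis
        by (simp add: emeasure_density sets_cyl)
    qed
    moreover have "emeasure (density ?M g) (cyl l) = ennreal (pmf (step \<alpha> p (l ! n)) t) * emeasure ?M (cyl l)"
    proof -
      have "g \<omega> * indicator (cyl l) \<omega> = ennreal (pmf (step \<alpha> p (l ! n)) t) * indicator (cyl l) \<omega>" for \<omega>
        using l by (auto simp: g_def indicator_def cyl_def)
      then show ?thesis
        by (simp add: emeasure_density sets_cyl nn_integral_cmult_indicator)
    qed
    ultimately show ?thesis
      unfolding path path' by (auto simp: ennreal_mult prod_nonneg mult.commute)
  qed
  have "emeasure (density ?M f) A = emeasure (density ?M g) A"
  proof -
    define I where "I = (\<lambda>\<omega>. map \<omega> [0..<Suc n]) ` A"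
    note U = past_eq_Union_cyl[OF A, folded I_def]
    have "emeasure (density ?M h) A = (\<integral>\<^sup>+l. emeasure (density ?M h) (cyl l) \<partial>count_space I)" for h
      by (subst U(1), rule emeasure_UN_countable) (simp_all add: sets_cyl U(2,3))
    then show ?thesis
      by (simp, intro nn_integral_cong cyl) (auto intro: U(4))
  qed
  moreover have "emeasure (density ?M f) A = emeasure ?M (A \<inter> {\<omega>. \<omega> (Suc n) = t})"
  proof -
    have "f \<omega> * indicator A \<omega> = indicator (A \<inter> {\<omega>. \<omega> (Suc n) = t}) \<omega>" for \<omega>
      by (auto simp: f_def indicator_def)
    then show ?thesis
      using sets_past[OF A] sets_Collect_state[of "\<lambda>s. s = t"]
      by (simp add: emeasure_density)
  qed
  moreover have "emeasure (density ?M g) A = (\<integral>\<^sup>+\<omega>. indicator A \<omega> * g \<omega> \<partial>?M)"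
    using sets_past[OF A] by (simp add: emeasure_density mult.commute)
  ultimately show ?thesis
    by (simp add: g_def)
qed

text \<open>Decompose by the value \<open>t\<close> of the next configuration; countability turns
  the integral over \<open>t\<close> into a sum that may be exchanged with the integral over
  trajectories, and \<open>emeasure_past_next\<close> handles each \<open>t\<close>.\<close>

lemma nn_integral_past_next:
  fixes f :: "config \<Rightarrow> ennreal"
  assumes A: "past n A"
  shows "(\<integral>\<^sup>+\<omega>. indicator A \<omega> * f (\<omega> (Suc n)) \<partial>urn_law s0 \<alpha> p) =
    (\<integral>\<^sup>+\<omega>. indicator A \<omega> * (\<integral>\<^sup>+t. f t \<partial>step \<alpha> p (\<omega> n)) \<partial>urn_law s0 \<alpha> p)"
proof -
  let ?M = "urn_law s0 \<alpha> p"
  have [measurable]: "A \<in> sets ?M" "{\<omega>. \<omega> (Suc n) = t} \<in> sets ?M" for t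
    using sets_past[OF A] sets_Collect_state[of "\<lambda>s. s = t"] by auto
  have [measurable]: "(\<lambda>\<omega>. ennreal (pmf (step \<alpha> p (\<omega> n)) t)) \<in> borel_measurable ?M" for t
    by (rule measurable_urn_law_state[of "\<lambda>s. ennreal (pmf (step \<alpha> p s) t)"]) simp
  have eq: "indicator A \<omega> * f (\<omega> (Suc n)) =
      (\<integral>\<^sup>+t. f t * indicator (A \<inter> {\<omega>. \<omega> (Suc n) = t}) \<omega> \<partial>count_space UNIV)" for \<omega>
  proof -
    have "f t * indicator (A \<inter> {\<omega>. \<omega> (Suc n) = t}) \<omega> = (f t * indicator A \<omega>) * indicator {\<omega> (Suc n)} t" for t
      by (auto simp: indicator_def)
    then show ?thesis
      by (simp add: mult.commute)
  qed
  have "(\<integral>\<^sup>+\<omega>. indicator A \<omega> * f (\<omega> (Suc n)) \<partial>?M) =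
      (\<integral>\<^sup>+t. \<integral>\<^sup>+\<omega>. f t * indicator (A \<inter> {\<omega>. \<omega> (Suc n) = t}) \<omega> \<partial>?M \<partial>count_space UNIV)"
    unfolding eq by (rule nn_integral_count_space_nn_integral) simp_all
  also have "\<dots> = (\<integral>\<^sup>+t. f t * (\<integral>\<^sup>+\<omega>. indicator A \<omega> * ennreal (pmf (step \<alpha> p (\<omega> n)) t) \<partial>?M) \<partial>count_space UNIV)"
    by (intro nn_integral_cong) (simp add: nn_integral_cmult_indicator emeasure_past_next[OF A])
  also have "\<dots> = (\<integral>\<^sup>+t. \<integral>\<^sup>+\<omega>. f t * (indicator A \<omega> * ennreal (pmf (step \<alpha> p (\<omega> n)) t)) \<partial>?M \<partial>count_space UNIV)"
    by (intro nn_integral_cong nn_integral_cmult[symmetric]) measurable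
  also have "\<dots> = (\<integral>\<^sup>+\<omega>. \<integral>\<^sup>+t. f t * (indicator A \<omega> * ennreal (pmf (step \<alpha> p (\<omega> n)) t)) \<partial>count_space UNIV \<partial>?M)"
    by (rule nn_integral_count_space_nn_integral[symmetric]) simp_all
  also have "\<dots> = (\<integral>\<^sup>+\<omega>. indicator A \<omega> * (\<integral>\<^sup>+t. f t \<partial>step \<alpha> p (\<omega> n)) \<partial>?M)"
    by (intro nn_integral_cong)
       (simp add: nn_integral_measure_pmf nn_integral_cmult[symmetric] ac_simps)
  finally show ?thesis .
qed

lemma nn_integral_past_next_le:
  fixes f f' :: "config \<Rightarrow> ennreal"
  assumes A: "past n A"
    and le: "AE \<omega> in urn_law s0 \<alpha> p. \<omega> \<in> A \<longrightarrow> (\<integral>\<^sup>+t. f t \<partial>step \<alpha> p (\<omega> n)) \<le> f' (\<omega> n)"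
  shows "(\<integral>\<^sup>+\<omega>. indicator A \<omega> * f (\<omega> (Suc n)) \<partial>urn_law s0 \<alpha> p) \<le>
    (\<integral>\<^sup>+\<omega>. indicator A \<omega> * f' (\<omega> n) \<partial>urn_law s0 \<alpha> p)"
  unfolding nn_integral_past_next[OF A]
  by (intro nn_integral_mono_AE, use le in eventually_elim) (auto simp: indicator_def)

lemma borel_measurable_state: "(\<lambda>\<omega>. f (\<omega> n)) \<in> borel_measurable (urn_law s0 \<alpha> p)"
  for f :: "config \<Rightarrow> ennreal"
  by (rule measurable_urn_law_state) simp

lemma nn_integral_indicator_split:
  fixes f :: "'a \<Rightarrow> ennreal"
  assumes [measurable]: "A \<in> sets M" "B \<in> sets M" "f \<in> borel_measurable M" and "A \<inter> B = {}"
  shows "(\<integral>\<^sup>+x. indicator (A \<union> B) x * f x \<partial>M) =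
    (\<integral>\<^sup>+x. indicator A x * f x \<partial>M) + (\<integral>\<^sup>+x. indicator B x * f x \<partial>M)"
proof -
  have "indicator (A \<union> B) x * f x = indicator A x * f x + indicator B x * f x" for x
    using assms(4) by (auto simp: indicator_def)
  then show ?thesis
    by (simp add: nn_integral_add)
qed

section \<open>Maximal inequality and hitting criterion for supermartingales\<close>

text \<open>Doob's maximal inequality for the process stopped on reaching level \<open>c\<close>, so
  the supermartingale inequality is demanded only below \<open>c\<close>. The quantity
  \<open>c\<close> times the probability of having crossed, plus the mass of \<open>h\<close> on
  uncrossed paths, does not increase with \<open>n\<close>.\<close>

lemma supermartingale_maximal:
  fixes h :: "nat \<Rightarrow> config \<Rightarrow> ennreal"
  assumes A: "past N A"
    and super: "\<And>n. n \<ge> N \<Longrightarrow> AE \<omega> in urn_law s0 \<alpha> p. h n (\<omega> n) < c \<longrightarrow>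
      (\<integral>\<^sup>+t. h (Suc n) t \<partial>step \<alpha> p (\<omega> n)) \<le> h n (\<omega> n)"
  shows "c * emeasure (urn_law s0 \<alpha> p) (A \<inter> {\<omega>. \<exists>k\<ge>N. h k (\<omega> k) \<ge> c}) \<le>
    (\<integral>\<^sup>+\<omega>. indicator A \<omega> * h N (\<omega> N) \<partial>urn_law s0 \<alpha> p)"
proof -
  let ?M = "urn_law s0 \<alpha> p"
  define E where "E = (\<lambda>n. A \<inter> {\<omega>. \<exists>k\<in>{N..n}. h k (\<omega> k) \<ge> c})"
  define S where "S = (\<lambda>n. A \<inter> {\<omega>. \<forall>k\<in>{N..n}. h k (\<omega> k) < c})"
  define R where "R = (\<lambda>n. S n \<inter> {\<omega>. h (Suc n) (\<omega> (Suc n)) \<ge> c})"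
  let ?I = "\<lambda>B n. \<integral>\<^sup>+\<omega>. indicator B \<omega> * h n (\<omega> n) \<partial>?M"
  have past_S: "past n (S n)" and past_E: "past n (E n)" if "n \<ge> N" for n
    unfolding S_def E_def using past_mono[OF A that]
    by (auto intro!: past_Int past_Collect ball_cong bex_cong)
  have past_R: "past (Suc n) (R n)" if "n \<ge> N" for n
    unfolding R_def using past_mono[OF past_S[OF that], of "Suc n"] by (auto intro!: past_Int past_Collect)
  have sets_E: "E n \<in> sets ?M" and sets_S: "S n \<in> sets ?M" and sets_R: "R n \<in> sets ?M" if "n \<ge> N" for n
    by (rule sets_past past_E past_S past_R that)+
  have markov: "c * emeasure ?M B \<le> ?I B n" if "B \<in> sets ?M" "\<And>\<omega>. \<omega> \<in> B \<Longrightarrow> h n (\<omega> n) \<ge> c" for B n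
  proof -
    have "c * emeasure ?M B = (\<integral>\<^sup>+\<omega>. c * indicator B \<omega> \<partial>?M)"
      by (rule nn_integral_cmult_indicator[symmetric]) fact
    also have "\<dots> \<le> ?I B n"
      by (intro nn_integral_mono) (auto simp: indicator_def that)
    finally show ?thesis .
  qed
  have main: "c * emeasure ?M (E n) + ?I (S n) n \<le> ?I A N" if "n \<ge> N" for n
    using that
  proof (induction n rule: dec_induct)
    case base
    have "A = E N \<union> S N" "E N \<inter> S N = {}"
      by (auto simp: E_def S_def)
    then have "?I A N = ?I (E N) N + ?I (S N) N"
      using nn_integral_indicator_split[OF sets_E[of N] sets_S[of N] borel_measurable_state[of "h N" N]] by simp
    moreover have "c * emeasure ?M (E N) \<le> ?I (E N) N"
      by (rule markov[OF sets_E]) (auto simp: E_def)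
    ultimately show ?case
      by (simp add: add_right_mono)
  next
    case (step n)
    have "E (Suc n) = E n \<union> R n" "E n \<inter> R n = {}"
      using step(1) by (auto simp: E_def R_def S_def le_Suc_eq not_le[symmetric])
    then have e: "emeasure ?M (E (Suc n)) = emeasure ?M (E n) + emeasure ?M (R n)"
      using plus_emeasure[OF sets_E[OF step(1)] sets_R[OF step(1)]] by simp
    have "S n = R n \<union> S (Suc n)" "R n \<inter> S (Suc n) = {}"
      using step(1) by (auto simp: R_def S_def atLeastAtMostSuc_conv)
    then have i: "?I (S n) (Suc n) = ?I (R n) (Suc n) + ?I (S (Suc n)) (Suc n)"
      using nn_integral_indicator_split[OF sets_R[OF step(1)] sets_S[of "Suc n"]
          borel_measurable_state[of "h (Suc n)" "Suc n"]] step(1) by simp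
    have "c * emeasure ?M (E (Suc n)) + ?I (S (Suc n)) (Suc n) =
        c * emeasure ?M (E n) + (c * emeasure ?M (R n) + ?I (S (Suc n)) (Suc n))"
      by (simp add: e distrib_left add.assoc)
    also have "\<dots> \<le> c * emeasure ?M (E n) + (?I (R n) (Suc n) + ?I (S (Suc n)) (Suc n))"
      using sets_R[OF step(1)] by (intro add_left_mono add_right_mono markov) (auto simp: R_def)
    also have "\<dots> = c * emeasure ?M (E n) + ?I (S n) (Suc n)"
      by (simp only: i)
    also have "\<dots> \<le> c * emeasure ?M (E n) + ?I (S n) n"
    proof (rule add_left_mono)
      show "?I (S n) (Suc n) \<le> ?I (S n) n"
      proof (rule nn_integral_past_next_le[OF past_S[OF step(1)]])
        show "AE \<omega> in ?M. \<omega> \<in> S n \<longrightarrow> (\<integral>\<^sup>+t. h (Suc n) t \<partial>Defs.step \<alpha> p (\<omega> n)) \<le> h n (\<omega> n)"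
          using super[OF step(1)] by eventually_elim (use step(1) in \<open>auto simp: S_def\<close>)
      qed
    qed
    also note step.IH
    finally show ?case .
  qed
  have "A \<inter> {\<omega>. \<exists>k\<ge>N. h k (\<omega> k) \<ge> c} = (\<Union>n. E (N + n))" (is "?L = ?R")
  proof (intro equalityI subsetI)
    fix \<omega> assume "\<omega> \<in> ?L"
    then obtain k where "\<omega> \<in> A" "k \<ge> N" "h k (\<omega> k) \<ge> c"
      by blast
    then have "\<omega> \<in> E (N + (k - N))"
      unfolding E_def by (auto intro!: bexI[of _ k])
    then show "\<omega> \<in> ?R"
      by blast
  qed (auto simp: E_def)
  moreover have "(SUP n. emeasure ?M (E (N + n))) = emeasure ?M (\<Union>n. E (N + n))"
  proof (rule SUP_emeasure_incseq)
    show "range (\<lambda>n. E (N + n)) \<subseteq> sets ?M"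
      using sets_E[OF le_add1] by blast
    show "incseq (\<lambda>n. E (N + n))"
      unfolding incseq_def E_def by fastforce
  qed
  ultimately have "c * emeasure ?M (A \<inter> {\<omega>. \<exists>k\<ge>N. h k (\<omega> k) \<ge> c}) = (SUP n. c * emeasure ?M (E (N + n)))"
    by (simp only: flip: SUP_mult_left_ennreal)
  also have "\<dots> \<le> ?I A N"
  proof (rule SUP_least)
    show "c * emeasure ?M (E (N + n)) \<le> ?I A N" for n
      using main[of "N + n"] by (simp add: le_add1 order_trans[OF _ main[of "N + n"]])
  qed
  finally show ?thesis .
qed

text \<open>Each step before the hit costs \<open>c n\<close> in expectation, while
  \<open>\<Psi>\<close> starts at most at \<open>B\<close> and cannot become negative, being valued
  in \<open>ennreal\<close>. A positive probability of never hitting would bound the partial sums of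
  \<open>c\<close>.\<close>

lemma supermartingale_hits:
  fixes \<Psi> :: "nat \<Rightarrow> config \<Rightarrow> ennreal" and c :: "nat \<Rightarrow> real"
  assumes super: "\<And>n. n \<ge> N \<Longrightarrow> AE \<omega> in urn_law s0 \<alpha> p. \<omega> n \<notin> U n \<longrightarrow>
      (\<integral>\<^sup>+t. \<Psi> (Suc n) t \<partial>step \<alpha> p (\<omega> n)) + ennreal (c n) \<le> \<Psi> n (\<omega> n)"
    and bound: "\<And>s. \<Psi> N s \<le> ennreal B"
    and c: "\<And>n. n \<ge> N \<Longrightarrow> c n \<ge> 0"
    and diverges: "\<And>b. \<exists>n. (\<Sum>k=N..<n. c k) > b"
  shows "AE \<omega> in urn_law s0 \<alpha> p. \<exists>k\<ge>N. \<omega> k \<in> U k"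
proof -
  let ?M = "urn_law s0 \<alpha> p"
  interpret prob_space ?M by (rule prob_space_urn_law)
  define S where "S = (\<lambda>n. {\<omega>::nat \<Rightarrow> config. \<forall>k\<in>{N..n}. \<omega> k \<notin> U k})"
  define S' where "S' = {\<omega>::nat \<Rightarrow> config. \<forall>k\<ge>N. \<omega> k \<notin> U k}"
  let ?I = "\<lambda>B n. \<integral>\<^sup>+\<omega>. indicator B \<omega> * \<Psi> n (\<omega> n) \<partial>?M"
  have past_S: "past n (S n)" for n
    unfolding S_def by (auto intro!: past_Collect ball_cong)
  have sets_S: "S n \<in> sets ?M" for n
    by (rule sets_past[OF past_S])
  have S': "S' = (\<Inter>n. S n)"
    by (auto simp: S_def S'_def) (meson atLeastAtMost_iff order_refl)
  then have sets_S': "S' \<in> sets ?M"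
    using sets_S by (simp add: sets.countable_INT'')
  have main: "ennreal (\<Sum>k=N..<n. c k) * emeasure ?M S' + ?I (S n) n \<le> ennreal B" if "n \<ge> N" for n
    using that
  proof (induction n rule: dec_induct)
    case base
    have "?I (S N) N \<le> (\<integral>\<^sup>+\<omega>. ennreal B \<partial>?M)"
      by (intro nn_integral_mono) (auto simp: indicator_def bound)
    then show ?case
      by (simp add: emeasure_space_1)
  next
    case (step n)
    have "S (Suc n) \<subseteq> S n" "S' \<subseteq> S n"
      by (auto simp: S_def S'_def)
    then have "?I (S (Suc n)) (Suc n) + ennreal (c n) * emeasure ?M S' \<le>
        ?I (S n) (Suc n) + ennreal (c n) * emeasure ?M (S n)"
      using sets_S[of n]
      by (intro add_mono nn_integral_mono mult_left_mono emeasure_mono mult_right_mono)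
         (auto split: split_indicator)
    also have "ennreal (c n) * emeasure ?M (S n) = (\<integral>\<^sup>+\<omega>. ennreal (c n) * indicator (S n) \<omega> \<partial>?M)"
      by (simp add: nn_integral_cmult_indicator sets_S)
    also have "?I (S n) (Suc n) = (\<integral>\<^sup>+\<omega>. indicator (S n) \<omega> * (\<integral>\<^sup>+t. \<Psi> (Suc n) t \<partial>Defs.step \<alpha> p (\<omega> n)) \<partial>?M)"
      by (rule nn_integral_past_next[OF past_S])
    also have "\<dots> + (\<integral>\<^sup>+\<omega>. ennreal (c n) * indicator (S n) \<omega> \<partial>?M) =
        (\<integral>\<^sup>+\<omega>. indicator (S n) \<omega> * (\<integral>\<^sup>+t. \<Psi> (Suc n) t \<partial>Defs.step \<alpha> p (\<omega> n)) + ennreal (c n) * indicator (S n) \<omega> \<partial>?M)"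
      using sets_S[of n]
      by (intro nn_integral_add[symmetric] borel_measurable_times_ennreal borel_measurable_indicator
            borel_measurable_const borel_measurable_state[of "\<lambda>s. \<integral>\<^sup>+t. \<Psi> (Suc n) t \<partial>Defs.step \<alpha> p s"])
    also have "\<dots> \<le> ?I (S n) n"
      by (intro nn_integral_mono_AE, use super[OF step(1)] in eventually_elim)
         (use step(1) in \<open>auto simp: S_def indicator_def\<close>)
    finally have "?I (S (Suc n)) (Suc n) + ennreal (c n) * emeasure ?M S' \<le> ?I (S n) n" .
    then have "ennreal (\<Sum>k=N..<n. c k) * emeasure ?M S' + (?I (S (Suc n)) (Suc n) + ennreal (c n) * emeasure ?M S')
        \<le> ennreal B"
      using step.IH add_left_mono order_trans by blast
    moreover have "ennreal (\<Sum>k=N..<Suc n. c k) = ennreal (\<Sum>k=N..<n. c k) + ennreal (c n)"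
      using step(1) c by (subst ennreal_plus[symmetric]) (auto intro: sum_nonneg)
    ultimately show ?case
      by (simp only: distrib_right ac_simps) (simp only: distrib_left ac_simps)
  qed
  have "emeasure ?M S' = 0"
  proof (rule ccontr)
    assume "emeasure ?M S' \<noteq> 0"
    then have m: "measure ?M S' > 0"
      by (simp add: emeasure_eq_measure zero_less_measure_iff)
    obtain n where n: "(\<Sum>k=N..<n. c k) > max 0 B / measure ?M S'"
      using diverges by blast
    have "n \<ge> N"
    proof (rule ccontr)
      assume "\<not> n \<ge> N"
      with n m show False by (simp add: divide_less_0_iff)
    qed
    have "ennreal (\<Sum>k=N..<n. c k) * emeasure ?M S' \<le> ennreal B"
      by (rule order_trans[OF _ main[OF \<open>n \<ge> N\<close>]]) simp
    then have "ennreal ((\<Sum>k=N..<n. c k) * measure ?M S') \<le> ennreal (max 0 B)"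
      by (subst ennreal_mult) (auto simp: emeasure_eq_measure ennreal_max_0 intro!: sum_nonneg c)
    then have "(\<Sum>k=N..<n. c k) * measure ?M S' \<le> max 0 B"
      by (subst (asm) ennreal_le_iff) auto
    with n m show False
      by (auto simp: field_simps max_def split: if_splits)
  qed
  then have "AE \<omega> in ?M. \<omega> \<notin> S'"
    using sets_S' by (intro AE_not_in) (auto simp: null_sets_def)
  then show ?thesis
    by eventually_elim (auto simp: S'_def)
qed

section \<open>Zero-one arguments from finite pasts\<close>

text \<open>The events approximable in measure by finite-past events contain the coordinate
  generators and are closed under complement and countable union; a union is first truncated to
  \<open>k\<close> members.\<close>

lemma approx_past:
  assumes B: "B \<in> sets (urn_law s0 \<alpha> p)" and "\<epsilon> > 0"
  shows "\<exists>n A. past n A \<and> measure (urn_law s0 \<alpha> p) ((B - A) \<union> (A - B)) < \<epsilon>"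
proof -
  let ?M = "urn_law s0 \<alpha> p"
  interpret prob_space ?M by (rule prob_space_urn_law)
  let ?G = "{{f \<in> Pi\<^sub>E UNIV (\<lambda>_. space (count_space UNIV)). f i \<in> A} | i A.
      i \<in> (UNIV :: nat set) \<and> A \<in> sets (count_space (UNIV :: config set))}"
  have "B \<in> sigma_sets (Pi\<^sub>E UNIV (\<lambda>_. space (count_space UNIV))) ?G"
    using B unfolding sets_urn_law sets_PiM_single .
  then have "\<forall>\<epsilon>>0. \<exists>n A. past n A \<and> prob ((B - A) \<union> (A - B)) < \<epsilon>"
  proof (induction rule: sigma_sets.induct)
    case (Basic a)
    then obtain i :: nat and A :: "config set" where "a = {f. f i \<in> A}"
      by (auto simp: PiE_def)
    then have "past i a"
      by (auto intro!: past_Collect)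
    then show ?case
      by (auto intro!: exI[of _ i] exI[of _ a])
  next
    case Empty
    have "past 0 {}"
      by (simp add: past_def)
    then show ?case
      by (auto intro!: exI[of _ "0::nat"] exI[of _ "{} :: (nat \<Rightarrow> config) set"])
  next
    case (Compl a)
    show ?case
    proof (intro allI impI)
      fix \<epsilon> :: real assume "\<epsilon> > 0"
      then obtain n A where "past n A" "prob ((a - A) \<union> (A - a)) < \<epsilon>"
        using Compl.IH by blast
      moreover have "((UNIV - a) - - A) \<union> (- A - (UNIV - a)) = (a - A) \<union> (A - a)"
        by blast
      ultimately show "\<exists>n A. past n A \<and> prob ((Pi\<^sub>E UNIV (\<lambda>_. space (count_space UNIV)) - a - A) \<union>
          (A - (Pi\<^sub>E UNIV (\<lambda>_. space (count_space UNIV)) - a))) < \<epsilon>"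
        by (intro exI[of _ n] exI[of _ "- A"]) (simp add: past_Compl PiE_def)
    qed
  next
    case (Union a)
    have a: "a i \<in> sets ?M" for i
      using Union.hyps[of i] unfolding sets_urn_law sets_PiM_single .
    show ?case
    proof (intro allI impI)
      fix \<epsilon> :: real assume \<epsilon>: "\<epsilon> > 0"
      have "(\<lambda>k. prob (\<Union>i<k. a i)) \<longlonglongrightarrow> prob (\<Union>k. \<Union>i<k. a i)"
        using a by (intro finite_Lim_measure_incseq) (auto simp: incseq_def intro: order_less_le_trans)
      also have "(\<Union>k. \<Union>i<k. a i) = (\<Union>i. a i)"
        by auto
      finally have "\<forall>\<^sub>F k in sequentially. dist (prob (\<Union>i<k. a i)) (prob (\<Union>i. a i)) < \<epsilon> / 2"
        using \<epsilon> by (intro tendstoD) auto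
      then obtain k where k: "dist (prob (\<Union>i<k. a i)) (prob (\<Union>i. a i)) < \<epsilon> / 2"
        by (auto simp: eventually_sequentially)
      \<comment> \<open>The \<open>k\<close> approximations together contribute at most
        \<epsilon>/2; the added 1 avoids a zero denominator.\<close>
      define \<delta> where "\<delta> = \<epsilon> / (2 * (real k + 1))"
      have "\<delta> > 0"
        using \<epsilon> by (simp add: \<delta>_def)
      then have "\<forall>i. \<exists>n A. past n A \<and> prob ((a i - A) \<union> (A - a i)) < \<delta>"
        using Union.IH by blast
      then obtain n A where A: "\<And>i. past (n i) (A i)" "\<And>i. prob ((a i - A i) \<union> (A i - a i)) < \<delta>"
        by metis
      have sets_A: "A i \<in> sets ?M" for i
        by (rule sets_past[OF A(1)])
      let ?A = "\<Union>i<k. A i"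
      have past: "past (Max (n ` {..<k})) ?A"
        by (intro past_Union past_mono[OF A(1)]) auto
      have "((\<Union>i. a i) - ?A) \<union> (?A - (\<Union>i. a i)) \<subseteq>
          ((\<Union>i. a i) - (\<Union>i<k. a i)) \<union> (\<Union>i<k. (a i - A i) \<union> (A i - a i))"
        by blast
      then have "prob (((\<Union>i. a i) - ?A) \<union> (?A - (\<Union>i. a i))) \<le>
          prob (((\<Union>i. a i) - (\<Union>i<k. a i)) \<union> (\<Union>i<k. (a i - A i) \<union> (A i - a i)))"
        using a sets_A by (intro finite_measure_mono) auto
      moreover have "\<dots> \<le> prob ((\<Union>i. a i) - (\<Union>i<k. a i)) + prob (\<Union>i<k. (a i - A i) \<union> (A i - a i))"
        using a sets_A by (intro measure_Un_le) auto
      moreover have "prob ((\<Union>i. a i) - (\<Union>i<k. a i)) < \<epsilon> / 2"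
      proof -
        have "prob ((\<Union>i. a i) - (\<Union>i<k. a i)) = prob (\<Union>i. a i) - prob (\<Union>i<k. a i)"
          using a by (intro finite_measure_Diff) auto
        then show ?thesis
          using k by (simp add: dist_real_def abs_if split: if_splits)
      qed
      moreover have "prob (\<Union>i<k. (a i - A i) \<union> (A i - a i)) \<le> (\<Sum>i<k. prob ((a i - A i) \<union> (A i - a i)))"
        using a sets_A by (intro measure_subadditive_finite) auto
      moreover have "\<dots> \<le> (\<Sum>i<k. \<delta>)"
        using A(2) by (intro sum_mono less_imp_le)
      moreover have "\<dots> \<le> \<epsilon> / 2"
        using \<epsilon> by (simp add: \<delta>_def field_simps)
      ultimately have "prob (((\<Union>i. a i) - ?A) \<union> (?A - (\<Union>i. a i))) < \<epsilon>"
        by linarith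
      then show "\<exists>n A. past n A \<and> prob (((\<Union>i. a i) - A) \<union> (A - (\<Union>i. a i))) < \<epsilon>"
        using past by (intro exI conjI) auto
    qed
  qed
  then show ?thesis
    using \<open>\<epsilon> > 0\<close> by blast
qed

text \<open>An elementary form of Levy's zero-one law: a past event close to the complement of
  \<open>D\<close> would have to give half of its mass to \<open>D\<close>.\<close>

lemma measure_eq_1_if_past_half:
  assumes D: "D \<in> sets (urn_law s0 \<alpha> p)"
    and half: "\<And>n A. n \<ge> N \<Longrightarrow> past n A \<Longrightarrow>
      measure (urn_law s0 \<alpha> p) (A - D) \<le> measure (urn_law s0 \<alpha> p) A / 2"
  shows "measure (urn_law s0 \<alpha> p) D = 1"
proof -
  let ?M = "urn_law s0 \<alpha> p"
  interpret prob_space ?M by (rule prob_space_urn_law)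
  have D': "- D \<in> sets ?M"
    using D sets.compl_sets[of D ?M] by (simp add: space_urn_law Compl_eq_Diff_UNIV)
  have "prob (- D) \<le> 0"
  proof (rule field_le_epsilon)
    fix \<epsilon> :: real assume "\<epsilon> > 0"
    \<comment> \<open>With m = \<open>prob (- D)\<close> the estimates below give m \<le> (m +
      \<epsilon>/3) / 2 + \<epsilon>/3, that is m \<le> \<epsilon>.\<close>
    then obtain n A where A: "past n A" "prob ((- D - A) \<union> (A - - D)) < \<epsilon> / 3"
      using approx_past[OF D', of "\<epsilon> / 3"] by auto
    have sets_A: "A \<in> sets ?M"
      by (rule sets_past) fact
    have "prob (- D) \<le> prob ((A - D) \<union> ((- D - A) \<union> (A - - D)))"
      using D D' sets_A by (intro finite_measure_mono) auto
    moreover have "\<dots> \<le> prob (A - D) + prob ((- D - A) \<union> (A - - D))"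
      using D D' sets_A by (intro measure_Un_le) auto
    moreover have "prob (A - D) \<le> prob A / 2"
      using half[of "max n N" A] past_mono[OF A(1)] by simp
    moreover have "prob A \<le> prob (- D \<union> ((- D - A) \<union> (A - - D)))"
      using D D' sets_A by (intro finite_measure_mono) auto
    moreover have "\<dots> \<le> prob (- D) + prob ((- D - A) \<union> (A - - D))"
      using D D' sets_A by (intro measure_Un_le) auto
    ultimately show "prob (- D) \<le> 0 + \<epsilon>"
      using A(2) by linarith
  qed
  moreover have "prob (- D) = 1 - prob D"
    using prob_compl[OF D] by (simp add: space_urn_law Compl_eq_Diff_UNIV)
  ultimately show ?thesis
    using prob_le_1[of D] by simp
qed

text \<open>A strong Markov argument: \<open>T i\<close> is the part of \<open>A\<close> whose first
  visit to \<open>U\<close> from time \<open>n\<close> on happens at time \<open>n + i\<close>. Each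
  part gives at least half of its mass to \<open>D\<close>, and almost surely the parts exhaust
  \<open>A\<close>.\<close>

lemma measure_eq_1_if_absorbed:
  assumes D: "D \<in> sets (urn_law s0 \<alpha> p)"
    and half: "\<And>n A. n \<ge> N \<Longrightarrow> past n A \<Longrightarrow> (\<And>\<omega>. \<omega> \<in> A \<Longrightarrow> \<omega> n \<in> U n) \<Longrightarrow>
      measure (urn_law s0 \<alpha> p) (A - D) \<le> measure (urn_law s0 \<alpha> p) A / 2"
    and hits: "\<And>n. n \<ge> N \<Longrightarrow> AE \<omega> in urn_law s0 \<alpha> p. \<exists>k\<ge>n. \<omega> k \<in> U k"
  shows "measure (urn_law s0 \<alpha> p) D = 1"
proof (rule measure_eq_1_if_past_half[OF D])
  let ?M = "urn_law s0 \<alpha> p"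
  interpret prob_space ?M by (rule prob_space_urn_law)
  fix n A assume n: "n \<ge> N" and A: "past n A"
  define T where "T = (\<lambda>i. A \<inter> {\<omega>. \<omega> (n + i) \<in> U (n + i) \<and> (\<forall>j<i. \<omega> (n + j) \<notin> U (n + j))})"
  have past_T: "past (n + i) (T i)" for i
    unfolding T_def using past_mono[OF A] by (auto intro!: past_Int past_Collect conj_cong all_cong)
  have sets_T: "T i \<in> sets ?M" for i
    by (rule sets_past[OF past_T])
  have disj: "disjoint_family T"
    unfolding disjoint_family_on_def by (auto simp: T_def) (metis linorder_neqE_nat)
  have A_T: "AE \<omega> in ?M. \<omega> \<in> A \<longrightarrow> \<omega> \<in> (\<Union>i. T i)"
    using hits[OF n]
  proof eventually_elim
    case (elim \<omega>)
    then have ex: "\<exists>i. \<omega> (n + i) \<in> U (n + i)"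
      by (metis le_add_diff_inverse)
    show ?case
      using LeastI_ex[OF ex] not_less_Least[of _ "\<lambda>i. \<omega> (n + i) \<in> U (n + i)"] by (auto simp: T_def)
  qed
  have "prob (A - D) \<le> prob (\<Union>i. T i - D)"
    using A_T sets_T D sets_past[OF A] by (intro finite_measure_mono_AE) auto
  also have "\<dots> \<le> (\<Sum>i. prob (T i) / 2)"
  proof (rule order_trans)
    have s: "summable (\<lambda>i. prob (T i))"
      using finite_measure_UNION[OF _ disj] sets_T by (auto simp: sums_iff)
    have le: "prob (T i - D) \<le> prob (T i) / 2" for i
      using n by (intro half[OF _ past_T]) (auto simp: T_def)
    have "disjoint_family (\<lambda>i. T i - D)"
      using disj by (auto simp: disjoint_family_on_def)
    then have u: "(\<lambda>i. prob (T i - D)) sums prob (\<Union>i. T i - D)"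
      using sets_T D by (intro finite_measure_UNION) auto
    then have s': "summable (\<lambda>i. prob (T i - D))"
      by (rule sums_summable)
    show "prob (\<Union>i. T i - D) \<le> (\<Sum>i. prob (T i - D))"
      using u by (simp add: sums_iff)
    show "(\<Sum>i. prob (T i - D)) \<le> (\<Sum>i. prob (T i) / 2)"
      by (intro suminf_le le s' summable_divide s)
  qed
  also have "\<dots> = prob (\<Union>i. T i) / 2"
    using finite_measure_UNION[OF _ disj] sets_T by (subst suminf_divide) (auto simp: sums_iff)
  also have "\<dots> \<le> prob A / 2"
    using sets_past[OF A] by (intro divide_right_mono finite_measure_mono) (auto simp: T_def)
  finally show "prob (A - D) \<le> prob A / 2" .
qed

section \<open>Drift in the black fractions\<close>

text \<open>The function \<open>g\<close> of the overview; the weights are homogeneous, so a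
  nonempty urn enters a draw only through its black fraction.\<close>

definition share :: "real \<Rightarrow> real \<Rightarrow> real" where
  "share \<alpha> x = x powr \<alpha> / (x powr \<alpha> + (1 - x) powr \<alpha>)"

definition balls :: "urn \<Rightarrow> nat" where "balls u = black u + red u"
definition bfrac :: "urn \<Rightarrow> real" where "bfrac u = real (black u) / real (balls u)"

text \<open>The step kernel acts on all configurations, but the time-dependent formulas hold only
  for those with the right ball counts; \<open>AE_level\<close> shows that the process stays among
  them.\<close>

definition level :: "config \<Rightarrow> nat \<Rightarrow> config \<Rightarrow> bool" where
  "level s0 n s \<longleftrightarrow> balls (fst s) = n + balls (fst s0) \<and> balls (snd s) = n + balls (snd s0)"

lemma bfrac_bounds: "bfrac u \<in> {0..1}"
  by (auto simp: bfrac_def balls_def divide_simps)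

lemma black_share_eq_share:
  assumes "balls u \<noteq> 0"
  shows "black_share \<alpha> u = share \<alpha> (bfrac u)"
proof -
  let ?t = "real (balls u)"
  have t: "?t > 0"
    using assms by simp
  then have "1 - bfrac u = real (red u) / ?t"
    by (simp add: bfrac_def field_simps) (simp add: balls_def)
  then have e: "bfrac u powr \<alpha> = real (black u) powr \<alpha> / ?t powr \<alpha>"
    "(1 - bfrac u) powr \<alpha> = real (red u) powr \<alpha> / ?t powr \<alpha>"
    using t by (simp_all add: bfrac_def powr_divide)
  show ?thesis
    using t unfolding black_share_def weight_def share_def e
    by (simp add: add_divide_distrib[symmetric])
qed

lemma bfrac_add_ball:
  assumes "balls u \<noteq> 0"
  shows "bfrac (add_ball \<xi> u) = bfrac u + (of_bool \<xi> - bfrac u) / (real (balls u) + 1)"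
proof -
  have t: "real (balls u) > 0"
    using assms by simp
  have "real (balls (add_ball \<xi> u)) = real (balls u) + 1"
    by (simp add: add_ball_def balls_def)
  then show ?thesis
    using t by (simp add: bfrac_def divide_simps) (simp add: add_ball_def algebra_simps)
qed

lemma balls_add_ball: "balls (add_ball \<xi> u) = Suc (balls u)"
  by (simp add: add_ball_def balls_def)

text \<open>Mean of \<open>f\<close> at two independent Bernoulli variables, written out so that
  moment identities become polynomial identities.\<close>

definition bern2 :: "real \<Rightarrow> real \<Rightarrow> (real \<Rightarrow> real \<Rightarrow> real) \<Rightarrow> real" where
  "bern2 q1 q2 f = q1 * (q2 * f 1 1 + (1 - q2) * f 1 0) + (1 - q1) * (q2 * f 0 1 + (1 - q2) * f 0 0)"

lemma bern2_mono:
  assumes "q1 \<in> {0..1}" "q2 \<in> {0..1}" "\<And>a b. a \<in> {0, 1} \<Longrightarrow> b \<in> {0, 1} \<Longrightarrow> f a b \<le> f' a b"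
  shows "bern2 q1 q2 f \<le> bern2 q1 q2 f'"
  unfolding bern2_def using assms
  by (intro add_mono mult_left_mono) auto

lemma bern2_const [simp]: "bern2 q1 q2 (\<lambda>_ _. c) = c"
  by (simp add: bern2_def algebra_simps)

lemma nn_integral_step:
  fixes f :: "config \<Rightarrow> real"
  assumes p: "p \<in> {0..1}" and f: "\<And>s. f s \<ge> 0"
    and F: "\<And>\<xi>1 \<xi>2. f (add_ball \<xi>1 (fst s), add_ball \<xi>2 (snd s)) = F (of_bool \<xi>1) (of_bool \<xi>2)"
  shows "(\<integral>\<^sup>+t. ennreal (f t) \<partial>step \<alpha> p s) =
    ennreal (bern2 (draw_prob \<alpha> p s (fst s)) (draw_prob \<alpha> p s (snd s)) F)"
proof -
  have q: "draw_prob \<alpha> p s u \<in> {0..1}" for u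
    using p by (rule draw_prob_bounds)
  have nn: "F (of_bool \<xi>1) (of_bool \<xi>2) \<ge> 0" for \<xi>1 \<xi>2
    unfolding F[symmetric] by (rule f)
  show ?thesis
    using q[of "fst s"] q[of "snd s"] nn[of True True] nn[of True False] nn[of False True] nn[of False False]
    by (simp add: step_def nn_integral_pair_pmf' case_prod_unfold F bern2_def ennreal_mult[symmetric]
          ennreal_plus[symmetric] mult.commute del: ennreal_plus)
qed

text \<open>At time \<open>n\<close> the urns contain \<open>n + t1\<close> and \<open>n + t2\<close> balls, with fractions \<open>x\<close> and \<open>y\<close> of black ones.\<close>

definition pool :: "nat \<Rightarrow> nat \<Rightarrow> nat \<Rightarrow> real \<Rightarrow> real \<Rightarrow> real" where
  "pool t1 t2 n x y = (real (n + t1) * x + real (n + t2) * y) / (real (n + t1) + real (n + t2))"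

text \<open>Mean of \<open>h\<close> at the black fractions after one more draw. It makes sense for
  all real \<open>x\<close> and \<open>y\<close>, not only for attainable fractions, so that drift
  estimates are pure real analysis; \<open>nn_integral_step_frac\<close> connects it with the
  kernel.\<close>

definition expect :: "real \<Rightarrow> real \<Rightarrow> nat \<Rightarrow> nat \<Rightarrow> nat \<Rightarrow> (real \<Rightarrow> real \<Rightarrow> real) \<Rightarrow> real \<Rightarrow> real \<Rightarrow> real" where
  "expect \<alpha> p t1 t2 n h x y =
     bern2 (p * share \<alpha> (pool t1 t2 n x y) + (1 - p) * share \<alpha> x)
           (p * share \<alpha> (pool t1 t2 n x y) + (1 - p) * share \<alpha> y)
       (\<lambda>a b. h (x + (a - x) / (real (n + t1) + 1)) (y + (b - y) / (real (n + t2) + 1)))"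

lemma nn_integral_step_frac:
  fixes h :: "real \<Rightarrow> real \<Rightarrow> real"
  assumes p: "p \<in> {0..1}" and h: "\<And>x y. x \<in> {0..1} \<Longrightarrow> y \<in> {0..1} \<Longrightarrow> h x y \<ge> 0"
    and lev: "level s0 n s" and t: "balls (fst s0) \<ge> 1" "balls (snd s0) \<ge> 1"
  shows "(\<integral>\<^sup>+t. ennreal (h (bfrac (fst t)) (bfrac (snd t))) \<partial>step \<alpha> p s) =
    ennreal (expect \<alpha> p (balls (fst s0)) (balls (snd s0)) n h (bfrac (fst s)) (bfrac (snd s)))"
proof -
  have nz: "balls (fst s) \<noteq> 0" "balls (snd s) \<noteq> 0" "balls (pooled s) \<noteq> 0"
    using lev t by (auto simp: level_def pooled_def balls_def)
  have b: "real (black u) = bfrac u * real (balls u)" if "balls u \<noteq> 0" for u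
    using that by (simp add: bfrac_def)
  have pool: "bfrac (pooled s) = pool (balls (fst s0)) (balls (snd s0)) n (bfrac (fst s)) (bfrac (snd s))"
  proof -
    have "bfrac (pooled s) = (real (black (fst s)) + real (black (snd s))) / (real (balls (fst s)) + real (balls (snd s)))"
      by (simp add: bfrac_def pooled_def balls_def algebra_simps)
    then show ?thesis
      using lev by (simp add: b nz level_def pool_def mult.commute)
  qed
  have q: "draw_prob \<alpha> p s u =
      p * share \<alpha> (pool (balls (fst s0)) (balls (snd s0)) n (bfrac (fst s)) (bfrac (snd s))) + (1 - p) * share \<alpha> (bfrac u)"
    if "balls u \<noteq> 0" for u
    using nz(3) that by (simp add: draw_prob_def black_share_eq_share pool)
  have T: "balls (fst s) = n + balls (fst s0)" "balls (snd s) = n + balls (snd s0)"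
    using lev by (simp_all add: level_def)
  show ?thesis
    unfolding expect_def q[OF nz(1), symmetric] q[OF nz(2), symmetric] T[symmetric]
    by (intro nn_integral_step[OF p]) (auto simp only: bfrac_add_ball[OF nz(1)] bfrac_add_ball[OF nz(2)] h bfrac_bounds fst_conv snd_conv)
qed

lemma share_bounds: "share \<alpha> x \<in> {0..1}"
  by (auto simp: share_def divide_simps) (smt (verit) powr_ge_zero)+

lemma add_fraction_bounds:
  fixes x a t :: real
  assumes "x \<in> {0..1}" "a \<in> {0, 1}" "t \<ge> 0"
  shows "x + (a - x) / (t + 1) \<in> {0..1}"
proof -
  have "x + (a - x) / (t + 1) = (x * t + a) / (t + 1)"
    using assms by (simp add: field_simps)
  then show ?thesis
    using assms mult_left_le_one_le[of t x] by (auto simp: divide_simps)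
qed

lemma mixture_bounds:
  assumes "p \<in> {0..1}"
  shows "p * share \<alpha> u + (1 - p) * share \<alpha> v \<in> {0..1}"
  using convexD_alt[of "{0..1::real}" "share \<alpha> v" "share \<alpha> u" p] assms share_bounds
  by (simp add: add.commute)

lemma expect_mono:
  assumes "p \<in> {0..1}" "x \<in> {0..1}" "y \<in> {0..1}"
    and "\<And>x y. x \<in> {0..1} \<Longrightarrow> y \<in> {0..1} \<Longrightarrow> h x y \<le> h' x y"
  shows "expect \<alpha> p t1 t2 n h x y \<le> expect \<alpha> p t1 t2 n h' x y"
  unfolding expect_def using assms
  by (intro bern2_mono mixture_bounds assms(4) add_fraction_bounds) auto

lemma expect_nonneg:
  assumes "p \<in> {0..1}" "x \<in> {0..1}" "y \<in> {0..1}"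
    and "\<And>x y. x \<in> {0..1} \<Longrightarrow> y \<in> {0..1} \<Longrightarrow> h x y \<ge> 0"
  shows "expect \<alpha> p t1 t2 n h x y \<ge> 0"
  using expect_mono[OF assms(1-3), of "\<lambda>_ _. 0" h] assms(4) by (simp add: expect_def)

lemma AE_level:
  shows "AE \<omega> in urn_law s0 \<alpha> p. level s0 n (\<omega> n)"
proof (induction n)
  case 0
  interpret prob_space "urn_law s0 \<alpha> p" by (rule prob_space_urn_law)
  have "prob {\<omega>. \<forall>i\<le>0. \<omega> i = s0} = 1"
    using urn_law_path[of s0 \<alpha> p 0 "\<lambda>_. s0"] by simp
  then have "AE \<omega> in urn_law s0 \<alpha> p. \<omega> 0 = s0"
    by (subst (asm) prob_eq_1) (auto intro: sets_Collect_state[of "\<lambda>s. s = s0"])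
  then show ?case
    by eventually_elim (simp add: level_def)
next
  case (Suc n)
  let ?M = "urn_law s0 \<alpha> p"
  have le: "(\<integral>\<^sup>+t. indicator {t. \<not> level s0 (Suc n) t} t \<partial>step \<alpha> p s) = 0" if "level s0 n s" for s
  proof -
    have "AE t in step \<alpha> p s. level s0 (Suc n) t"
      using that by (auto simp: AE_measure_pmf_iff step_def level_def balls_add_ball)
    then show ?thesis
      by (subst nn_integral_0_iff_AE) auto
  qed
  have sets: "{\<omega>. \<not> level s0 (Suc n) (\<omega> (Suc n))} \<in> sets ?M"
    by (rule sets_Collect_state)
  have "emeasure ?M {\<omega>. \<not> level s0 (Suc n) (\<omega> (Suc n))} =
      (\<integral>\<^sup>+\<omega>. indicator UNIV \<omega> * indicator {t. \<not> level s0 (Suc n) t} (\<omega> (Suc n)) \<partial>?M)"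
    by (subst nn_integral_indicator[OF sets, symmetric]) (auto intro!: nn_integral_cong simp: indicator_def)
  also have "\<dots> \<le> (\<integral>\<^sup>+\<omega>. indicator UNIV \<omega> * 0 \<partial>?M)"
    by (rule nn_integral_past_next_le[where f'="\<lambda>_. 0"]) (use Suc in \<open>auto simp only: past_def le\<close>)
  finally have "emeasure ?M {\<omega>. \<not> level s0 (Suc n) (\<omega> (Suc n))} = 0"
    by simp
  then show ?case
    using sets AE_not_in[of "{\<omega>. \<not> level s0 (Suc n) (\<omega> (Suc n))}" ?M] by (auto simp: null_sets_def)
qed

lemma frac_level:
  "level s0 n (\<omega> n) \<Longrightarrow> x_frac s0 \<omega> n = bfrac (fst (\<omega> n)) \<and> y_frac s0 \<omega> n = bfrac (snd (\<omega> n))"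
  by (simp add: x_frac_def y_frac_def bfrac_def level_def balls_def)

text \<open>The maximal inequality in terms of the fractions. Starting at most at half the exit
  level makes the exit probability at most 1/2, the form in which both the antisymmetric equilibrium
  and the sinks use it.\<close>

lemma frac_maximal:
  fixes h :: "nat \<Rightarrow> real \<Rightarrow> real \<Rightarrow> real"
  assumes p: "p \<in> {0..1}" and t: "balls (fst s0) \<ge> 1" "balls (snd s0) \<ge> 1"
    and A: "past N A" and c: "c > 0"
    and start: "\<And>\<omega>. \<omega> \<in> A \<Longrightarrow> h N (bfrac (fst (\<omega> N))) (bfrac (snd (\<omega> N))) \<le> c / 2"
    and h: "\<And>n x y. n \<ge> N \<Longrightarrow> x \<in> {0..1} \<Longrightarrow> y \<in> {0..1} \<Longrightarrow> h n x y \<ge> 0"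
    and super: "\<And>n x y. n \<ge> N \<Longrightarrow> x \<in> {0..1} \<Longrightarrow> y \<in> {0..1} \<Longrightarrow> h n x y < c \<Longrightarrow>
      expect \<alpha> p (balls (fst s0)) (balls (snd s0)) n (h (Suc n)) x y \<le> h n x y"
  shows "measure (urn_law s0 \<alpha> p) (A \<inter> {\<omega>. \<exists>k\<ge>N. h k (bfrac (fst (\<omega> k))) (bfrac (snd (\<omega> k))) \<ge> c})
    \<le> measure (urn_law s0 \<alpha> p) A / 2"
proof -
  let ?M = "urn_law s0 \<alpha> p"
  interpret prob_space ?M by (rule prob_space_urn_law)
  let ?h = "\<lambda>n s. ennreal (h n (bfrac (fst s)) (bfrac (snd s)))"
  let ?B = "A \<inter> {\<omega>. \<exists>k\<ge>N. ennreal c \<le> ?h k (\<omega> k)}"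
  have B: "?B = A \<inter> {\<omega>. \<exists>k\<ge>N. h k (bfrac (fst (\<omega> k))) (bfrac (snd (\<omega> k))) \<ge> c}"
    using c by (auto simp: ennreal_le_iff2)
  have "ennreal c * emeasure ?M ?B \<le> (\<integral>\<^sup>+\<omega>. indicator A \<omega> * ?h N (\<omega> N) \<partial>?M)"
  proof (rule supermartingale_maximal[OF A])
    fix n assume n: "n \<ge> N"
    show "AE \<omega> in ?M. ?h n (\<omega> n) < ennreal c \<longrightarrow>
        (\<integral>\<^sup>+t. ?h (Suc n) t \<partial>step \<alpha> p (\<omega> n)) \<le> ?h n (\<omega> n)"
      using AE_level[of s0 n \<alpha> p]
    proof eventually_elim
      case (elim \<omega>)
      have fb: "bfrac (fst (\<omega> n)) \<in> {0..1}" "bfrac (snd (\<omega> n)) \<in> {0..1}"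
        by (rule bfrac_bounds)+
      show ?case
      proof
        assume "?h n (\<omega> n) < ennreal c"
        then have "h n (bfrac (fst (\<omega> n))) (bfrac (snd (\<omega> n))) < c"
          using h[OF n fb] by (simp add: ennreal_less_iff)
        then have "expect \<alpha> p (balls (fst s0)) (balls (snd s0)) n (h (Suc n)) (bfrac (fst (\<omega> n))) (bfrac (snd (\<omega> n)))
            \<le> h n (bfrac (fst (\<omega> n))) (bfrac (snd (\<omega> n)))"
          by (intro super n fb)
        moreover have "(\<integral>\<^sup>+t. ?h (Suc n) t \<partial>step \<alpha> p (\<omega> n)) =
            ennreal (expect \<alpha> p (balls (fst s0)) (balls (snd s0)) n (h (Suc n)) (bfrac (fst (\<omega> n))) (bfrac (snd (\<omega> n))))"
          using n by (intro nn_integral_step_frac[OF p _ elim t] h) auto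
        ultimately show "(\<integral>\<^sup>+t. ?h (Suc n) t \<partial>step \<alpha> p (\<omega> n)) \<le> ?h n (\<omega> n)"
          by (simp add: ennreal_leI)
      qed
    qed
  qed
  also have "\<dots> \<le> (\<integral>\<^sup>+\<omega>. ennreal (c / 2) * indicator A \<omega> \<partial>?M)"
    by (intro nn_integral_mono) (auto simp: indicator_def intro!: ennreal_leI start)
  also have "\<dots> = ennreal (c / 2) * emeasure ?M A"
    by (rule nn_integral_cmult_indicator) (rule sets_past[OF A])
  finally have "c * measure ?M ?B \<le> c / 2 * measure ?M A"
    using c by (simp add: emeasure_eq_measure ennreal_mult[symmetric])
  then show ?thesis
    using c unfolding B by (simp add: field_simps)
qed

lemma frac_hits:
  fixes \<Psi> :: "nat \<Rightarrow> real \<Rightarrow> real \<Rightarrow> real" and c :: "nat \<Rightarrow> real"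
  assumes p: "p \<in> {0..1}" and t: "balls (fst s0) \<ge> 1" "balls (snd s0) \<ge> 1"
    and \<Psi>: "\<And>n x y. n \<ge> N \<Longrightarrow> x \<in> {0..1} \<Longrightarrow> y \<in> {0..1} \<Longrightarrow> \<Psi> n x y \<in> {0..B}"
    and c: "\<And>n. n \<ge> N \<Longrightarrow> c n \<ge> 0"
    and super: "\<And>n x y. n \<ge> N \<Longrightarrow> x \<in> {0..1} \<Longrightarrow> y \<in> {0..1} \<Longrightarrow> \<not> U x y \<Longrightarrow>
      expect \<alpha> p (balls (fst s0)) (balls (snd s0)) n (\<Psi> (Suc n)) x y + c n \<le> \<Psi> n x y"
    and diverges: "\<And>b. \<exists>n. (\<Sum>k=N..<n. c k) > b"
  shows "AE \<omega> in urn_law s0 \<alpha> p. \<exists>k\<ge>N. U (bfrac (fst (\<omega> k))) (bfrac (snd (\<omega> k)))"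
proof -
  let ?M = "urn_law s0 \<alpha> p"
  let ?h = "\<lambda>n s. ennreal (\<Psi> n (bfrac (fst s)) (bfrac (snd s)))"
  have "AE \<omega> in ?M. \<exists>k\<ge>N. \<omega> k \<in> {s. U (bfrac (fst s)) (bfrac (snd s))}"
  proof (rule supermartingale_hits[where \<Psi>="?h" and c=c and B=B])
    show "?h N s \<le> ennreal B" for s
      using \<Psi>[of N "bfrac (fst s)" "bfrac (snd s)"] bfrac_bounds by (intro ennreal_leI) auto
    show "\<And>n. n \<ge> N \<Longrightarrow> c n \<ge> 0" by (rule c)
    show "\<And>b. \<exists>n. (\<Sum>k=N..<n. c k) > b" by (rule diverges)
    fix n assume n: "n \<ge> N"
    show "AE \<omega> in ?M. \<omega> n \<notin> {s. U (bfrac (fst s)) (bfrac (snd s))} \<longrightarrow>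
        (\<integral>\<^sup>+t. ?h (Suc n) t \<partial>step \<alpha> p (\<omega> n)) + ennreal (c n) \<le> ?h n (\<omega> n)"
      using AE_level[of s0 n \<alpha> p]
    proof eventually_elim
      case (elim \<omega>)
      let ?x = "bfrac (fst (\<omega> n))" and ?y = "bfrac (snd (\<omega> n))"
      have fb: "?x \<in> {0..1}" "?y \<in> {0..1}"
        by (rule bfrac_bounds)+
      have eq: "(\<integral>\<^sup>+t. ?h (Suc n) t \<partial>step \<alpha> p (\<omega> n)) =
          ennreal (expect \<alpha> p (balls (fst s0)) (balls (snd s0)) n (\<Psi> (Suc n)) ?x ?y)"
        using n \<Psi>[of "Suc n"] by (intro nn_integral_step_frac[OF p _ elim t]) auto
      show ?case
      proof
        assume "\<omega> n \<notin> {s. U (bfrac (fst s)) (bfrac (snd s))}"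
        then have le: "expect \<alpha> p (balls (fst s0)) (balls (snd s0)) n (\<Psi> (Suc n)) ?x ?y + c n \<le> \<Psi> n ?x ?y"
          using super[OF n fb] by simp
        show "(\<integral>\<^sup>+t. ?h (Suc n) t \<partial>step \<alpha> p (\<omega> n)) + ennreal (c n) \<le> ?h n (\<omega> n)"
          unfolding eq using c[OF n] le \<Psi>[of "Suc n"] n expect_nonneg[OF p fb, where h="\<Psi> (Suc n)"]
          by (subst ennreal_plus[symmetric]) (auto intro!: ennreal_leI simp del: ennreal_plus)
      qed
    qed
  qed
  then show ?thesis
    by simp
qed

section \<open>Calculus of the share function\<close>

lemma share_denominator_pos: "0 < x powr \<alpha> + (1 - x) powr \<alpha>" for x :: real
proof (cases "x = 0")
  case False
  then have "x powr \<alpha> > 0" by simp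
  then show ?thesis by (simp add: add_pos_nonneg)
qed simp

lemma share_0 [simp]: "share \<alpha> 0 = 0" and share_1 [simp]: "share \<alpha> 1 = 1"
  by (simp_all add: share_def)

lemma share_compl: "share \<alpha> (1 - x) = 1 - share \<alpha> x"
  using share_denominator_pos[of x \<alpha>] by (simp add: share_def field_simps)

lemma share_half: "share \<alpha> (1/2) = 1/2"
  using share_compl[of \<alpha> "1/2"] by simp

definition share_deriv :: "real \<Rightarrow> real \<Rightarrow> real" where
  "share_deriv \<alpha> x = \<alpha> * (x powr (\<alpha> - 1) * (1 - x) powr (\<alpha> - 1)) / (x powr \<alpha> + (1 - x) powr \<alpha>)\<^sup>2"

lemma powr_eq_mult_powr: "x powr \<alpha> = x * x powr (\<alpha> - 1)" if "x > 0" for x :: real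
  using that by (simp add: powr_diff)

lemma DERIV_share:
  assumes "0 < x" "x < 1"
  shows "(share \<alpha> has_real_derivative share_deriv \<alpha> x) (at x)"
proof -
  let ?a = "x powr (\<alpha> - 1)" and ?b = "(1 - x) powr (\<alpha> - 1)"
  have "((\<lambda>x. x powr \<alpha> / (x powr \<alpha> + (1 - x) powr \<alpha>)) has_real_derivative
      ((\<alpha> * ?a) * (x powr \<alpha> + (1 - x) powr \<alpha>) - x powr \<alpha> * (\<alpha> * ?a - \<alpha> * ?b)) /
      ((x powr \<alpha> + (1 - x) powr \<alpha>) * (x powr \<alpha> + (1 - x) powr \<alpha>))) (at x)"
    using assms share_denominator_pos[of x \<alpha>]
    by (auto intro!: derivative_eq_intros simp: powr_diff)
  also have "((\<alpha> * ?a) * (x powr \<alpha> + (1 - x) powr \<alpha>) - x powr \<alpha> * (\<alpha> * ?a - \<alpha> * ?b)) /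
      ((x powr \<alpha> + (1 - x) powr \<alpha>) * (x powr \<alpha> + (1 - x) powr \<alpha>)) = share_deriv \<alpha> x"
  proof -
    have "(\<alpha> * ?a) * (x powr \<alpha> + (1 - x) powr \<alpha>) - x powr \<alpha> * (\<alpha> * ?a - \<alpha> * ?b) = \<alpha> * (?a * ?b)"
      using assms by (simp add: powr_eq_mult_powr[of _ \<alpha>] algebra_simps)
    then show ?thesis
      by (simp add: share_deriv_def power2_eq_square)
  qed
  finally show ?thesis
    by (simp add: share_def[abs_def])
qed

lemma continuous_on_share: "\<alpha> > 0 \<Longrightarrow> continuous_on {0..1} (share \<alpha>)"
  unfolding share_def[abs_def] using share_denominator_pos[THEN less_imp_neq, of _ \<alpha>]
  by (intro continuous_on_divide continuous_on_add continuous_on_powr' continuous_on_diff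
        continuous_on_const continuous_on_id ballI) (auto simp: eq_commute[of 0])

lemma share_deriv_nonneg: "\<alpha> \<ge> 0 \<Longrightarrow> share_deriv \<alpha> x \<ge> 0"
  by (simp add: share_deriv_def)

lemma share_MVT:
  assumes "\<alpha> > 0" "0 \<le> x" "x < y" "y \<le> 1"
  obtains z where "x < z" "z < y" "share \<alpha> y - share \<alpha> x = (y - x) * share_deriv \<alpha> z"
proof -
  have "continuous_on {x..y} (share \<alpha>)"
    using assms by (intro continuous_on_subset[OF continuous_on_share]) auto
  moreover have "(share \<alpha> has_derivative (*) (share_deriv \<alpha> z)) (at z)" if "x < z" "z < y" for z
    using DERIV_share[of z \<alpha>] that assms by (simp add: has_field_derivative_def)
  ultimately show ?thesis
    using mvt[OF \<open>x < y\<close>, of "share \<alpha>" "\<lambda>z. (*) (share_deriv \<alpha> z)"] that by (auto simp: mult.commute)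
qed

lemma share_mono:
  assumes "\<alpha> > 0" "0 \<le> x" "x \<le> y" "y \<le> 1"
  shows "share \<alpha> x \<le> share \<alpha> y"
proof (cases "x = y")
  case False
  then obtain z where "share \<alpha> y - share \<alpha> x = (y - x) * share_deriv \<alpha> z"
    using share_MVT[of \<alpha> x y] assms by auto
  moreover have "(y - x) * share_deriv \<alpha> z \<ge> 0"
    using assms share_deriv_nonneg[of \<alpha> z] by simp
  ultimately show ?thesis by simp
qed simp

text \<open>For \<open>x\<close> at most 1/2 the odds \<open>(1 - x) / x\<close> are at least 1, so
  their powers grow with the exponent. Comparison with exponents 1 and 2 later replaces calculations
  with general \<alpha>.\<close>

lemma share_antimono_exponent:
  assumes "0 \<le> x" "x \<le> 1/2" "\<beta> \<le> \<alpha>" "\<beta> > 0"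
  shows "share \<alpha> x \<le> share \<beta> x"
proof (cases "x = 0")
  case False
  have e: "share \<gamma> x = 1 / (1 + ((1 - x) / x) powr \<gamma>)" for \<gamma>
  proof -
    have "((1 - x) / x) powr \<gamma> = (1 - x) powr \<gamma> / x powr \<gamma>"
      using assms False by (simp add: powr_divide)
    moreover have "x powr \<gamma> > 0" "1 + ((1 - x) / x) powr \<gamma> > 0"
      using False by (simp_all add: add_pos_nonneg)
    ultimately show ?thesis
      using share_denominator_pos[of x \<gamma>] unfolding share_def by (simp add: divide_simps algebra_simps)
  qed
  have "((1 - x) / x) powr \<beta> \<le> ((1 - x) / x) powr \<alpha>"
    using assms False by (intro powr_mono) (auto simp: field_simps)
  moreover have "1 + ((1 - x) / x) powr \<beta> > 0"
    by (simp add: add_pos_nonneg)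
  ultimately show ?thesis
    unfolding e by (intro divide_left_mono) (auto intro!: mult_pos_pos add_pos_nonneg)
qed simp

lemma share_exponent_1: "share 1 x = x" if "x \<in> {0..1}"
  using that by (simp add: share_def)

lemma share_2: "share 2 x = x\<^sup>2 / (x\<^sup>2 + (1 - x)\<^sup>2)" if "x \<in> {0..1}"
  using that by (simp add: share_def powr_numeral)

lemma share_le_square:
  assumes "\<alpha> \<ge> 2" "0 \<le> x" "x \<le> 1/2"
  shows "share \<alpha> x \<le> 2 * x\<^sup>2"
proof -
  have "share \<alpha> x \<le> share 2 x"
    using assms by (intro share_antimono_exponent) auto
  also have "\<dots> = x\<^sup>2 / (x\<^sup>2 + (1 - x)\<^sup>2)"
    using assms by (intro share_2) auto
  also have "\<dots> \<le> x\<^sup>2 / (1/2)"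
  proof (rule divide_left_mono)
    have "x\<^sup>2 + (1 - x)\<^sup>2 - 1/2 = 2 * (x - 1/2)\<^sup>2"
      by (simp add: power2_eq_square field_simps)
    moreover have "2 * (x - 1/2)\<^sup>2 \<ge> 0" by simp
    ultimately show "1/2 \<le> x\<^sup>2 + (1 - x)\<^sup>2" by linarith
    then show "0 < (x\<^sup>2 + (1 - x)\<^sup>2) * (1/2)" by simp
  qed simp
  finally show ?thesis by simp
qed

text \<open>On the left half \<open>share\<close> lies below the identity and the difference of the
  two variances factors; the right half follows by symmetry.\<close>

lemma share_variance_le:
  assumes "\<alpha> \<ge> 1" "x \<in> {0..1}"
  shows "share \<alpha> x * (1 - share \<alpha> x) \<le> x * (1 - x)"
proof -
  have le: "share \<alpha> x * (1 - share \<alpha> x) \<le> x * (1 - x)" if "0 \<le> x" "x \<le> 1/2" for x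
  proof -
    have s: "share \<alpha> x \<le> x"
      using share_antimono_exponent[of x 1 \<alpha>] share_exponent_1[of x] assms that by auto
    have "x * (1 - x) - share \<alpha> x * (1 - share \<alpha> x) = (x - share \<alpha> x) * (1 - x - share \<alpha> x)"
      by (simp add: algebra_simps)
    also have "\<dots> \<ge> 0"
      using s that by (intro mult_nonneg_nonneg) auto
    finally show ?thesis by simp
  qed
  show ?thesis
  proof (cases "x \<le> 1/2")
    case False
    then show ?thesis
      using le[of "1 - x"] assms by (simp add: share_compl mult.commute)
  qed (use le assms in auto)
qed

text \<open>\<open>share\<close> solves the logistic equation x (1 - x) g' = \<alpha> g (1 - g), so
  the variance comparison bounds the slope by \<alpha>, its value at 1/2.\<close>

lemma share_deriv_le:
  assumes "\<alpha> \<ge> 1" "0 < x" "x < 1"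
  shows "share_deriv \<alpha> x \<le> \<alpha>"
proof -
  have "1 - share \<alpha> x = (1 - x) powr \<alpha> / (x powr \<alpha> + (1 - x) powr \<alpha>)"
    using share_compl[of \<alpha> x] by (simp add: share_def add.commute)
  then have "share_deriv \<alpha> x * (x * (1 - x)) = \<alpha> * (share \<alpha> x * (1 - share \<alpha> x))"
    using assms powr_eq_mult_powr[of x \<alpha>] powr_eq_mult_powr[of "1 - x" \<alpha>]
    by (simp add: share_deriv_def share_def power2_eq_square)
  also have "\<dots> \<le> \<alpha> * (x * (1 - x))"
    using assms by (intro mult_left_mono share_variance_le) auto
  finally show ?thesis
    using assms by simp
qed

lemma share_lipschitz:
  assumes "\<alpha> \<ge> 1" "x \<in> {0..1}" "y \<in> {0..1}"
  shows "\<bar>share \<alpha> x - share \<alpha> y\<bar> \<le> \<alpha> * \<bar>x - y\<bar>"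
proof -
  have "\<bar>share \<alpha> x - share \<alpha> y\<bar> \<le> \<alpha> * \<bar>x - y\<bar>" if xy: "0 \<le> x" "x < y" "y \<le> 1" for x y
  proof -
    obtain z where z: "x < z" "z < y" "share \<alpha> y - share \<alpha> x = (y - x) * share_deriv \<alpha> z"
      using share_MVT[of \<alpha> x y] assms(1) xy by auto
    have "(y - x) * share_deriv \<alpha> z \<le> (y - x) * \<alpha>"
      using z xy assms by (intro mult_left_mono share_deriv_le) auto
    then show ?thesis
      using z share_mono[of \<alpha> x y] xy assms by (simp add: abs_if mult.commute)
  qed
  from this[of x y] this[of y x] assms show ?thesis
    by (cases x y rule: linorder_cases) (auto simp: abs_minus_commute)
qed

lemma share_increment_le:
  assumes "\<alpha> > 0" "x \<in> {0..b}" "y \<in> {0..b}" "b \<le> 1"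
    and K: "\<And>z. 0 < z \<Longrightarrow> z < b \<Longrightarrow> share_deriv \<alpha> z \<le> K"
  shows "(share \<alpha> x - share \<alpha> y) * (x - y) \<le> K * (x - y)\<^sup>2"
proof -
  have le: "(share \<alpha> x - share \<alpha> y) * (x - y) \<le> K * (x - y)\<^sup>2" if xy: "0 \<le> y" "y < x" "x \<le> b" for x y
  proof -
    obtain z where z: "y < z" "z < x" "share \<alpha> x - share \<alpha> y = (x - y) * share_deriv \<alpha> z"
      using share_MVT[of \<alpha> y x] assms(1,4) xy by auto
    have "share_deriv \<alpha> z * (x - y)\<^sup>2 \<le> K * (x - y)\<^sup>2"
      using z xy by (intro mult_right_mono K) auto
    then show ?thesis
      using z by (simp add: power2_eq_square ac_simps)
  qed
  have "(share \<alpha> x - share \<alpha> y) * (x - y) = (share \<alpha> y - share \<alpha> x) * (y - x)"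
    "(x - y)\<^sup>2 = (y - x)\<^sup>2"
    by (simp_all add: power2_eq_square algebra_simps)
  with le[of x y] le[of y x] assms show ?thesis
    by (cases x y rule: linorder_cases) auto
qed

text \<open>Unequal initial totals make the pooled fraction a weighted mean; its deviation from the
  plain average is (t1 - t2) (x - y) over twice the total number of balls, hence O(1 / n).\<close>

lemma pool_approx:
  assumes "n \<ge> 1" "x \<in> {0..1}" "y \<in> {0..1}"
  shows "\<bar>pool t1 t2 n x y - (x + y) / 2\<bar> \<le> real (t1 + t2) / real n"
    and "pool t1 t2 n x y \<in> {0..1}"
proof -
  let ?T1 = "real (n + t1)" and ?T2 = "real (n + t2)"
  have T: "?T1 > 0" "?T2 > 0" "?T1 + ?T2 > 0" "?T1 + ?T2 \<ge> real n"
    using assms by auto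
  have "pool t1 t2 n x y - (x + y) / 2 = (real t1 - real t2) * (x - y) / (2 * (?T1 + ?T2))"
    using T(3) unfolding pool_def by (simp add: field_simps)
  then have "\<bar>pool t1 t2 n x y - (x + y) / 2\<bar> = \<bar>real t1 - real t2\<bar> * \<bar>x - y\<bar> / (2 * (?T1 + ?T2))"
    using T by (simp add: abs_mult)
  also have "\<dots> \<le> (real (t1 + t2) * 1) / (1 * real n)"
    using assms T by (intro frac_le mult_mono) auto
  finally show "\<bar>pool t1 t2 n x y - (x + y) / 2\<bar> \<le> real (t1 + t2) / real n"
    by simp
  have "?T1 * x + ?T2 * y \<le> ?T1 * 1 + ?T2 * 1"
    using assms T by (intro add_mono mult_left_mono) auto
  then show "pool t1 t2 n x y \<in> {0..1}"
    using assms T by (auto simp: pool_def divide_simps)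
qed

text \<open>The mean-field drift of a black fraction \<open>z\<close> when the average fraction is \<open>m\<close>.\<close>

definition drift :: "real \<Rightarrow> real \<Rightarrow> real \<Rightarrow> real \<Rightarrow> real" where
  "drift \<alpha> p m z = p * share \<alpha> m + (1 - p) * share \<alpha> z - z"

lemma drift_bounds: "p \<in> {0..1} \<Longrightarrow> z \<in> {0..1} \<Longrightarrow> \<bar>drift \<alpha> p m z\<bar> \<le> 1"
  using mixture_bounds[of p \<alpha> m z] by (auto simp: drift_def)

text \<open>Two errors of order 1 / n^2 add up: the pooled fraction is replaced by the average,
  using the Lipschitz bound, and the step 1 / (n + t + 1) by 1 / n. They are summable, so later
  estimates can work with the autonomous field.\<close>

lemma drift_approx:
  assumes "\<alpha> \<ge> 1" "p \<in> {0..1}" "n \<ge> 1" "x \<in> {0..1}" "y \<in> {0..1}" "z \<in> {0..1}" "t \<le> t1 + t2"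
  shows "\<bar>drift \<alpha> p (pool t1 t2 n x y) z / (real (n + t) + 1) - drift \<alpha> p ((x + y) / 2) z / real n\<bar>
    \<le> (real (t1 + t2) * (1 + \<alpha>) + 1) / (real n)\<^sup>2"
proof -
  let ?c = "real (t1 + t2)" and ?m = "pool t1 t2 n x y" and ?F = "drift \<alpha> p ((x + y) / 2) z"
  have n: "real n > 0" using assms by simp
  have pl: "?m \<in> {0..1}" "\<bar>?m - (x + y) / 2\<bar> \<le> ?c / real n"
    using pool_approx[of n x y] assms by auto
  have "\<bar>drift \<alpha> p ?m z - ?F\<bar> = p * \<bar>share \<alpha> ?m - share \<alpha> ((x + y) / 2)\<bar>"
    using assms by (simp add: drift_def abs_mult[symmetric] algebra_simps)
       (metis abs_mult abs_of_nonneg right_diff_distrib)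
  also have "\<dots> \<le> 1 * (\<alpha> * (?c / real n))"
  proof (intro mult_mono)
    have "\<bar>share \<alpha> ?m - share \<alpha> ((x + y) / 2)\<bar> \<le> \<alpha> * \<bar>?m - (x + y) / 2\<bar>"
      using assms pl by (intro share_lipschitz) auto
    also have "\<dots> \<le> \<alpha> * (?c / real n)"
      using assms pl by (intro mult_left_mono) auto
    finally show "\<bar>share \<alpha> ?m - share \<alpha> ((x + y) / 2)\<bar> \<le> \<alpha> * (?c / real n)" .
  qed (use assms in auto)
  finally have d: "\<bar>drift \<alpha> p ?m z - ?F\<bar> \<le> \<alpha> * ?c / real n" by simp
  have "\<bar>(drift \<alpha> p ?m z - ?F) / (real (n + t) + 1)\<bar> \<le> (\<alpha> * ?c / real n) / real n"
    unfolding abs_divide using n d by (intro frac_le) auto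
  moreover have "\<bar>?F / (real (n + t) + 1) - ?F / real n\<bar> \<le> (?c + 1) / (real n)\<^sup>2"
  proof -
    have "?F / (real (n + t) + 1) - ?F / real n = - (?F * (real t + 1)) / ((real (n + t) + 1) * real n)"
      using n by (simp add: field_simps)
    then have "\<bar>?F / (real (n + t) + 1) - ?F / real n\<bar> = \<bar>?F\<bar> * (real t + 1) / ((real (n + t) + 1) * real n)"
      using n by (simp add: abs_mult)
    also have "\<dots> \<le> 1 * (?c + 1) / (real n * real n)"
      using n assms by (intro frac_le mult_mono drift_bounds) auto
    finally show ?thesis by (simp add: power2_eq_square)
  qed
  moreover have "drift \<alpha> p ?m z / (real (n + t) + 1) - ?F / real n =
      (drift \<alpha> p ?m z - ?F) / (real (n + t) + 1) + (?F / (real (n + t) + 1) - ?F / real n)"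
    by (simp add: diff_divide_distrib)
  ultimately have "\<bar>drift \<alpha> p ?m z / (real (n + t) + 1) - ?F / real n\<bar> \<le>
      (\<alpha> * ?c / real n) / real n + (?c + 1) / (real n)\<^sup>2"
    by linarith
  also have "\<dots> = (?c * (1 + \<alpha>) + 1) / (real n)\<^sup>2"
    using n by (simp add: power2_eq_square field_simps)
  finally show ?thesis .
qed

section \<open>A stable antisymmetric equilibrium\<close>

text \<open>The two colour hypotheses put both colours into the pooled urn, and p > 0 mixes its
  share into each draw. As counts never decrease, the hypotheses persist along a path.\<close>

lemma draw_prob_in_open_unit:
  assumes "0 < p" "p < 1" "red (fst s) \<ge> 1" "black (snd s) \<ge> 1"
  shows "0 < draw_prob \<alpha> p s u" "draw_prob \<alpha> p s u < 1"
proof -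
  have sh: "0 < black_share \<alpha> (pooled s)" "black_share \<alpha> (pooled s) < 1"
    using assms by (auto simp: black_share_def weight_def pooled_def divide_simps add_pos_pos)
  have u: "0 \<le> black_share \<alpha> u" "black_share \<alpha> u \<le> 1"
    by (auto simp: black_share_def weight_def divide_simps) (smt (verit) powr_ge_zero)+
  show "0 < draw_prob \<alpha> p s u"
    unfolding draw_prob_def using sh u assms by (intro add_pos_nonneg) auto
  have "p * black_share \<alpha> (pooled s) < p * 1"
    using sh assms by (intro mult_strict_left_mono) auto
  moreover have "(1 - p) * black_share \<alpha> u \<le> (1 - p) * 1"
    using u assms by (intro mult_left_mono) auto
  ultimately show "draw_prob \<alpha> p s u < 1"
    unfolding draw_prob_def by simp
qed

lemma pmf_step_pos:
  assumes "0 < p" "p < 1" "red (fst s) \<ge> 1" "black (snd s) \<ge> 1"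
  shows "pmf (step \<alpha> p s) (add_ball \<xi>1 (fst s), add_ball \<xi>2 (snd s)) > 0"
proof -
  have "0 < draw_prob \<alpha> p s u \<and> draw_prob \<alpha> p s u < 1" for u
    using draw_prob_in_open_unit[of p s \<alpha> u] assms by simp
  then have "(\<xi>1, \<xi>2) \<in> set_pmf (pair_pmf (bernoulli_pmf (draw_prob \<alpha> p s (fst s))) (bernoulli_pmf (draw_prob \<alpha> p s (snd s))))"
    by (simp add: set_pmf_bernoulli)
  then have "(add_ball \<xi>1 (fst s), add_ball \<xi>2 (snd s)) \<in> set_pmf (step \<alpha> p s)"
    by (force simp: step_def)
  then show ?thesis
    by (simp add: pmf_positive_iff)
qed

lemma state_reachable:
  assumes p: "0 < p" "p < 1" and s0: "red (fst s0) \<ge> 1" "black (snd s0) \<ge> 1"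
    and "j \<le> n" "k \<le> n"
  shows "emeasure (urn_law s0 \<alpha> p) {\<omega>. \<omega> n =
    ((black (fst s0) + j, red (fst s0) + (n - j)), (black (snd s0) + k, red (snd s0) + (n - k)))} > 0"
  using assms(5,6)
proof (induction n arbitrary: j k)
  case 0
  interpret prob_space "urn_law s0 \<alpha> p" by (rule prob_space_urn_law)
  have "prob {\<omega>. \<forall>i\<le>0. \<omega> i = s0} = 1"
    using urn_law_path[of s0 \<alpha> p 0 "\<lambda>_. s0"] by simp
  then show ?case
    using 0 by (simp add: emeasure_eq_measure)
next
  case (Suc n)
  let ?M = "urn_law s0 \<alpha> p"
  \<comment> \<open>The last draw of an urn is taken black only if all \<open>Suc n\<close> draws
    are black; otherwise it is red, and the required black draws fit into the first
    \<open>n\<close>.\<close>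
  define j' k' where "j' = (if j = Suc n then n else j)" and "k' = (if k = Suc n then n else k)"
  define s where "s = ((black (fst s0) + j', red (fst s0) + (n - j')), (black (snd s0) + k', red (snd s0) + (n - k')))"
  define t where "t = ((black (fst s0) + j, red (fst s0) + (Suc n - j)), (black (snd s0) + k, red (snd s0) + (Suc n - k)))"
  have t: "t = (add_ball (j = Suc n) (fst s), add_ball (k = Suc n) (snd s))"
    using Suc.prems by (auto simp: t_def s_def j'_def k'_def add_ball_def)
  have past: "past n {\<omega>. \<omega> n = s}"
    by (rule past_Collect) simp
  have "0 < emeasure ?M {\<omega>. \<omega> n = s}"
    unfolding s_def using Suc.prems by (intro Suc.IH) (auto simp: j'_def k'_def)
  moreover have "0 < pmf (step \<alpha> p s) t"
    unfolding t using p s0 by (intro pmf_step_pos) (auto simp: s_def)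
  moreover have "emeasure ?M ({\<omega>. \<omega> n = s} \<inter> {\<omega>. \<omega> (Suc n) = t}) =
      ennreal (pmf (step \<alpha> p s) t) * emeasure ?M {\<omega>. \<omega> n = s}"
  proof -
    have "indicator {\<omega>. \<omega> n = s} \<omega> * ennreal (pmf (step \<alpha> p (\<omega> n)) t) =
        ennreal (pmf (step \<alpha> p s) t) * indicator {\<omega>. \<omega> n = s} \<omega>" for \<omega> :: "nat \<Rightarrow> config"
      by (auto simp: indicator_def)
    then show ?thesis
      using sets_past[OF past] by (simp add: emeasure_past_next[OF past] nn_integral_cmult_indicator)
  qed
  ultimately have "0 < emeasure ?M ({\<omega>. \<omega> n = s} \<inter> {\<omega>. \<omega> (Suc n) = t})"
    by (simp add: ennreal_zero_less_mult_iff)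
  also have "\<dots> \<le> emeasure ?M {\<omega>. \<omega> (Suc n) = t}"
    by (intro emeasure_mono sets_Collect_state[of "\<lambda>s. s = t"]) auto
  finally show ?case
    by (simp add: t_def)
qed

lemma AE_frac:
  "AE \<omega> in urn_law s0 \<alpha> p. \<forall>n. x_frac s0 \<omega> n = bfrac (fst (\<omega> n)) \<and> y_frac s0 \<omega> n = bfrac (snd (\<omega> n))"
  unfolding AE_all_countable
proof
  show "AE \<omega> in urn_law s0 \<alpha> p. x_frac s0 \<omega> n = bfrac (fst (\<omega> n)) \<and> y_frac s0 \<omega> n = bfrac (snd (\<omega> n))" for n
    using AE_level[of s0 n \<alpha> p] by eventually_elim (rule frac_level)
qed

lemma bern2_add: "bern2 q1 q2 (\<lambda>a b. f a + (g b + r)) =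
    (q1 * f 1 + (1 - q1) * f 0) + (q2 * g 1 + (1 - q2) * g 0) + r"
  by (simp add: bern2_def algebra_simps)

lemma second_moment_le:
  fixes q x u \<tau> :: real
  assumes "q \<in> {0..1}" "x \<in> {0..1}"
  shows "q * (u + (1 - x) * \<tau>)\<^sup>2 + (1 - q) * (u + (0 - x) * \<tau>)\<^sup>2 \<le> u\<^sup>2 + 2 * u * ((q - x) * \<tau>) + \<tau>\<^sup>2"
proof -
  have "q * (1 - x)\<^sup>2 + (1 - q) * x\<^sup>2 \<le> q * 1 + (1 - q) * 1"
    using assms by (intro add_mono mult_left_mono power_le_one) auto
  then have "(q * (1 - x)\<^sup>2 + (1 - q) * x\<^sup>2) * \<tau>\<^sup>2 \<le> 1 * \<tau>\<^sup>2"
    by (intro mult_right_mono) auto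
  moreover have "q * (u + (1 - x) * \<tau>)\<^sup>2 + (1 - q) * (u + (0 - x) * \<tau>)\<^sup>2 =
      u\<^sup>2 + 2 * u * ((q - x) * \<tau>) + (q * (1 - x)\<^sup>2 + (1 - q) * x\<^sup>2) * \<tau>\<^sup>2"
    by (simp add: power2_eq_square algebra_simps)
  ultimately show ?thesis by simp
qed

text \<open>Near an antisymmetric equilibrium \<open>(x0, 1 - x0)\<close> the drift is contracting as soon as
  \<open>p * \<alpha> + (1 - p) * K \<le> 1\<close>: the pooled share has slope at most \<open>\<alpha>\<close>, the individual ones at most \<open>K\<close>.\<close>

lemma antisymmetric_drift_contracting:
  assumes "\<alpha> \<ge> 1" "p \<in> {0..1}" "x \<in> {0..b}" "1 - y \<in> {0..b}" "x0 \<in> {0..b}" "b \<le> 1"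
    and K: "\<And>z. 0 < z \<Longrightarrow> z < b \<Longrightarrow> share_deriv \<alpha> z \<le> K"
    and eq: "drift \<alpha> p (1/2) x0 = 0" and le: "p * \<alpha> + (1 - p) * K \<le> 1"
  defines "m \<equiv> (x + y) / 2" and "u \<equiv> x - x0" and "v \<equiv> y - (1 - x0)"
  shows "u * drift \<alpha> p m x + v * drift \<alpha> p m y \<le> 0"
proof -
  have "u * (share \<alpha> x - share \<alpha> x0) \<le> K * u\<^sup>2"
    unfolding u_def using share_increment_le[of \<alpha> x b x0 K] assms by (simp add: mult.commute)
  moreover have "v * (share \<alpha> y - (1 - share \<alpha> x0)) \<le> K * v\<^sup>2"
  proof -
    have "v * (share \<alpha> y - (1 - share \<alpha> x0)) = (share \<alpha> (1 - y) - share \<alpha> x0) * ((1 - y) - x0)"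
      by (simp add: v_def share_compl algebra_simps)
    also have "\<dots> \<le> K * ((1 - y) - x0)\<^sup>2"
      using assms by (intro share_increment_le[of \<alpha> _ b]) auto
    also have "((1 - y) - x0)\<^sup>2 = v\<^sup>2"
      by (simp add: v_def power2_eq_square algebra_simps)
    finally show ?thesis .
  qed
  ultimately have 1: "u * (share \<alpha> x - share \<alpha> x0) + v * (share \<alpha> y - (1 - share \<alpha> x0)) \<le> K * (u\<^sup>2 + v\<^sup>2)"
    by (simp add: distrib_left)
  have 2: "(share \<alpha> m - 1/2) * (u + v) \<le> \<alpha> * (u\<^sup>2 + v\<^sup>2)"
  proof -
    define w where "w = m - 1/2"
    have uv: "u + v = 2 * w"
      by (simp add: w_def u_def v_def m_def field_simps)
    have "\<bar>share \<alpha> m - share \<alpha> (1/2)\<bar> \<le> \<alpha> * \<bar>w\<bar>"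
      unfolding w_def using assms by (intro share_lipschitz) auto
    then have "\<bar>share \<alpha> m - 1/2\<bar> * \<bar>w\<bar> \<le> (\<alpha> * \<bar>w\<bar>) * \<bar>w\<bar>"
      by (intro mult_right_mono) (auto simp: share_half)
    then have "(share \<alpha> m - 1/2) * w \<le> \<alpha> * w\<^sup>2"
      by (simp add: power2_eq_square abs_mult[symmetric] mult.assoc)
    then have "(share \<alpha> m - 1/2) * (u + v) \<le> \<alpha> * ((u + v)\<^sup>2 / 2)"
      unfolding uv by (simp add: power2_eq_square)
    also have "\<dots> \<le> \<alpha> * (u\<^sup>2 + v\<^sup>2)"
    proof (rule mult_left_mono)
      have "u\<^sup>2 + v\<^sup>2 - (u + v)\<^sup>2 / 2 = (u - v)\<^sup>2 / 2"
        by (simp add: power2_eq_square field_simps)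
      moreover have "(u - v)\<^sup>2 / 2 \<ge> 0"
        by simp
      ultimately show "(u + v)\<^sup>2 / 2 \<le> u\<^sup>2 + v\<^sup>2"
        by linarith
    qed (use assms(1) in simp)
    finally show ?thesis .
  qed
  have "u * drift \<alpha> p m x + v * drift \<alpha> p m y =
      p * ((share \<alpha> m - 1/2) * (u + v)) +
      (1 - p) * (u * (share \<alpha> x - share \<alpha> x0) + v * (share \<alpha> y - (1 - share \<alpha> x0))) - (u\<^sup>2 + v\<^sup>2)
      + (u - v) * drift \<alpha> p (1/2) x0"
    by (simp add: drift_def share_half u_def v_def power2_eq_square field_simps)
  also have "\<dots> \<le> p * (\<alpha> * (u\<^sup>2 + v\<^sup>2)) + (1 - p) * (K * (u\<^sup>2 + v\<^sup>2)) - (u\<^sup>2 + v\<^sup>2)"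
    unfolding eq mult_zero_right add_0_right
    using assms(2) 1 2 by (intro diff_right_mono add_mono mult_left_mono) auto
  also have "\<dots> = (p * \<alpha> + (1 - p) * K - 1) * (u\<^sup>2 + v\<^sup>2)"
    by (simp add: algebra_simps)
  also have "\<dots> \<le> 0"
    using le by (intro mult_nonpos_nonneg) auto
  finally show ?thesis .
qed

text \<open>With D the constant of \<open>drift_approx\<close>, the linear error costs at most 2 D /
  n^2 per urn and the second moment 1 / n^2 per urn, in total C / n^2. The summand 2 C / n decreases
  by 2 C / (n (n + 1)) \<ge> C / n^2 and pays for it.\<close>

lemma antisymmetric_supermartingale:
  fixes t1 t2 :: nat
  assumes "\<alpha> \<ge> 1" "p \<in> {0..1}" "n \<ge> 1" "x \<in> {0..1}" "y \<in> {0..1}" "x0 \<in> {0..1}"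
    and contracting: "(x - x0) * drift \<alpha> p ((x + y) / 2) x + (y - (1 - x0)) * drift \<alpha> p ((x + y) / 2) y \<le> 0"
  defines "C \<equiv> 4 * (real (t1 + t2) * (1 + \<alpha>) + 1) + 2"
  shows "expect \<alpha> p t1 t2 n (\<lambda>x y. (x - x0)\<^sup>2 + (y - (1 - x0))\<^sup>2 + 2 * C / real (Suc n)) x y
    \<le> (x - x0)\<^sup>2 + (y - (1 - x0))\<^sup>2 + 2 * C / real n"
proof -
  let ?m = "pool t1 t2 n x y" and ?D = "real (t1 + t2) * (1 + \<alpha>) + 1" and ?n = "real n"
  define \<tau>1 \<tau>2 where "\<tau>1 = 1 / (real (n + t1) + 1)" and "\<tau>2 = 1 / (real (n + t2) + 1)"
  define q1 q2 where "q1 = p * share \<alpha> ?m + (1 - p) * share \<alpha> x" and "q2 = p * share \<alpha> ?m + (1 - p) * share \<alpha> y"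
  define u v where "u = x - x0" and "v = y - (1 - x0)"
  let ?Fx = "drift \<alpha> p ((x + y) / 2) x" and ?Fy = "drift \<alpha> p ((x + y) / 2) y"
  have n: "?n > 0" using assms by simp
  have q: "q1 \<in> {0..1}" "q2 \<in> {0..1}"
    unfolding q1_def q2_def by (rule mixture_bounds, fact)+
  have \<tau>: "\<tau>1\<^sup>2 \<le> 1 / ?n\<^sup>2" "\<tau>2\<^sup>2 \<le> 1 / ?n\<^sup>2"
    using n by (auto simp: \<tau>1_def \<tau>2_def power_divide intro!: divide_left_mono power_mono)
  have d: "\<bar>(q1 - x) * \<tau>1 - ?Fx / ?n\<bar> \<le> ?D / ?n\<^sup>2" "\<bar>(q2 - y) * \<tau>2 - ?Fy / ?n\<bar> \<le> ?D / ?n\<^sup>2"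
    using drift_approx[of \<alpha> p n x y x t1 t1 t2] drift_approx[of \<alpha> p n x y y t2 t1 t2] assms
    by (simp_all add: drift_def q1_def q2_def \<tau>1_def \<tau>2_def)
  have uv: "\<bar>u\<bar> \<le> 1" "\<bar>v\<bar> \<le> 1"
    using assms by (auto simp: u_def v_def)
  have D: "?D / ?n\<^sup>2 \<ge> 0"
    using assms by simp
  have e: "a * b \<le> a * F / ?n + ?D / ?n\<^sup>2" if "\<bar>b - F / ?n\<bar> \<le> ?D / ?n\<^sup>2" "\<bar>a\<bar> \<le> 1" for a b F
  proof -
    have "\<bar>a * (b - F / ?n)\<bar> \<le> 1 * (?D / ?n\<^sup>2)"
      unfolding abs_mult using that D by (intro mult_mono) auto
    then show ?thesis
      by (simp add: right_diff_distrib abs_le_iff)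
  qed
  have "expect \<alpha> p t1 t2 n (\<lambda>x y. (x - x0)\<^sup>2 + (y - (1 - x0))\<^sup>2 + 2 * C / real (Suc n)) x y =
      bern2 q1 q2 (\<lambda>a b. (u + (a - x) * \<tau>1)\<^sup>2 + ((v + (b - y) * \<tau>2)\<^sup>2 + 2 * C / real (Suc n)))"
    by (simp add: expect_def q1_def q2_def u_def v_def \<tau>1_def \<tau>2_def algebra_simps)
  also have "\<dots> = (q1 * (u + (1 - x) * \<tau>1)\<^sup>2 + (1 - q1) * (u + (0 - x) * \<tau>1)\<^sup>2) +
      (q2 * (v + (1 - y) * \<tau>2)\<^sup>2 + (1 - q2) * (v + (0 - y) * \<tau>2)\<^sup>2) + 2 * C / real (Suc n)"
    by (rule bern2_add)
  also have "\<dots> \<le> (u\<^sup>2 + 2 * u * ((q1 - x) * \<tau>1) + \<tau>1\<^sup>2) + (v\<^sup>2 + 2 * v * ((q2 - y) * \<tau>2) + \<tau>2\<^sup>2) + 2 * C / real (Suc n)"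
    using q assms(4,5) by (intro add_mono second_moment_le order_refl)
  also have "\<dots> \<le> u\<^sup>2 + v\<^sup>2 + 2 * (u * ?Fx + v * ?Fy) / ?n + C / ?n\<^sup>2 + 2 * C / real (Suc n)"
  proof -
    have "(4 * d + 2) / r = 4 * (d / r) + 2 * (1 / r)" for d r :: real
      by (simp add: add_divide_distrib)
    then have "C / ?n\<^sup>2 = 4 * (?D / ?n\<^sup>2) + 2 * (1 / ?n\<^sup>2)"
      unfolding C_def .
    moreover have "2 * (u * ?Fx + v * ?Fy) / ?n = 2 * (u * ?Fx / ?n) + 2 * (v * ?Fy / ?n)"
      by (simp only: add_divide_distrib distrib_left times_divide_eq_right)
    moreover have "U + 2 * a + s + (V + 2 * b + s') + r \<le> U + V + G + c + r"
      if "c = 4 * d + 2 * t" "G = 2 * a' + 2 * b'" "a \<le> a' + d" "b \<le> b' + d" "s \<le> t" "s' \<le> t"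
      for a b a' b' c d r s s' t U V G :: real
      using that by linarith
    ultimately show ?thesis
      using e[OF d(1) uv(1)] e[OF d(2) uv(2)] \<tau> unfolding mult.assoc by blast
  qed
  also have "\<dots> \<le> u\<^sup>2 + v\<^sup>2 + C / ?n\<^sup>2 + 2 * C / real (Suc n)"
    using contracting n by (simp add: u_def v_def divide_nonpos_pos)
  finally have "expect \<alpha> p t1 t2 n (\<lambda>x y. (x - x0)\<^sup>2 + (y - (1 - x0))\<^sup>2 + 2 * C / real (Suc n)) x y
      \<le> u\<^sup>2 + v\<^sup>2 + C / ?n\<^sup>2 + 2 * C / real (Suc n)" .
  moreover have "C / ?n\<^sup>2 + 2 * C / real (Suc n) \<le> 2 * C / ?n"
  proof -
    have "C \<ge> 0" using assms by (simp add: C_def)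
    have "2 * C / ?n - 2 * C / real (Suc n) - C / ?n\<^sup>2 = C * (?n - 1) / (?n\<^sup>2 * (?n + 1))"
      using n by (simp add: divide_simps power2_eq_square) (simp add: algebra_simps)
    also have "\<dots> \<ge> 0"
      using \<open>C \<ge> 0\<close> assms by simp
    finally show ?thesis by simp
  qed
  ultimately show ?thesis
    by (simp add: u_def v_def)
qed


text \<open>With positive probability the process reaches a state near (x0, 1 - x0) at a late time.
  From there it stays with probability at least 1/2 in a ball where the drift contracts, and this
  ball keeps away from both sinks.\<close>

lemma not_almost_surely_dominant:
  assumes \<alpha>: "\<alpha> \<ge> 1" and p: "0 < p" "p < 1"
    and s0: "red (fst s0) \<ge> 1" "black (snd s0) \<ge> 1"
    and x0: "0 < x0" "x0 < b" "b < 1" and eq: "drift \<alpha> p (1/2) x0 = 0"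
    and K: "\<And>z. 0 < z \<Longrightarrow> z < b \<Longrightarrow> share_deriv \<alpha> z \<le> K"
    and le: "p * \<alpha> + (1 - p) * K \<le> 1"
  shows "measure (urn_law s0 \<alpha> p) (dominance s0) < 1"
proof -
  let ?M = "urn_law s0 \<alpha> p"
  interpret prob_space ?M by (rule prob_space_urn_law)
  define t1 t2 where "t1 = balls (fst s0)" and "t2 = balls (snd s0)"
  define C where "C = 4 * (real (t1 + t2) * (1 + \<alpha>) + 1) + 2"
  define h where "h = (\<lambda>n x y. (x - x0)\<^sup>2 + (y - (1 - x0))\<^sup>2 + 2 * C / real n)"
  \<comment> \<open>Within distance \<delta> both \<open>x\<close> and \<open>1 - y\<close> remain
    in [0, b], where \<open>K\<close> bounds the slope; because b < 1, no sink is within \<delta> of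
    the equilibrium in both coordinates.\<close>
  define \<delta> where "\<delta> = min x0 (b - x0)"
  have t: "t1 \<ge> 1" "t2 \<ge> 1"
    using s0 by (auto simp: t1_def t2_def balls_def)
  have C: "C > 0"
  proof -
    have "real (t1 + t2) * (1 + \<alpha>) \<ge> 0"
      using \<alpha> by (intro mult_nonneg_nonneg) auto
    moreover have "0 < 4 * (r + 1) + 2" if "r \<ge> 0" for r :: real
      using that by simp
    ultimately show ?thesis
      unfolding C_def by blast
  qed
  have \<delta>: "\<delta> > 0"
    using x0 by (simp add: \<delta>_def)
  have sq: "\<bar>z\<bar> < \<delta>" if "z\<^sup>2 < \<delta>\<^sup>2" for z
    using power2_less_imp_less[of "\<bar>z\<bar>" \<delta>] that \<delta> by simp
  \<comment> \<open>\<open>X\<close> and \<open>Y\<close> are the fractions after \<open>n\<close>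
    draws when the floor of x0 n of them are black in urn 1 and equally many are red in urn
    2.\<close>
  define X where "X = (\<lambda>n. (real (black (fst s0)) + real (nat \<lfloor>x0 * real n\<rfloor>)) / (real n + real t1))"
  define Y where "Y = (\<lambda>n. (real (black (snd s0)) + (real n - real (nat \<lfloor>x0 * real n\<rfloor>))) / (real n + real t2))"
  have x0_less_1: "x0 < 1"
    using x0 by simp
  have "X \<longlonglongrightarrow> x0"
    unfolding X_def using x0(1) x0_less_1 by real_asymp
  moreover have "Y \<longlonglongrightarrow> 1 - x0"
    unfolding Y_def using x0(1) x0_less_1 by real_asymp
  moreover have "(\<lambda>n. 2 * C / real n) \<longlonglongrightarrow> 0"
    by real_asymp
  ultimately have "(\<lambda>n. h n (X n) (Y n)) \<longlonglongrightarrow> (x0 - x0)\<^sup>2 + ((1 - x0) - (1 - x0))\<^sup>2 + 0"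
    unfolding h_def by (intro tendsto_intros)
  then have "(\<lambda>n. h n (X n) (Y n)) \<longlonglongrightarrow> 0"
    by simp
  then have "\<forall>\<^sub>F n in sequentially. h n (X n) (Y n) < \<delta>\<^sup>2 / 2"
    using \<delta> by (intro order_tendstoD) auto
  then obtain N where N: "N \<ge> 1" "h N (X N) (Y N) < \<delta>\<^sup>2 / 2"
    using eventually_happens'[OF sequentially_bot eventually_conj[OF eventually_ge_at_top[of 1]]] by blast
  define k where "k = nat \<lfloor>x0 * real N\<rfloor>"
  have "x0 * real N \<le> 1 * real N"
    using x0 by (intro mult_right_mono) auto
  then have k: "k \<le> N"
    unfolding k_def by linarith
  define s where "s = ((black (fst s0) + k, red (fst s0) + (N - k)), (black (snd s0) + (N - k), red (snd s0) + (N - (N - k))))"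
  have s: "bfrac (fst s) = X N" "bfrac (snd s) = Y N"
    using k by (simp_all add: s_def bfrac_def balls_def X_def Y_def t1_def t2_def of_nat_diff ac_simps flip: k_def)
  define A where "A = {\<omega>::nat \<Rightarrow> config. \<omega> N = s}"
  define E where "E = {\<omega>. \<exists>n\<ge>N. h n (bfrac (fst (\<omega> n))) (bfrac (snd (\<omega> n))) \<ge> \<delta>\<^sup>2}"
  have past: "past N A"
    unfolding A_def by (rule past_Collect) simp
  have sets_A: "A \<in> sets ?M"
    by (rule sets_past[OF past])
  have "emeasure ?M A > 0"
    unfolding A_def s_def using p s0 k by (intro state_reachable) auto
  then have A: "prob A > 0"
    by (simp add: emeasure_eq_measure)
  have exit: "prob (A \<inter> E) \<le> prob A / 2"
    unfolding E_def
  proof (rule frac_maximal[OF _ _ _ past])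
    show "p \<in> {0..1}" "\<delta>\<^sup>2 > 0"
      using p \<delta> by auto
    show "balls (fst s0) \<ge> 1" "balls (snd s0) \<ge> 1"
      using t by (simp_all add: t1_def t2_def)
    show "h N (bfrac (fst (\<omega> N))) (bfrac (snd (\<omega> N))) \<le> \<delta>\<^sup>2 / 2" if "\<omega> \<in> A" for \<omega>
      using that N(2) by (simp add: A_def s)
    show "h n x y \<ge> 0" for n x y
      using C by (simp add: h_def)
    fix n x y assume n: "n \<ge> N" and xy: "x \<in> {0..1}" "y \<in> {0..1}" and small: "h n x y < \<delta>\<^sup>2"
    have "2 * C / real n \<ge> 0"
      using C by simp
    then have "(x - x0)\<^sup>2 + (y - (1 - x0))\<^sup>2 < \<delta>\<^sup>2"
      using small by (simp add: h_def)
    then have "(x - x0)\<^sup>2 < \<delta>\<^sup>2" "(y - (1 - x0))\<^sup>2 < \<delta>\<^sup>2"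
      using zero_le_power2[of "x - x0"] zero_le_power2[of "y - (1 - x0)"] by linarith+
    then have "\<bar>x - x0\<bar> < \<delta>" "\<bar>y - (1 - x0)\<bar> < \<delta>"
      by (auto intro: sq)
    then have "x \<in> {0..b}" "1 - y \<in> {0..b}"
      by (auto simp: \<delta>_def)
    then have "(x - x0) * drift \<alpha> p ((x + y) / 2) x + (y - (1 - x0)) * drift \<alpha> p ((x + y) / 2) y \<le> 0"
      using \<alpha> p x0 K eq le by (intro antisymmetric_drift_contracting[where b=b and K=K]) auto
    then show "expect \<alpha> p (balls (fst s0)) (balls (snd s0)) n (h (Suc n)) x y \<le> h n x y"
      unfolding h_def C_def t1_def[symmetric] t2_def[symmetric]
      using \<alpha> p n N(1) xy x0 by (intro antisymmetric_supermartingale) auto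
  qed
  have "AE \<omega> in ?M. \<omega> \<in> A \<inter> dominance s0 \<longrightarrow> \<omega> \<in> A \<inter> E"
    using AE_frac[of s0 \<alpha> p]
  proof eventually_elim
    case (elim \<omega>)
    show ?case
    proof (intro impI IntI)
      assume D: "\<omega> \<in> A \<inter> dominance s0"
      then show "\<omega> \<in> A" by simp
      show "\<omega> \<in> E"
      proof (rule ccontr)
        assume "\<omega> \<notin> E"
        have near: "\<bar>x_frac s0 \<omega> n - x0\<bar> < \<delta> \<and> \<bar>y_frac s0 \<omega> n - (1 - x0)\<bar> < \<delta>" if "n \<ge> N" for n
        proof -
          have "h n (x_frac s0 \<omega> n) (y_frac s0 \<omega> n) < \<delta>\<^sup>2"
          proof -
            have "\<not> h n (bfrac (fst (\<omega> n))) (bfrac (snd (\<omega> n))) \<ge> \<delta>\<^sup>2"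
              using \<open>\<omega> \<notin> E\<close> that unfolding E_def by blast
            then show ?thesis
              using elim by simp
          qed
          moreover have "2 * C / real n \<ge> 0"
            using C by simp
          ultimately have "(x_frac s0 \<omega> n - x0)\<^sup>2 + (y_frac s0 \<omega> n - (1 - x0))\<^sup>2 < \<delta>\<^sup>2"
            by (simp add: h_def)
          then have "(x_frac s0 \<omega> n - x0)\<^sup>2 < \<delta>\<^sup>2" "(y_frac s0 \<omega> n - (1 - x0))\<^sup>2 < \<delta>\<^sup>2"
            using zero_le_power2[of "x_frac s0 \<omega> n - x0"] zero_le_power2[of "y_frac s0 \<omega> n - (1 - x0)"] by linarith+
          then show ?thesis
            by (auto intro: sq)
        qed
        have lim: "\<bar>a - x0\<bar> \<le> \<delta> \<and> \<bar>c - (1 - x0)\<bar> \<le> \<delta>"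
          if "(\<lambda>n. (x_frac s0 \<omega> n, y_frac s0 \<omega> n)) \<longlonglongrightarrow> (a, c)" for a c
        proof -
          have "(\<lambda>n. \<bar>x_frac s0 \<omega> n - x0\<bar>) \<longlonglongrightarrow> \<bar>a - x0\<bar>"
            using tendsto_fst[OF that] by (intro tendsto_intros) simp
          moreover have "(\<lambda>n. \<bar>y_frac s0 \<omega> n - (1 - x0)\<bar>) \<longlonglongrightarrow> \<bar>c - (1 - x0)\<bar>"
            using tendsto_snd[OF that] by (intro tendsto_intros) simp
          ultimately show ?thesis
            using near by (meson LIMSEQ_le_const2 less_imp_le)
        qed
        from D consider "(\<lambda>n. (x_frac s0 \<omega> n, y_frac s0 \<omega> n)) \<longlonglongrightarrow> (0, 0)"
          | "(\<lambda>n. (x_frac s0 \<omega> n, y_frac s0 \<omega> n)) \<longlonglongrightarrow> (1, 1)"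
          by (auto simp: dominance_def)
        then show False
          using lim x0 by cases (fastforce simp: \<delta>_def)+
      qed
    qed
  qed
  moreover have sets_D: "dominance s0 \<in> sets ?M"
    by (rule dominance_in_sets)
  moreover have "A \<inter> E \<in> sets ?M"
  proof -
    have "E = (\<Union>n\<in>{N..}. {\<omega>. h n (bfrac (fst (\<omega> n))) (bfrac (snd (\<omega> n))) \<ge> \<delta>\<^sup>2})"
      by (auto simp: E_def)
    also have "\<dots> \<in> sets ?M"
      by (intro sets.countable_UN'' sets_Collect_state) auto
    finally show ?thesis
      using sets_A by simp
  qed
  ultimately have "prob (A \<inter> dominance s0) \<le> prob (A \<inter> E)"
    by (intro finite_measure_mono_AE)
  then have le_half: "prob (A \<inter> dominance s0) \<le> prob A / 2"
    using exit by linarith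
  have "prob (dominance s0) \<le> prob ((A \<inter> dominance s0) \<union> (space ?M - A))"
    by (intro finite_measure_mono sets.Un sets.Int sets.compl_sets sets_A sets_D) (auto simp: space_urn_law)
  also have "\<dots> \<le> prob (A \<inter> dominance s0) + prob (space ?M - A)"
    by (intro measure_Un_le sets.Int sets.compl_sets sets_A sets_D)
  also have "prob (space ?M - A) = 1 - prob A"
    by (rule prob_compl[OF sets_A])
  finally show ?thesis
    using le_half A by simp
qed

section \<open>Numerical verification at exponent 5/2\<close>

lemma powr_nat_plus_half: "x powr (real n + 1/2) = x ^ n * sqrt x" if "x \<ge> 0" for x :: real
proof (cases "x = 0")
  case False
  have "x powr (real n + 1/2) = x powr real n * x powr (1/2)"
    by (rule powr_add)
  then show ?thesis
    using that False by (simp add: powr_half_sqrt powr_realpow)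
qed simp

text \<open>On (0, 1/2] the numerator grows with x (1 - x) while the denominator decreases, so the
  slope on an interval is controlled at its right end.\<close>

lemma share_deriv_mono:
  assumes "\<alpha> \<ge> 1" "0 < x" "x \<le> y" "y \<le> 1/2"
  shows "share_deriv \<alpha> x \<le> share_deriv \<alpha> y"
proof -
  have "x * (1 - x) \<le> y * (1 - y)"
  proof -
    have "y * (1 - y) - x * (1 - x) = (y - x) * (1 - x - y)"
      by (simp add: algebra_simps)
    also have "\<dots> \<ge> 0"
      using assms by (intro mult_nonneg_nonneg) auto
    finally show ?thesis by simp
  qed
  then have num: "x powr (\<alpha> - 1) * (1 - x) powr (\<alpha> - 1) \<le> y powr (\<alpha> - 1) * (1 - y) powr (\<alpha> - 1)"
    using assms by (simp add: powr_mult[symmetric] powr_mono2)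
  have den: "y powr \<alpha> + (1 - y) powr \<alpha> \<le> x powr \<alpha> + (1 - x) powr \<alpha>"
  proof (rule DERIV_nonpos_imp_nonincreasing[where f="\<lambda>z. z powr \<alpha> + (1 - z) powr \<alpha>"])
    fix z assume z: "x \<le> z" "z \<le> y"
    have "((\<lambda>z. z powr \<alpha> + (1 - z) powr \<alpha>) has_real_derivative
        \<alpha> * z powr (\<alpha> - 1) - \<alpha> * (1 - z) powr (\<alpha> - 1)) (at z)"
      using assms z by (auto intro!: derivative_eq_intros simp: powr_diff)
    moreover have "\<alpha> * z powr (\<alpha> - 1) - \<alpha> * (1 - z) powr (\<alpha> - 1) \<le> 0"
      using assms z by (simp add: mult_left_mono powr_mono2)
    ultimately show "\<exists>d. ((\<lambda>z. z powr \<alpha> + (1 - z) powr \<alpha>) has_real_derivative d) (at z) \<and> d \<le> 0"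
      by blast
  qed fact
  show ?thesis
    unfolding share_deriv_def using assms num den share_denominator_pos[of y \<alpha>]
    by (intro frac_le mult_left_mono power_mono) (auto simp: add_nonneg_nonneg)
qed

lemma not_almost_surely_dominant_five_halves:
  assumes "red (fst s0) \<ge> 1" "black (snd s0) \<ge> 1"
  shows "measure (urn_law s0 (5/2) (3101/10000)) (dominance s0) < 1"
proof -
  \<comment> \<open>\<open>?b\<close> is just above the equilibrium: p/2 + (1 - p) g(b) - b is about
    -0.0013. There the slope is at most 0.3205, and p \<alpha> + (1 - p) K is about 0.9964. The
    square root bounds are chosen just sharp enough to certify this.\<close>
  let ?p = "3101/10000 :: real" and ?b = "169/1000 :: real"
  have sqrt1: "411/1000 \<le> sqrt ?b" "sqrt ?b \<le> 4112/10000"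
    and sqrt2: "9115/10000 \<le> sqrt (1 - ?b)" and sqrt3: "sqrt (?b * (1 - ?b)) \<le> 3748/10000"
    by (rule real_le_rsqrt real_le_lsqrt; simp add: power2_eq_square)+
  note powr_five_halves = powr_nat_plus_half[of _ 2, simplified]
  define d where "d = ?b powr (5/2) + (1 - ?b) powr (5/2)"
  have b52: "?b powr (5/2) \<le> 11745/1000000"
    using sqrt1 by (simp add: powr_five_halves power2_eq_square)
  have d: "d \<ge> 64118/100000"
    using sqrt1 sqrt2 by (simp add: d_def powr_five_halves power2_eq_square)
  have "share (5/2) ?b \<le> (11745/1000000) / (64118/100000)"
    using b52 d unfolding share_def d_def[symmetric] by (intro frac_le) auto
  then have below: "drift (5/2) ?p (1/2) ?b < 0"
    by (simp add: drift_def share_half)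
  have above: "drift (5/2) ?p (1/2) 0 > 0"
    by (simp add: drift_def share_half)
  have "continuous_on {0..?b} (drift (5/2) ?p (1/2))"
    unfolding drift_def by (intro continuous_intros continuous_on_subset[OF continuous_on_share]) auto
  then obtain x0 where x0: "0 \<le> x0" "x0 \<le> ?b" "drift (5/2) ?p (1/2) x0 = 0"
    using IVT2'[of "drift (5/2) ?p (1/2)" ?b 0 0] above below by auto
  have "x0 \<noteq> 0" "x0 \<noteq> ?b"
    using x0(3) above below by (metis less_irrefl)+
  then have x0': "0 < x0" "x0 < ?b"
    using x0 by auto
  have "share_deriv (5/2) ?b \<le> 3205/10000"
  proof -
    have "?b powr (5/2 - 1) * (1 - ?b) powr (5/2 - 1) = (?b * (1 - ?b)) powr (5/2 - 1)"
      by (rule powr_mult[symmetric])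
    also have "\<dots> = ?b * (1 - ?b) * sqrt (?b * (1 - ?b))"
      using powr_nat_plus_half[of "?b * (1 - ?b)" 1] by simp
    also have "\<dots> \<le> 52638/1000000"
      using sqrt3 by simp
    finally have "share_deriv (5/2) ?b \<le> (5/2 * (52638/1000000)) / (64118/100000)\<^sup>2"
      using d unfolding share_deriv_def d_def[symmetric] by (intro frac_le mult_left_mono power_mono) auto
    then show ?thesis
      by (simp add: power2_eq_square)
  qed
  then have K: "share_deriv (5/2) z \<le> 3205/10000" if "0 < z" "z < ?b" for z
    using share_deriv_mono[of "5/2" z ?b] that by simp
  show ?thesis
    by (rule not_almost_surely_dominant[OF _ _ _ assms x0' _ x0(3) K]) simp_all
qed

section \<open>Absorption by the sinks\<close>

text \<open>Symmetry under exchange of the colours; it reduces the sink (1, 1) to (0, 0).\<close>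

lemma expect_flip:
  assumes "n \<ge> 1"
  shows "expect \<alpha> p t1 t2 n (\<lambda>x y. h (1 - x) (1 - y)) x y = expect \<alpha> p t1 t2 n h (1 - x) (1 - y)"
proof -
  have pool: "pool t1 t2 n (1 - x) (1 - y) = 1 - pool t1 t2 n x y"
    using assms by (simp add: pool_def field_simps)
  have flip: "bern2 q1 q2 f = bern2 (1 - q1) (1 - q2) (\<lambda>a b. f (1 - a) (1 - b))" for q1 q2 f
    by (simp add: bern2_def algebra_simps)
  have q: "1 - (p * share \<alpha> u + (1 - p) * share \<alpha> v) = p * share \<alpha> (1 - u) + (1 - p) * share \<alpha> (1 - v)" for u v
    by (simp add: share_compl algebra_simps)
  have z: "1 - (z + (1 - a - z) / T) = 1 - z + (a - (1 - z)) / T" for z a T :: real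
    by (simp add: diff_divide_distrib)
  show ?thesis
    unfolding expect_def by (subst flip) (simp only: q z pool)
qed

text \<open>The ratio of the roots is at most 1 + 1 / (2 n), and 1/2 is less than 5/8, the
  contraction rate near a sink: the scaling sqrt n is slow enough to leave room.\<close>

lemma sqrt_Suc_mult_le:
  assumes "n \<ge> 1"
  shows "sqrt (real (Suc n)) * (1 - 5 / (8 * real n)) \<le> sqrt (real n)"
proof -
  have n: "real n \<ge> 1" using assms by simp
  have "real (Suc n) \<le> real n * (1 + 1 / (2 * real n))\<^sup>2"
    using n by (simp add: power2_eq_square field_simps)
  then have "sqrt (real (Suc n)) \<le> sqrt (real n) * (1 + 1 / (2 * real n))"
    using n by (intro real_le_lsqrt) (auto simp: power_mult_distrib)
  moreover have "1 - 5 / (8 * real n) \<ge> 0"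
    using n by (simp add: field_simps)
  ultimately have "sqrt (real (Suc n)) * (1 - 5 / (8 * real n)) \<le>
      sqrt (real n) * (1 + 1 / (2 * real n)) * (1 - 5 / (8 * real n))"
    by (rule mult_right_mono)
  also have "\<dots> = sqrt (real n) * ((1 + 1 / (2 * real n)) * (1 - 5 / (8 * real n)))"
    by (simp only: mult.assoc)
  also have "\<dots> \<le> sqrt (real n) * 1"
    using n by (intro mult_left_mono) (auto simp: field_simps)
  finally show ?thesis by simp
qed

text \<open>Close to \<open>(0, 0)\<close> shares are quadratically small, so \<open>x + y\<close> decays at least like \<open>1 / sqrt n\<close>.\<close>

lemma sink_supermartingale:
  assumes \<alpha>: "\<alpha> \<ge> 2" and p: "p \<in> {0..1}" and n: "n \<ge> 1" "n \<ge> 7 * (t1 + 1)" "n \<ge> 7 * (t2 + 1)"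
    and xy: "x \<in> {0..1}" "y \<in> {0..1}" "x + y \<le> 1/16"
  shows "expect \<alpha> p t1 t2 n (\<lambda>x y. sqrt (real (Suc n)) * (x + y)) x y \<le> sqrt (real n) * (x + y)"
proof -
  let ?m = "pool t1 t2 n x y" and ?L = "x + y" and ?n = "real n"
  define \<tau>1 \<tau>2 where "\<tau>1 = 1 / (real (n + t1) + 1)" and "\<tau>2 = 1 / (real (n + t2) + 1)"
  define q1 q2 where "q1 = p * share \<alpha> ?m + (1 - p) * share \<alpha> x" and "q2 = p * share \<alpha> ?m + (1 - p) * share \<alpha> y"
  \<comment> \<open>n \<ge> 7 (t + 1) gives n + t + 1 \<le> 8 n / 7, hence a step of at least 7 / (8
    n).\<close>
  have \<tau>: "0 \<le> \<tau>1" "\<tau>1 \<le> 1 / ?n" "0 \<le> \<tau>2" "\<tau>2 \<le> 1 / ?n" "7 / (8 * ?n) \<le> \<tau>1" "7 / (8 * ?n) \<le> \<tau>2"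
    using n by (auto simp: \<tau>1_def \<tau>2_def divide_simps)
  have m: "0 \<le> ?m" "?m \<le> ?L"
  proof -
    have "real (n + t1) * x + real (n + t2) * y \<le> (real (n + t1) + real (n + t2)) * ?L"
      using xy by (simp add: algebra_simps)
    then show "0 \<le> ?m" "?m \<le> ?L"
      using n xy by (auto simp: pool_def divide_simps mult.commute)
  qed
  have sq: "share \<alpha> z \<le> z / 8" if "0 \<le> z" "z \<le> 1/16" for z
  proof -
    have "2 * (z * z) \<le> 2 * (z * (1/16))"
      using that by (intro mult_left_mono) auto
    then show ?thesis
      using share_le_square[of \<alpha> z] that \<alpha> by (simp add: power2_eq_square)
  qed
  have s: "share \<alpha> ?m \<le> ?L / 8" "share \<alpha> x \<le> x / 8" "share \<alpha> y \<le> y / 8"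
    using sq[of ?m] sq[of x] sq[of y] m xy by auto
  have q: "q1 \<le> p * (?L / 8) + (1 - p) * (x / 8)" "q2 \<le> p * (?L / 8) + (1 - p) * (y / 8)"
    unfolding q1_def q2_def by (intro add_mono mult_left_mono s; use p in simp)+
  \<comment> \<open>Up to the factor 1 / n, the shares return at most (1 + p) / 8 \<le> 2/8 of
    \<open>?L\<close>, while at least 7/8 of it is lost: the net rate is 5/8.\<close>
  have "(q1 - x) * \<tau>1 + (q2 - y) * \<tau>2 \<le> - (5 / (8 * ?n)) * ?L"
  proof -
    have "q1 * \<tau>1 \<le> (p * (?L / 8) + (1 - p) * (x / 8)) * (1 / ?n)"
      using q(1) \<tau> p xy by (intro mult_mono) auto
    moreover have "q2 * \<tau>2 \<le> (p * (?L / 8) + (1 - p) * (y / 8)) * (1 / ?n)"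
      using q(2) \<tau> p xy by (intro mult_mono) auto
    moreover have "x * (7 / (8 * ?n)) \<le> x * \<tau>1" "y * (7 / (8 * ?n)) \<le> y * \<tau>2"
      by (rule mult_left_mono, rule \<tau>, use xy in simp)+
    moreover have "(p * (?L / 8) + (1 - p) * (x / 8)) * (1 / ?n) + (p * (?L / 8) + (1 - p) * (y / 8)) * (1 / ?n)
        \<le> ?L * (2 / (8 * ?n))"
    proof -
      have "(p * (?L / 8) + (1 - p) * (x / 8)) + (p * (?L / 8) + (1 - p) * (y / 8)) = (1 + p) * (?L / 8)"
        by (simp add: field_simps)
      also have "\<dots> \<le> 2 * (?L / 8)"
        using p xy by (intro mult_right_mono) auto
      finally have "((p * (?L / 8) + (1 - p) * (x / 8)) + (p * (?L / 8) + (1 - p) * (y / 8))) * (1 / ?n)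
          \<le> (2 * (?L / 8)) * (1 / ?n)"
        by (rule mult_right_mono) simp
      moreover have eq: "?L * (2 / (8 * ?n)) = (2 * (?L / 8)) * (1 / ?n)"
        using n by (simp add: field_simps)
      ultimately show ?thesis
        unfolding eq distrib_right[symmetric] by blast
    qed
    moreover have "?L * (2 / (8 * ?n)) - x * (7 / (8 * ?n)) - y * (7 / (8 * ?n)) = - (5 / (8 * ?n)) * ?L"
      using n by (simp add: field_simps)
    ultimately show ?thesis
      unfolding left_diff_distrib by linarith
  qed
  then have "?L + ((q1 - x) * \<tau>1 + (q2 - y) * \<tau>2) \<le> (1 - 5 / (8 * ?n)) * ?L"
    unfolding left_diff_distrib by simp
  then have "sqrt (real (Suc n)) * (?L + ((q1 - x) * \<tau>1 + (q2 - y) * \<tau>2)) \<le>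
      sqrt (real (Suc n)) * ((1 - 5 / (8 * ?n)) * ?L)"
    by (rule mult_left_mono) simp
  also have "\<dots> = sqrt (real (Suc n)) * (1 - 5 / (8 * ?n)) * ?L"
    by (simp only: mult.assoc)
  also have "\<dots> \<le> sqrt ?n * ?L"
    using xy by (intro mult_right_mono sqrt_Suc_mult_le n) auto
  finally have le: "sqrt (real (Suc n)) * (?L + ((q1 - x) * \<tau>1 + (q2 - y) * \<tau>2)) \<le> sqrt ?n * ?L" .
  have "expect \<alpha> p t1 t2 n (\<lambda>x y. s * (x + y)) x y =
      bern2 q1 q2 (\<lambda>a b. s * (x + (a - x) * \<tau>1 + (y + (b - y) * \<tau>2)))" for s
    by (simp add: expect_def q1_def q2_def \<tau>1_def \<tau>2_def)
  also have "bern2 q1 q2 (\<lambda>a b. s * (x + (a - x) * \<tau>1 + (y + (b - y) * \<tau>2))) =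
      s * (?L + ((q1 - x) * \<tau>1 + (q2 - y) * \<tau>2))" for s
    by (simp add: bern2_def algebra_simps)
  finally show ?thesis
    using le by simp
qed

lemma sets_limit:
  "{\<omega>. (\<lambda>n. (x_frac s0 \<omega> n, y_frac s0 \<omega> n)) \<longlonglongrightarrow> z} \<in> sets (urn_law s0 \<alpha> p)"
proof -
  have [measurable]: "(\<lambda>\<omega>. x_frac s0 \<omega> n) \<in> borel_measurable (urn_law s0 \<alpha> p)"
      "(\<lambda>\<omega>. y_frac s0 \<omega> n) \<in> borel_measurable (urn_law s0 \<alpha> p)" for n
    unfolding x_frac_def y_frac_def
    by (rule measurable_urn_law_state[of "\<lambda>s. real (black (fst s)) / real (n + black (fst s0) + red (fst s0))"], simp,
        rule measurable_urn_law_state[of "\<lambda>s. real (black (snd s)) / real (n + black (snd s0) + red (snd s0))"], simp)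
  have "{\<omega> \<in> space (urn_law s0 \<alpha> p). (\<lambda>n. (x_frac s0 \<omega> n, y_frac s0 \<omega> n)) \<longlonglongrightarrow> z} \<in> sets (urn_law s0 \<alpha> p)"
    by measurable
  then show ?thesis
    by (simp add: space_urn_law)
qed

text \<open>\<open>w\<close> measures the distance to either sink. The scaled distance starts at
  most at half of the level \<open>c\<close>, and below \<open>c\<close> the sum of distances is
  less than 1/16, where \<open>sink_supermartingale\<close> applies. A path that never reaches
  \<open>c\<close> has distance O(1 / sqrt n), so staying already implies convergence.\<close>

lemma sink_absorbs:
  fixes w :: "real \<Rightarrow> real"
  assumes \<alpha>: "\<alpha> \<ge> 2" and p: "p \<in> {0..1}" and t: "balls (fst s0) \<ge> 1" "balls (snd s0) \<ge> 1"
    and w: "w = (\<lambda>z. z) \<and> l = 0 \<or> w = (\<lambda>z. 1 - z) \<and> l = 1"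
    and N: "N \<ge> 7 * (balls (fst s0) + balls (snd s0) + 1)" and A: "past N A"
    and start: "\<And>\<omega>. \<omega> \<in> A \<Longrightarrow> w (bfrac (fst (\<omega> N))) + w (bfrac (snd (\<omega> N))) \<le> 1/32"
  shows "measure (urn_law s0 \<alpha> p) (A - {\<omega>. (\<lambda>n. (x_frac s0 \<omega> n, y_frac s0 \<omega> n)) \<longlonglongrightarrow> (l, l)})
    \<le> measure (urn_law s0 \<alpha> p) A / 2"
proof -
  let ?M = "urn_law s0 \<alpha> p"
  interpret prob_space ?M by (rule prob_space_urn_law)
  have N1: "N \<ge> 1" using N by simp
  let ?h = "\<lambda>n x y. sqrt (real n) * (w x + w y)"
  define c where "c = sqrt (real N) / 16"
  have c: "c > 0" using N1 by (simp add: c_def)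
  have w01: "w z \<in> {0..1}" if "z \<in> {0..1}" for z
    using w that by auto
  define E where "E = {\<omega>. \<exists>k\<ge>N. ?h k (bfrac (fst (\<omega> k))) (bfrac (snd (\<omega> k))) \<ge> c}"
  have small: "w x + w y < 1/16 * (sqrt (real N) / sqrt (real n))" if "n \<ge> N" "?h n x y < c" for n x y
    using that N1 by (simp add: c_def field_simps)
  have "prob (A \<inter> E) \<le> prob A / 2"
    unfolding E_def
  proof (rule frac_maximal[OF p t A c])
    show "?h N (bfrac (fst (\<omega> N))) (bfrac (snd (\<omega> N))) \<le> c / 2" if "\<omega> \<in> A" for \<omega>
      using mult_left_mono[OF start[OF that], of "sqrt (real N)"] by (simp add: c_def)
    show "?h n x y \<ge> 0" if "x \<in> {0..1}" "y \<in> {0..1}" for n x y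
      using w01[OF that(1)] w01[OF that(2)] by simp
    fix n x y assume n: "n \<ge> N" and xy: "x \<in> {0..1}" "y \<in> {0..1}" and lt: "?h n x y < c"
    have "sqrt (real N) / sqrt (real n) \<le> 1"
      using n N1 by simp
    then have "w x + w y \<le> 1/16"
      using small[OF n lt] by linarith
    then have s: "expect \<alpha> p (balls (fst s0)) (balls (snd s0)) n (\<lambda>x y. sqrt (real (Suc n)) * (x + y)) (w x) (w y)
        \<le> ?h n x y"
      using n N N1 w01 xy by (intro sink_supermartingale \<alpha> p) auto
    show "expect \<alpha> p (balls (fst s0)) (balls (snd s0)) n (?h (Suc n)) x y \<le> ?h n x y"
      using w
    proof
      assume "w = (\<lambda>z. 1 - z) \<and> l = 1"
      then show ?thesis
        using s expect_flip[of n \<alpha> p "balls (fst s0)" "balls (snd s0)" "\<lambda>x y. sqrt (real (Suc n)) * (x + y)" x y] n N1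
        by simp
    qed (use s in simp)
  qed
  moreover have "prob (A - {\<omega>. (\<lambda>n. (x_frac s0 \<omega> n, y_frac s0 \<omega> n)) \<longlonglongrightarrow> (l, l)}) \<le> prob (A \<inter> E)"
  proof (rule finite_measure_mono_AE)
    show "AE \<omega> in ?M. \<omega> \<in> A - {\<omega>. (\<lambda>n. (x_frac s0 \<omega> n, y_frac s0 \<omega> n)) \<longlonglongrightarrow> (l, l)} \<longrightarrow> \<omega> \<in> A \<inter> E"
      using AE_frac[of s0 \<alpha> p]
    proof eventually_elim
      case (elim \<omega>)
      have "(\<lambda>n. (x_frac s0 \<omega> n, y_frac s0 \<omega> n)) \<longlonglongrightarrow> (l, l)" if "\<omega> \<notin> E"
      proof -
        let ?x = "\<lambda>n. bfrac (fst (\<omega> n))" and ?y = "\<lambda>n. bfrac (snd (\<omega> n))"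
        have lt: "w (?x n) + w (?y n) < 1/16 * (sqrt (real N) / sqrt (real n))" if "n \<ge> N" for n
        proof (rule small[OF that])
          have "\<not> ?h n (?x n) (?y n) \<ge> c"
            using \<open>\<omega> \<notin> E\<close> that unfolding E_def by blast
          then show "?h n (?x n) (?y n) < c" by simp
        qed
        have lim0: "(\<lambda>n. 1/16 * (sqrt (real N) / sqrt (real n))) \<longlonglongrightarrow> 0"
          by real_asymp
        have wx: "(\<lambda>n. w (?x n)) \<longlonglongrightarrow> 0"
          by (rule tendsto_sandwich[OF _ _ tendsto_const lim0])
             (use w01[OF bfrac_bounds] lt in \<open>auto intro!: eventually_sequentiallyI[of N] simp: less_imp_le add_increasing\<close>,
              smt (verit) w01[OF bfrac_bounds] atLeastAtMost_iff)
        have wy: "(\<lambda>n. w (?y n)) \<longlonglongrightarrow> 0"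
          by (rule tendsto_sandwich[OF _ _ tendsto_const lim0])
             (use w01[OF bfrac_bounds] lt in \<open>auto intro!: eventually_sequentiallyI[of N] simp: less_imp_le add_increasing\<close>,
              smt (verit) w01[OF bfrac_bounds] atLeastAtMost_iff)
        have "?x \<longlonglongrightarrow> l" "?y \<longlonglongrightarrow> l"
          using w wx wy tendsto_diff[OF tendsto_const[of 1] wx] tendsto_diff[OF tendsto_const[of 1] wy] by auto
        then show ?thesis
          using elim by (simp add: tendsto_Pair)
      qed
      then show ?case by blast
    qed
    have "E = (\<Union>n\<in>{N..}. {\<omega>. ?h n (bfrac (fst (\<omega> n))) (bfrac (snd (\<omega> n))) \<ge> c})"
      by (auto simp: E_def)
    also have "\<dots> \<in> sets ?M"
      by (intro sets.countable_UN'' sets_Collect_state) auto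
    finally show "A \<inter> E \<in> sets ?M"
      using sets_past[OF A] by simp
  qed
  ultimately show ?thesis by linarith
qed

text \<open>The condition with 31/32 says that the distances to one of the sinks sum to at most
  1/32, the starting condition of \<open>sink_absorbs\<close>; a past event is split according to
  which sink it is.\<close>

lemma almost_surely_dominant_if_hits:
  assumes \<alpha>: "\<alpha> \<ge> 2" and p: "p \<in> {0..1}" and t: "balls (fst s0) \<ge> 1" "balls (snd s0) \<ge> 1"
    and hits: "\<And>n. n \<ge> N \<Longrightarrow> AE \<omega> in urn_law s0 \<alpha> p. \<exists>k\<ge>n.
      \<bar>bfrac (fst (\<omega> k)) + bfrac (snd (\<omega> k)) - 1\<bar> \<ge> 31/32"
  shows "measure (urn_law s0 \<alpha> p) (dominance s0) = 1"
proof -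
  let ?M = "urn_law s0 \<alpha> p"
  interpret prob_space ?M by (rule prob_space_urn_law)
  let ?U = "{s. \<bar>bfrac (fst s) + bfrac (snd s) - 1\<bar> \<ge> 31/32}"
  define N' where "N' = max N (7 * (balls (fst s0) + balls (snd s0) + 1))"
  show ?thesis
  proof (rule measure_eq_1_if_absorbed[where N=N' and U="\<lambda>_. ?U", OF dominance_in_sets])
    fix n A assume n: "n \<ge> N'" and A: "past n A" "\<And>\<omega>. \<omega> \<in> A \<Longrightarrow> \<omega> n \<in> ?U"
    define A0 A1 where "A0 = A \<inter> {\<omega>. bfrac (fst (\<omega> n)) + bfrac (snd (\<omega> n)) \<le> 1/32}"
      and "A1 = A \<inter> - {\<omega>. bfrac (fst (\<omega> n)) + bfrac (snd (\<omega> n)) \<le> 1/32}"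
    have past: "past n A0" "past n A1"
      unfolding A0_def A1_def using A(1) by (auto intro!: past_Int past_Compl past_Collect)
    have sets: "A0 \<in> sets ?M" "A1 \<in> sets ?M"
      using past by (auto intro: sets_past)
    define D where "D = (\<lambda>l::real. {\<omega>. (\<lambda>n. (x_frac s0 \<omega> n, y_frac s0 \<omega> n)) \<longlonglongrightarrow> (l, l)})"
    have D: "dominance s0 = D 0 \<union> D 1"
      by (simp add: dominance_def D_def)
    have h0: "prob (A0 - D 0) \<le> prob A0 / 2"
      unfolding D_def using n past
      by (intro sink_absorbs[OF \<alpha> p t, where w="\<lambda>z. z"]) (auto simp: N'_def A0_def)
    have h1: "prob (A1 - D 1) \<le> prob A1 / 2"
      unfolding D_def
    proof (rule sink_absorbs[OF \<alpha> p t, where w="\<lambda>z. 1 - z"])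
      fix \<omega> assume "\<omega> \<in> A1"
      then have "\<bar>bfrac (fst (\<omega> n)) + bfrac (snd (\<omega> n)) - 1\<bar> \<ge> 31/32"
        "\<not> bfrac (fst (\<omega> n)) + bfrac (snd (\<omega> n)) \<le> 1/32"
        using A(2) by (auto simp: A1_def)
      then show "1 - bfrac (fst (\<omega> n)) + (1 - bfrac (snd (\<omega> n))) \<le> 1/32"
        by (auto simp: abs_if split: if_splits)
    qed (use n past in \<open>auto simp: N'_def\<close>)
    have [measurable]: "D l \<in> sets ?M" for l
      unfolding D_def by (rule sets_limit)
    have "prob (A - dominance s0) \<le> prob ((A0 - D 0) \<union> (A1 - D 1))"
      using sets by (intro finite_measure_mono) (auto simp: A0_def A1_def D)
    also have "\<dots> \<le> prob (A0 - D 0) + prob (A1 - D 1)"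
      using sets by (intro measure_Un_le) auto
    also have "\<dots> \<le> (prob A0 + prob A1) / 2"
      using h0 h1 by simp
    also have "prob A0 + prob A1 = prob A"
    proof -
      have "A = A0 \<union> A1" "A0 \<inter> A1 = {}"
        by (auto simp: A0_def A1_def)
      then show ?thesis
        using sets by (simp add: finite_measure_Union)
    qed
    finally show "prob (A - dominance s0) \<le> prob A / 2" .
  next
    fix n assume "n \<ge> N'"
    then show "AE \<omega> in ?M. \<exists>k\<ge>n. \<omega> k \<in> ?U"
      using hits[of n] by (simp add: N'_def)
  qed
qed

section \<open>Escape from unstable equilibria\<close>

text \<open>\<open>share\<close> is nondecreasing, so its integral is convex. The tangent inequality
  serves in place of a second-order expansion and holds up to the boundary of [0, 1].\<close>

lemma share_antiderivative:
  assumes "\<alpha> > 0"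
  obtains \<Gamma> B where "\<And>x y. x \<in> {0..1} \<Longrightarrow> y \<in> {0..1} \<Longrightarrow> \<Gamma> y \<ge> \<Gamma> x + share \<alpha> x * (y - x)"
    and "\<And>x. x \<in> {0..1} \<Longrightarrow> \<bar>\<Gamma> x\<bar> \<le> (B::real)"
proof -
  define \<Gamma> where "\<Gamma> = (\<lambda>x. integral {0..x} (share \<alpha>))"
  have d: "(\<Gamma> has_vector_derivative share \<alpha> x) (at x within {0..1})" if "x \<in> {0..1}" for x
    unfolding \<Gamma>_def using that assms by (intro integral_has_vector_derivative continuous_on_share)
  have c: "continuous_on {0..1} \<Gamma>"
    by (auto simp: continuous_on_eq_continuous_within intro: has_vector_derivative_continuous d)
  have conv: "\<Gamma> y \<ge> \<Gamma> x + share \<alpha> x * (y - x)" if xy: "x \<in> {0..1}" "y \<in> {0..1}" for x y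
  proof -
    have mvt: "\<exists>z. a < z \<and> z < b \<and> \<Gamma> b - \<Gamma> a = (b - a) * share \<alpha> z" if ab: "0 \<le> a" "a < b" "b \<le> 1" for a b
    proof -
      have "(\<Gamma> has_derivative (\<lambda>h. h * share \<alpha> z)) (at z)" if "a < z" "z < b" for z
      proof -
        have "at z within {0..1} = at z"
          using that ab by (intro at_within_interior) auto
        then show ?thesis
          using d[of z] that ab by (simp add: has_vector_derivative_def)
      qed
      moreover have "continuous_on {a..b} \<Gamma>"
        using ab by (intro continuous_on_subset[OF c]) auto
      ultimately show ?thesis
        using mvt[OF ab(2), of \<Gamma> "\<lambda>z h. h * share \<alpha> z"] by auto
    qed
    show ?thesis
    proof (cases x y rule: linorder_cases)
      case less
      then obtain z where z: "x < z" "z < y" "\<Gamma> y - \<Gamma> x = (y - x) * share \<alpha> z"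
        using mvt[of x y] xy by auto
      have "(y - x) * share \<alpha> x \<le> (y - x) * share \<alpha> z"
        using z xy assms by (intro mult_left_mono share_mono) auto
      then show ?thesis
        using z(3) mult.commute[of "share \<alpha> x" "y - x"] by linarith
    next
      case greater
      then obtain z where z: "y < z" "z < x" "\<Gamma> x - \<Gamma> y = (x - y) * share \<alpha> z"
        using mvt[of y x] xy by auto
      have "(x - y) * share \<alpha> z \<le> (x - y) * share \<alpha> x"
        using z xy assms by (intro mult_left_mono share_mono) auto
      then show ?thesis
        using z by (simp add: algebra_simps)
    qed simp
  qed
  have "compact (\<Gamma> ` {0..1})"
    by (intro compact_continuous_image c) simp
  then obtain B where "\<forall>z\<in>\<Gamma> ` {0..1}. norm z \<le> B"
    using compact_imp_bounded bounded_iff by metis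
  then have "\<And>x. x \<in> {0..1} \<Longrightarrow> \<bar>\<Gamma> x\<bar> \<le> B"
    by (simp add: image_iff)
  with conv show ?thesis
    by (rule that)
qed

text \<open>The mean-field dynamics is a gradient flow; the potential has convex part \<open>\<Gamma>\<close>, so its
  increments dominate their linearisation up to \<open>- (\<Delta>x\<^sup>2 + \<Delta>y\<^sup>2) / 2\<close>.\<close>

lemma potential_exists:
  assumes "\<alpha> > 0" "p \<in> {0..1}"
  obtains V :: "real \<Rightarrow> real \<Rightarrow> real" and B :: real where
    "\<And>x y x' y'. x \<in> {0..1} \<Longrightarrow> y \<in> {0..1} \<Longrightarrow> x' \<in> {0..1} \<Longrightarrow> y' \<in> {0..1} \<Longrightarrow>
      V x' y' \<ge> V x y + drift \<alpha> p ((x + y) / 2) x * (x' - x) + drift \<alpha> p ((x + y) / 2) y * (y' - y)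
        - ((x' - x)\<^sup>2 + (y' - y)\<^sup>2) / 2"
    "\<And>x y. x \<in> {0..1} \<Longrightarrow> y \<in> {0..1} \<Longrightarrow> \<bar>V x y\<bar> \<le> B" "B \<ge> 0"
proof -
  obtain \<Gamma> B where \<Gamma>: "\<And>x y. x \<in> {0..1} \<Longrightarrow> y \<in> {0..1} \<Longrightarrow> \<Gamma> y \<ge> \<Gamma> x + share \<alpha> x * (y - x)"
    and B: "\<And>x. x \<in> {0..1} \<Longrightarrow> \<bar>\<Gamma> x\<bar> \<le> B"
    using share_antiderivative[OF assms(1)] by blast
  \<comment> \<open>The factor 2 cancels the 1/2 from the midpoint, so that both partial derivatives
    are the drifts at \<open>x\<close> and at \<open>y\<close>.\<close>
  define V where "V = (\<lambda>x y. 2 * p * \<Gamma> ((x + y) / 2) + (1 - p) * (\<Gamma> x + \<Gamma> y) - (x\<^sup>2 + y\<^sup>2) / 2)"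
  show ?thesis
  proof (rule that[of V "4 * B + 1"])
    fix x y x' y' :: real
    assume xy: "x \<in> {0..1}" "y \<in> {0..1}" "x' \<in> {0..1}" "y' \<in> {0..1}"
    let ?m = "(x + y) / 2" and ?m' = "(x' + y') / 2"
    have "2 * p * (\<Gamma> ?m + share \<alpha> ?m * (?m' - ?m)) \<le> 2 * p * \<Gamma> ?m'"
      using assms xy by (intro mult_left_mono \<Gamma>) auto
    moreover have "(1 - p) * ((\<Gamma> x + share \<alpha> x * (x' - x)) + (\<Gamma> y + share \<alpha> y * (y' - y))) \<le> (1 - p) * (\<Gamma> x' + \<Gamma> y')"
      using assms xy by (intro mult_left_mono add_mono \<Gamma>) auto
    moreover have "V x y + drift \<alpha> p ?m x * (x' - x) + drift \<alpha> p ?m y * (y' - y) - ((x' - x)\<^sup>2 + (y' - y)\<^sup>2) / 2 =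
        2 * p * (\<Gamma> ?m + share \<alpha> ?m * (?m' - ?m)) +
        (1 - p) * ((\<Gamma> x + share \<alpha> x * (x' - x)) + (\<Gamma> y + share \<alpha> y * (y' - y))) - (x'\<^sup>2 + y'\<^sup>2) / 2"
      by (simp add: V_def drift_def power2_eq_square field_simps)
    ultimately show "V x' y' \<ge> V x y + drift \<alpha> p ?m x * (x' - x) + drift \<alpha> p ?m y * (y' - y)
        - ((x' - x)\<^sup>2 + (y' - y)\<^sup>2) / 2"
      unfolding V_def by linarith
  next
    fix x y :: real assume xy: "x \<in> {0..1}" "y \<in> {0..1}"
    have "\<bar>2 * p * \<Gamma> ((x + y) / 2)\<bar> \<le> 2 * B"
      unfolding abs_mult using B[of "(x + y) / 2"] xy assms
      by (intro mult_mono) auto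
    moreover have "\<bar>(1 - p) * (\<Gamma> x + \<Gamma> y)\<bar> \<le> 1 * (2 * B)"
      unfolding abs_mult using B[OF xy(1)] B[OF xy(2)] xy assms
      by (intro mult_mono) auto
    moreover have "x\<^sup>2 \<le> 1" "y\<^sup>2 \<le> 1" "x\<^sup>2 \<ge> 0" "y\<^sup>2 \<ge> 0"
      using xy by (auto intro: power_le_one)
    moreover have "\<bar>a + b - (c + d) / 2\<bar> \<le> 4 * B + 1"
      if "\<bar>a\<bar> \<le> 2 * B" "\<bar>b\<bar> \<le> 1 * (2 * B)" "c \<le> 1" "d \<le> 1" "c \<ge> 0" "d \<ge> 0" for a b c d :: real
      using that by (auto simp: abs_le_iff add_divide_distrib)
    ultimately show "\<bar>V x y\<bar> \<le> 4 * B + 1"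
      unfolding V_def by blast
  next
    show "4 * B + 1 \<ge> 0" using B[of 0] by auto
  qed
qed

lemma bern2_quadratic:
  "bern2 q1 q2 (\<lambda>a b. k0 + k1 * ((a - x) * s + (b - y) * t) + k2 * ((a - x) * s + (b - y) * t)\<^sup>2) =
    k0 + k1 * ((q1 - x) * s + (q2 - y) * t) +
    k2 * (((q1 - x) * s + (q2 - y) * t)\<^sup>2 + q1 * (1 - q1) * s\<^sup>2 + q2 * (1 - q2) * t\<^sup>2)"
  by (simp add: bern2_def power2_eq_square algebra_simps)

lemma expect_combine:
  "expect \<alpha> p t1 t2 n (\<lambda>x y. c - (f x y + g x y / s)) x y =
    c - (expect \<alpha> p t1 t2 n f x y + expect \<alpha> p t1 t2 n g x y / s)"
  by (simp add: expect_def bern2_def add_divide_distrib diff_divide_distrib algebra_simps)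

lemma bern2_affine:
  "bern2 q1 q2 (\<lambda>a b. c + f * ((a - x) * s) + g * ((b - y) * t) - e) = c + f * ((q1 - x) * s) + g * ((q2 - y) * t) - e"
  by (simp add: bern2_def algebra_simps)

text \<open>Take the mean of the tangent inequality for \<open>V\<close>. As |F| \<le> 1 in each
  coordinate, replacing the exact one-step drift by F / n costs D / n^2 per urn; the quadratic loss
  is at most 1 / n^2 in total.\<close>

lemma potential_drift:
  fixes t1 t2 :: nat
  assumes \<alpha>: "\<alpha> \<ge> 1" and p: "p \<in> {0..1}" and n: "n \<ge> 1" and xy: "x \<in> {0..1}" "y \<in> {0..1}"
    and V: "\<And>x' y'. x' \<in> {0..1} \<Longrightarrow> y' \<in> {0..1} \<Longrightarrow>
      V x' y' \<ge> V x y + drift \<alpha> p ((x + y) / 2) x * (x' - x) + drift \<alpha> p ((x + y) / 2) y * (y' - y)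
        - ((x' - x)\<^sup>2 + (y' - y)\<^sup>2) / 2"
  defines "D \<equiv> real (t1 + t2) * (1 + \<alpha>) + 1"
  shows "expect \<alpha> p t1 t2 n V x y \<ge> V x y +
    ((drift \<alpha> p ((x + y) / 2) x)\<^sup>2 + (drift \<alpha> p ((x + y) / 2) y)\<^sup>2) / real n - (2 * D + 1) / (real n)\<^sup>2"
proof -
  let ?m = "pool t1 t2 n x y" and ?n = "real n"
  let ?Fx = "drift \<alpha> p ((x + y) / 2) x" and ?Fy = "drift \<alpha> p ((x + y) / 2) y"
  define \<tau>1 \<tau>2 where "\<tau>1 = 1 / (real (n + t1) + 1)" and "\<tau>2 = 1 / (real (n + t2) + 1)"
  define q1 q2 where "q1 = p * share \<alpha> ?m + (1 - p) * share \<alpha> x" and "q2 = p * share \<alpha> ?m + (1 - p) * share \<alpha> y"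
  have n0: "?n > 0" using n by simp
  have q: "q1 \<in> {0..1}" "q2 \<in> {0..1}"
    unfolding q1_def q2_def by (rule mixture_bounds, fact)+
  have \<tau>: "0 \<le> \<tau>1" "0 \<le> \<tau>2" "\<tau>1 \<le> 1 / ?n" "\<tau>2 \<le> 1 / ?n"
    using n0 by (auto simp: \<tau>1_def \<tau>2_def divide_simps)
  have d: "\<bar>(q1 - x) * \<tau>1 - ?Fx / ?n\<bar> \<le> D / ?n\<^sup>2" "\<bar>(q2 - y) * \<tau>2 - ?Fy / ?n\<bar> \<le> D / ?n\<^sup>2"
    using drift_approx[of \<alpha> p n x y x t1 t1 t2] drift_approx[of \<alpha> p n x y y t2 t1 t2] \<alpha> p n xy
    by (simp_all add: drift_def q1_def q2_def \<tau>1_def \<tau>2_def D_def)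
  have F: "F * b \<ge> F\<^sup>2 / ?n - D / ?n\<^sup>2" if "\<bar>b - F / ?n\<bar> \<le> D / ?n\<^sup>2" "\<bar>F\<bar> \<le> 1" for F b
  proof -
    have "\<bar>F * (b - F / ?n)\<bar> \<le> 1 * (D / ?n\<^sup>2)"
      unfolding abs_mult using that by (intro mult_mono) auto
    then show ?thesis
      by (simp add: right_diff_distrib abs_le_iff power2_eq_square)
  qed
  have F1: "\<bar>?Fx\<bar> \<le> 1" "\<bar>?Fy\<bar> \<le> 1"
    using p xy by (auto intro!: drift_bounds)
  have sq: "((a - z) * t)\<^sup>2 \<le> 1 / ?n\<^sup>2" if "z \<in> {0..1}" "a \<in> {0, 1}" "0 \<le> t" "t \<le> 1 / ?n" for a z t :: real
  proof -
    have "\<bar>(a - z) * t\<bar> \<le> 1 * (1 / ?n)"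
      unfolding abs_mult using that by (intro mult_mono) auto
    then have "\<bar>(a - z) * t\<bar>\<^sup>2 \<le> (1 / ?n)\<^sup>2"
      by (intro power_mono) auto
    then show ?thesis
      by (simp add: power_divide)
  qed
  have "V x y + (?Fx * ((q1 - x) * \<tau>1)) + (?Fy * ((q2 - y) * \<tau>2)) - 1 / ?n\<^sup>2 =
      bern2 q1 q2 (\<lambda>a b. V x y + ?Fx * ((a - x) * \<tau>1) + ?Fy * ((b - y) * \<tau>2) - 1 / ?n\<^sup>2)"
    by (rule bern2_affine[symmetric])
  also have "\<dots> \<le> bern2 q1 q2 (\<lambda>a b. V (x + (a - x) * \<tau>1) (y + (b - y) * \<tau>2))"
  proof (rule bern2_mono[OF q])
    fix a b :: real assume ab: "a \<in> {0, 1}" "b \<in> {0, 1}"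
    have "x + (a - x) * \<tau>1 \<in> {0..1}" "y + (b - y) * \<tau>2 \<in> {0..1}"
      using add_fraction_bounds[OF xy(1) ab(1), of "real (n + t1)"] add_fraction_bounds[OF xy(2) ab(2), of "real (n + t2)"]
      by (simp_all add: \<tau>1_def \<tau>2_def)
    from V[OF this] show "V x y + ?Fx * ((a - x) * \<tau>1) + ?Fy * ((b - y) * \<tau>2) - 1 / ?n\<^sup>2
        \<le> V (x + (a - x) * \<tau>1) (y + (b - y) * \<tau>2)"
      using sq[OF xy(1) ab(1) \<tau>(1,3)] sq[OF xy(2) ab(2) \<tau>(2,4)] by (simp add: add_divide_distrib)
  qed
  also have "\<dots> = expect \<alpha> p t1 t2 n V x y"
    by (simp add: expect_def q1_def q2_def \<tau>1_def \<tau>2_def)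
  finally have "V x y + (?Fx * ((q1 - x) * \<tau>1)) + (?Fy * ((q2 - y) * \<tau>2)) - 1 / ?n\<^sup>2 \<le> expect \<alpha> p t1 t2 n V x y" .
  then show ?thesis
    using F[OF d(1) F1(1)] F[OF d(2) F1(2)] by (simp add: add_divide_distrib)
qed

text \<open>Completing the square. It absorbs a cross error |W| / n, comparable to the noise when W
  is not small, into \<epsilon> W^2 and a term O(1 / n^2).\<close>

lemma abs_mult_le_AM_GM: "c * \<bar>W\<bar> / n \<le> \<epsilon> * W\<^sup>2 + c\<^sup>2 / (4 * \<epsilon> * n\<^sup>2)" if "\<epsilon> > 0" "n > 0" for c W n \<epsilon> :: real
proof -
  have "\<epsilon> * W\<^sup>2 + c\<^sup>2 / (4 * \<epsilon> * n\<^sup>2) - c * \<bar>W\<bar> / n = (2 * \<epsilon> * n * \<bar>W\<bar> - c)\<^sup>2 / (4 * \<epsilon> * n\<^sup>2)"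
    using that by (simp add: power2_eq_square field_simps flip: abs_mult)
  also have "\<dots> \<ge> 0" using that by simp
  finally show ?thesis by simp
qed

text \<open>With \<open>A\<close> large, \<open>ln (A + n * W\<^sup>2)\<close> for \<open>W = x + y - 1\<close> has a drift of order \<open>1 / n\<close> that stays
  positive at \<open>W = 0\<close> thanks to the noise: this is how unstable equilibria are left.\<close>

lemma log_drift:
  fixes t1 t2 :: nat
  assumes \<alpha>: "\<alpha> \<ge> 1" and p: "p \<in> {0..1}" and n: "n \<ge> t1 + 1" and xy: "x \<in> {0..1}" "y \<in> {0..1}"
    and A: "A \<ge> 100" and \<epsilon>: "\<epsilon> > 0"
  defines "D \<equiv> real (t1 + t2) * (1 + \<alpha>) + 1"
    and "W \<equiv> x + y - 1" and "q \<equiv> p * share \<alpha> (pool t1 t2 n x y) + (1 - p) * share \<alpha> x"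
  assumes \<kappa>: "W * (drift \<alpha> p ((x + y) / 2) x + drift \<alpha> p ((x + y) / 2) y) \<ge> \<kappa> * W\<^sup>2"
    and \<sigma>: "q * (1 - q) \<ge> \<sigma>" "\<sigma> \<ge> 0"
  shows "(A + real n * W\<^sup>2) * (expect \<alpha> p t1 t2 n (\<lambda>x y. ln (A + real (Suc n) * (x + y - 1)\<^sup>2)) x y - ln (A + real n * W\<^sup>2))
    \<ge> W\<^sup>2 * (1 + 2 * \<kappa> - 2 * \<bar>\<kappa>\<bar> / real n - \<epsilon> - 6 / real n - 384 / A) + \<sigma> / (4 * real n)
      - (16 * D\<^sup>2 / \<epsilon> + 384) / (real n)\<^sup>2"
proof -
  let ?m = "pool t1 t2 n x y" and ?n = "real n"
  let ?Fx = "drift \<alpha> p ((x + y) / 2) x" and ?Fy = "drift \<alpha> p ((x + y) / 2) y"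
  define \<tau>1 \<tau>2 where "\<tau>1 = 1 / (real (n + t1) + 1)" and "\<tau>2 = 1 / (real (n + t2) + 1)"
  define q' where "q' = p * share \<alpha> ?m + (1 - p) * share \<alpha> y"
  define R where "R = A + ?n * W\<^sup>2"
  define \<Delta> where "\<Delta> = (\<lambda>a b. (a - x) * \<tau>1 + (b - y) * \<tau>2)"
  define M where "M = (q - x) * \<tau>1 + (q' - y) * \<tau>2"
  \<comment> \<open>A bound for the square of the increment S of R, obtained from |S| \<le> W^2 + 8
    |W| + 8 / n.\<close>
  define k where "k = 3 * (W^4 + 64 * W\<^sup>2 + 64 / ?n\<^sup>2)"
  have n1: "?n \<ge> 1" using n by simp
  have n0: "?n > 0" using n1 by simp
  have qq: "q \<in> {0..1}" "q' \<in> {0..1}"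
    unfolding q_def q'_def by (rule mixture_bounds, fact)+
  have \<tau>: "0 \<le> \<tau>1" "0 \<le> \<tau>2" "\<tau>1 \<le> 1 / ?n" "\<tau>2 \<le> 1 / ?n" "1 / (2 * ?n) \<le> \<tau>1"
    using n0 n by (auto simp: \<tau>1_def \<tau>2_def divide_simps)
  have d: "\<bar>(q - x) * \<tau>1 - ?Fx / ?n\<bar> \<le> D / ?n\<^sup>2" "\<bar>(q' - y) * \<tau>2 - ?Fy / ?n\<bar> \<le> D / ?n\<^sup>2"
    using drift_approx[of \<alpha> p n x y x t1 t1 t2] drift_approx[of \<alpha> p n x y y t2 t1 t2] \<alpha> p n xy
    by (simp_all add: drift_def q_def q'_def \<tau>1_def \<tau>2_def D_def)
  have W1: "\<bar>W\<bar> \<le> 1" using xy by (auto simp: W_def)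
  then have W2: "W\<^sup>2 \<le> 1" "W\<^sup>2 \<ge> 0" by (auto simp: abs_square_le_1)
  have R: "R \<ge> A" "R \<ge> ?n * W\<^sup>2" "R > 0"
    using A W2 n0 by (auto simp: R_def add_pos_nonneg)
  have k0: "k \<ge> 0" by (simp add: k_def)
  \<comment> \<open>The second-order loss of the logarithm. R \<ge> n W^2 reduces W^4 / R, and R
    \<ge> A makes W^2 / R a small multiple of W^2 when A is large; 384 = 2 * 3 * 64.\<close>
  have kR: "2 * k / R \<le> W\<^sup>2 * (6 / ?n + 384 / A) + 384 / ?n\<^sup>2"
  proof -
    have "W^4 / R \<le> W\<^sup>2 / ?n"
    proof -
      have "W^4 * ?n = W\<^sup>2 * (?n * W\<^sup>2)" by (simp add: power2_eq_square power4_eq_xxxx)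
      also have "\<dots> \<le> W\<^sup>2 * R" using R W2 by (intro mult_left_mono) auto
      finally show ?thesis using R n0 by (simp add: divide_simps)
    qed
    moreover have "W\<^sup>2 / R \<le> W\<^sup>2 / A"
      using A R by (intro divide_left_mono) auto
    moreover have "(1 / ?n\<^sup>2) / R \<le> (1 / ?n\<^sup>2) / 1"
      using A R by (intro divide_left_mono) auto
    moreover have "2 * k / R = 6 * (W^4 / R) + 384 * (W\<^sup>2 / R) + 384 * ((1 / ?n\<^sup>2) / R)"
      by (simp add: k_def add_divide_distrib distrib_left)
    moreover have "W\<^sup>2 * (6 / ?n + 384 / A) + 384 / ?n\<^sup>2 = 6 * (W\<^sup>2 / ?n) + 384 * (W\<^sup>2 / A) + 384 * ((1 / ?n\<^sup>2) / 1)"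
      by (simp add: distrib_left ac_simps)
    ultimately show ?thesis by linarith
  qed
  have pointwise: "ln R + (W\<^sup>2 / R + (2 * (?n + 1) * W / R) * \<Delta> a b + ((?n + 1) / R) * (\<Delta> a b)\<^sup>2) - 2 * k / R\<^sup>2
      \<le> ln (A + real (Suc n) * (x + (a - x) * \<tau>1 + (y + (b - y) * \<tau>2) - 1)\<^sup>2)"
    if ab: "a \<in> {0, 1}" "b \<in> {0, 1}" for a b
  proof -
    define S where "S = W\<^sup>2 + 2 * (?n + 1) * W * \<Delta> a b + (?n + 1) * (\<Delta> a b)\<^sup>2"
    have "x + (a - x) * \<tau>1 + (y + (b - y) * \<tau>2) - 1 = W + \<Delta> a b"
      by (simp add: W_def \<Delta>_def)
    then have R': "A + real (Suc n) * (x + (a - x) * \<tau>1 + (y + (b - y) * \<tau>2) - 1)\<^sup>2 = R + S"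
      by (simp add: R_def S_def power2_eq_square algebra_simps)
    have \<Delta>: "\<bar>\<Delta> a b\<bar> \<le> 2 / ?n"
    proof -
      have "\<bar>(a - x) * \<tau>1\<bar> \<le> 1 * (1 / ?n)" "\<bar>(b - y) * \<tau>2\<bar> \<le> 1 * (1 / ?n)"
        unfolding abs_mult using ab xy \<tau> by (intro mult_mono; auto)+
      then show ?thesis unfolding \<Delta>_def by linarith
    qed
    have S: "\<bar>S\<bar> \<le> W\<^sup>2 + 8 * \<bar>W\<bar> + 8 / ?n"
    proof -
      have "\<bar>2 * (?n + 1) * W * \<Delta> a b\<bar> = (2 * (?n + 1) * \<bar>W\<bar>) * \<bar>\<Delta> a b\<bar>"
        using n0 by (simp add: abs_mult)
      also have "\<dots> \<le> (4 * ?n * \<bar>W\<bar>) * (2 / ?n)"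
        by (rule mult_mono) (use n1 \<Delta> in \<open>auto intro: mult_right_mono\<close>)
      also have "\<dots> = 8 * \<bar>W\<bar>" using n0 by simp
      finally have 1: "\<bar>2 * (?n + 1) * W * \<Delta> a b\<bar> \<le> 8 * \<bar>W\<bar>" .
      have "(\<Delta> a b)\<^sup>2 \<le> (2 / ?n)\<^sup>2"
        using power_mono[OF \<Delta>, of 2] by simp
      then have "(?n + 1) * (\<Delta> a b)\<^sup>2 \<le> (2 * ?n) * (2 / ?n)\<^sup>2"
        using n1 by (intro mult_mono) auto
      also have "\<dots> = 8 / ?n" using n0 by (simp add: power2_eq_square)
      finally have 2: "(?n + 1) * (\<Delta> a b)\<^sup>2 \<le> 8 / ?n" .
      have 3: "(?n + 1) * (\<Delta> a b)\<^sup>2 \<ge> 0" by simp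
      have "\<bar>u + v + w\<bar> \<le> u + v' + w'" if "u \<ge> 0" "\<bar>v\<bar> \<le> v'" "w \<le> w'" "w \<ge> 0" for u v v' w w' :: real
        using that by linarith
      from this[OF W2(2) 1 2 3] show ?thesis
        unfolding S_def .
    qed
    have sq3: "(u + v + w)\<^sup>2 \<le> 3 * (u\<^sup>2 + v\<^sup>2 + w\<^sup>2)" for u v w :: real
    proof -
      have "3 * (u\<^sup>2 + v\<^sup>2 + w\<^sup>2) - (u + v + w)\<^sup>2 = (u - v)\<^sup>2 + (v - w)\<^sup>2 + (u - w)\<^sup>2"
        by (simp add: power2_eq_square algebra_simps)
      moreover have "(u - v)\<^sup>2 + (v - w)\<^sup>2 + (u - w)\<^sup>2 \<ge> 0" by simp
      ultimately show ?thesis by linarith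
    qed
    have "S\<^sup>2 \<le> (W\<^sup>2 + 8 * \<bar>W\<bar> + 8 / ?n)\<^sup>2"
      using power_mono[OF S, of 2] by simp
    also have "\<dots> \<le> 3 * ((W\<^sup>2)\<^sup>2 + (8 * \<bar>W\<bar>)\<^sup>2 + (8 / ?n)\<^sup>2)"
      by (rule sq3)
    also have "\<dots> = k"
      by (simp add: k_def power_divide power_mult_distrib)
    finally have Sk: "S\<^sup>2 \<le> k" .
    \<comment> \<open>\<open>A \<ge> 100\<close> makes the relative increment small enough for ln (1
      + s) \<ge> s - 2 s^2.\<close>
    have "\<bar>S / R\<bar> \<le> 17 / 100"
    proof -
      have "8 / ?n \<le> 8" using n1 by (simp add: divide_simps)
      then have "\<bar>S\<bar> \<le> 17" using S W1 W2 by linarith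
      then show ?thesis
        unfolding abs_divide using R A by (intro frac_le) auto
    qed
    then have half: "\<bar>S / R\<bar> \<le> 1/2" by linarith
    have "ln (R + S) = ln R + ln (1 + S / R)"
    proof -
      have "R + S = R * (1 + S / R)" using R by (simp add: field_simps)
      moreover have "1 + S / R > 0" using half by linarith
      ultimately show ?thesis using R by (simp add: ln_mult)
    qed
    moreover have "ln (1 + S / R) \<ge> S / R - 2 * (S / R)\<^sup>2"
      using abs_ln_one_plus_x_minus_x_bound[OF half] by linarith
    moreover have "2 * (S / R)\<^sup>2 \<le> 2 * k / R\<^sup>2"
      using Sk R by (simp add: power_divide divide_right_mono)
    moreover have "W\<^sup>2 / R + (2 * (?n + 1) * W / R) * \<Delta> a b + ((?n + 1) / R) * (\<Delta> a b)\<^sup>2 = S / R"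
      using R(3) by (simp add: S_def field_simps)
    ultimately show ?thesis unfolding R' by linarith
  qed
  have "ln R + W\<^sup>2 / R - 2 * k / R\<^sup>2 + (2 * (?n + 1) * W / R) * M +
      ((?n + 1) / R) * (M\<^sup>2 + q * (1 - q) * \<tau>1\<^sup>2 + q' * (1 - q') * \<tau>2\<^sup>2) =
      bern2 q q' (\<lambda>a b. ln R + W\<^sup>2 / R - 2 * k / R\<^sup>2 + (2 * (?n + 1) * W / R) * \<Delta> a b + ((?n + 1) / R) * (\<Delta> a b)\<^sup>2)"
    unfolding \<Delta>_def M_def by (rule bern2_quadratic[symmetric])
  also have "\<dots> \<le> bern2 q q' (\<lambda>a b. ln (A + real (Suc n) * (x + (a - x) * \<tau>1 + (y + (b - y) * \<tau>2) - 1)\<^sup>2))"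
    using pointwise by (intro bern2_mono qq) (simp add: algebra_simps)
  also have "\<dots> = expect \<alpha> p t1 t2 n (\<lambda>x y. ln (A + real (Suc n) * (x + y - 1)\<^sup>2)) x y"
    by (simp add: expect_def q_def q'_def \<tau>1_def \<tau>2_def)
  finally have main: "ln R + W\<^sup>2 / R - 2 * k / R\<^sup>2 + (2 * (?n + 1) * W / R) * M +
      ((?n + 1) / R) * (M\<^sup>2 + q * (1 - q) * \<tau>1\<^sup>2 + q' * (1 - q') * \<tau>2\<^sup>2) \<le>
      expect \<alpha> p t1 t2 n (\<lambda>x y. ln (A + real (Suc n) * (x + y - 1)\<^sup>2)) x y" (is "?L \<le> ?E") .
  have "R * (?E - ln R) \<ge> R * (?L - ln R)"
    using main R by (intro mult_left_mono) auto
  also have "R * (?L - ln R) = W\<^sup>2 - 2 * k / R + 2 * (?n + 1) * W * M +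
      (?n + 1) * (M\<^sup>2 + q * (1 - q) * \<tau>1\<^sup>2 + q' * (1 - q') * \<tau>2\<^sup>2)"
    using R by (simp add: field_simps power2_eq_square)
  finally have lower: "W\<^sup>2 - 2 * k / R + 2 * (?n + 1) * W * M +
      (?n + 1) * (M\<^sup>2 + q * (1 - q) * \<tau>1\<^sup>2 + q' * (1 - q') * \<tau>2\<^sup>2) \<le> R * (?E - ln R)" .
  \<comment> \<open>The variance of urn 1 alone gives the bound: its step is at least 1 / (2 n)
    because n \<ge> t1 + 1, and the other terms are nonnegative.\<close>
  have noise: "\<sigma> / (4 * ?n) \<le> (?n + 1) * (M\<^sup>2 + q * (1 - q) * \<tau>1\<^sup>2 + q' * (1 - q') * \<tau>2\<^sup>2)"
  proof -
    have "(1 / (2 * ?n))\<^sup>2 \<le> \<tau>1\<^sup>2"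
      using \<tau> n0 by (intro power_mono) auto
    then have "\<sigma> * (1 / (2 * ?n))\<^sup>2 \<le> q * (1 - q) * \<tau>1\<^sup>2"
      using \<sigma> qq by (intro mult_mono) auto
    also have "\<dots> \<le> M\<^sup>2 + q * (1 - q) * \<tau>1\<^sup>2 + q' * (1 - q') * \<tau>2\<^sup>2"
      using qq by simp
    finally have "?n * (\<sigma> * (1 / (2 * ?n))\<^sup>2) \<le> (?n + 1) * (M\<^sup>2 + q * (1 - q) * \<tau>1\<^sup>2 + q' * (1 - q') * \<tau>2\<^sup>2)"
      using \<sigma> n0 by (intro mult_mono) auto
    moreover have "?n * (\<sigma> * (1 / (2 * ?n))\<^sup>2) = \<sigma> / (4 * ?n)"
      using n0 by (simp add: power2_eq_square)
    ultimately show ?thesis by simp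
  qed
  have drift: "2 * (?n + 1) * W * M \<ge> 2 * \<kappa> * W\<^sup>2 - 2 * \<bar>\<kappa>\<bar> / ?n * W\<^sup>2 - \<epsilon> * W\<^sup>2 - (16 * D\<^sup>2 / \<epsilon>) / ?n\<^sup>2"
  proof -
    have D0: "D \<ge> 0" using \<alpha> by (simp add: D_def)
    have "\<bar>M - (?Fx + ?Fy) / ?n\<bar> \<le> 2 * D / ?n\<^sup>2"
      using d unfolding M_def add_divide_distrib by linarith
    then have "\<bar>W * (M - (?Fx + ?Fy) / ?n)\<bar> \<le> \<bar>W\<bar> * (2 * D / ?n\<^sup>2)"
      unfolding abs_mult by (intro mult_left_mono) auto
    then have "W * M \<ge> W * (?Fx + ?Fy) / ?n - \<bar>W\<bar> * (2 * D / ?n\<^sup>2)"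
      by (simp add: right_diff_distrib abs_le_iff)
    moreover have "W * (?Fx + ?Fy) / ?n \<ge> \<kappa> * W\<^sup>2 / ?n"
      using \<kappa> n0 by (intro divide_right_mono) auto
    ultimately have "W * M \<ge> \<kappa> * W\<^sup>2 / ?n - \<bar>W\<bar> * (2 * D / ?n\<^sup>2)"
      by linarith
    then have "2 * (?n + 1) * (W * M) \<ge> 2 * (?n + 1) * (\<kappa> * W\<^sup>2 / ?n - \<bar>W\<bar> * (2 * D / ?n\<^sup>2))"
      using n0 by (intro mult_left_mono) auto
    moreover have "2 * (?n + 1) * (\<kappa> * W\<^sup>2 / ?n - \<bar>W\<bar> * (2 * D / ?n\<^sup>2)) =
        2 * \<kappa> * W\<^sup>2 + 2 * (\<kappa> / ?n) * W\<^sup>2 - 2 * (?n + 1) * (\<bar>W\<bar> * (2 * D / ?n\<^sup>2))"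
      using n0 by (simp add: field_simps)
    moreover have "2 * (\<kappa> / ?n) * W\<^sup>2 \<ge> - 2 * \<bar>\<kappa>\<bar> / ?n * W\<^sup>2"
    proof -
      have "(- \<bar>\<kappa>\<bar> / ?n) * W\<^sup>2 \<le> (\<kappa> / ?n) * W\<^sup>2"
        using n0 W2 by (intro mult_right_mono divide_right_mono) auto
      then show ?thesis by simp
    qed
    moreover have "2 * (?n + 1) * (\<bar>W\<bar> * (2 * D / ?n\<^sup>2)) \<le> (8 * D) * \<bar>W\<bar> / ?n"
    proof -
      have "2 * (?n + 1) * (\<bar>W\<bar> * (2 * D / ?n\<^sup>2)) \<le> (4 * ?n) * (\<bar>W\<bar> * (2 * D / ?n\<^sup>2))"
        using n1 D0 by (intro mult_right_mono) auto
      also have "\<dots> = (8 * D) * \<bar>W\<bar> / ?n"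
        using n0 by (simp add: power2_eq_square)
      finally show ?thesis .
    qed
    moreover have "(8 * D) * \<bar>W\<bar> / ?n \<le> \<epsilon> * W\<^sup>2 + (8 * D)\<^sup>2 / (4 * \<epsilon> * ?n\<^sup>2)"
      by (rule abs_mult_le_AM_GM[OF \<epsilon> n0])
    moreover have "(8 * D)\<^sup>2 / (4 * \<epsilon> * ?n\<^sup>2) = (16 * D\<^sup>2 / \<epsilon>) / ?n\<^sup>2"
      by (simp add: power_mult_distrib)
    ultimately show ?thesis
      unfolding mult.assoc[of "2 * (?n + 1)" W M] by linarith
  qed
  have "W\<^sup>2 * (1 + 2 * \<kappa> - 2 * \<bar>\<kappa>\<bar> / ?n - \<epsilon> - 6 / ?n - 384 / A) + \<sigma> / (4 * ?n) - (16 * D\<^sup>2 / \<epsilon> + 384) / ?n\<^sup>2 =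
      W\<^sup>2 + (2 * \<kappa> * W\<^sup>2 - 2 * \<bar>\<kappa>\<bar> / ?n * W\<^sup>2 - \<epsilon> * W\<^sup>2 - (16 * D\<^sup>2 / \<epsilon>) / ?n\<^sup>2)
      - (W\<^sup>2 * (6 / ?n + 384 / A) + 384 / ?n\<^sup>2) + \<sigma> / (4 * ?n)"
    by (simp add: add_divide_distrib algebra_simps)
  also have "\<dots> \<le> W\<^sup>2 + 2 * (?n + 1) * W * M - 2 * k / R + \<sigma> / (4 * ?n)"
    using drift kR by (intro add_right_mono diff_mono add_left_mono)
  also have "\<dots> \<le> W\<^sup>2 - 2 * k / R + 2 * (?n + 1) * W * M +
      (?n + 1) * (M\<^sup>2 + q * (1 - q) * \<tau>1\<^sup>2 + q' * (1 - q') * \<tau>2\<^sup>2)"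
    using noise by simp
  also note lower
  finally show ?thesis
    unfolding R_def .
qed

text \<open>With v = n W^2 and up to the factor 1 / (n ln n), the fraction is the gain of ln (A + v)
  and the subtracted quotient the loss from the growth of the normaliser ln n. For large v the gain
  is at least 1 + c/2 and the loss at most 1 + o(1); for bounded v the noise term c/16 keeps the
  gain positive while the loss tends to 0.\<close>

lemma log_ratio_gap:
  fixes c A :: real
  assumes "c > 0" "A \<ge> 1"
  obtains \<kappa> N where "\<kappa> > 0"
    "\<And>n v. n \<ge> N \<Longrightarrow> 0 \<le> v \<Longrightarrow> v \<le> real n \<Longrightarrow> ((1 + c) * v + c / 16) / (A + v) - ln (A + v) / ln (real n) \<ge> \<kappa>"
proof -
  \<comment> \<open>Solves (c/2) v0 = (1 + c/2) A, so that a gain of 1 + c/2 is guaranteed from v0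
    on.\<close>
  define v0 where "v0 = A * (2 / c + 1)"
  define g where "g = (c / 16) / (A + v0)"
  have v0: "v0 \<ge> 0" and g: "g > 0"
    using assms by (auto simp: v0_def g_def intro!: mult_nonneg_nonneg divide_pos_pos add_pos_nonneg)
  have "(\<lambda>n. 1 / ln (real n)) \<longlonglongrightarrow> 0"
    by real_asymp
  note lim = tendsto_mult_right_zero[OF this]
  have "\<forall>\<^sub>F n in sequentially. ln (A + 1) * (1 / ln (real n)) < c / 4"
    by (rule order_tendstoD(2)[OF lim]) (use assms in simp)
  moreover have "\<forall>\<^sub>F n in sequentially. ln (A + v0) * (1 / ln (real n)) < g / 2"
    by (rule order_tendstoD(2)[OF lim]) (use g in simp)
  moreover have "\<forall>\<^sub>F n in sequentially. n \<ge> (2 :: nat)"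
    by (rule eventually_ge_at_top)
  ultimately have "\<forall>\<^sub>F n in sequentially. n \<ge> 2 \<and> ln (A + 1) * (1 / ln (real n)) < c / 4 \<and> ln (A + v0) * (1 / ln (real n)) < g / 2"
    by eventually_elim auto
  then obtain N where N: "\<And>n. n \<ge> N \<Longrightarrow> n \<ge> 2 \<and> ln (A + 1) * (1 / ln (real n)) < c / 4 \<and> ln (A + v0) * (1 / ln (real n)) < g / 2"
    by (auto simp: eventually_sequentially)
  show ?thesis
  proof (rule that[of "min (c / 4) (g / 2)" N])
    show "min (c / 4) (g / 2) > 0"
      using assms g by simp
    fix n v assume n: "n \<ge> N" and v: "0 \<le> v" "v \<le> real n"
    have ln: "ln (real n) > 0" using N[OF n] by simp
    show "((1 + c) * v + c / 16) / (A + v) - ln (A + v) / ln (real n) \<ge> min (c / 4) (g / 2)"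
    proof (cases "v \<ge> v0")
      case True
      have "(1 + c / 2) * (A + v) \<le> (1 + c) * v + c / 16"
      proof -
        have "(c / 2) * v0 \<le> (c / 2) * v"
          using True assms by (intro mult_left_mono) auto
        moreover have "(c / 2) * v0 = A + (c / 2) * A"
          using assms by (simp add: v0_def field_simps)
        moreover have "(1 + c / 2) * (A + v) = A + (c / 2) * A + v + (c / 2) * v"
          "(1 + c) * v = v + (c / 2) * v + (c / 2) * v"
          by (simp_all add: field_simps)
        ultimately show ?thesis
          using assms(1) by linarith
      qed
      then have 1: "((1 + c) * v + c / 16) / (A + v) \<ge> 1 + c / 2"
        using assms v by (simp add: pos_le_divide_eq)
      have "A + v \<le> (A + 1) * real n"
      proof -
        have "A * 1 \<le> A * real n"
          using N[OF n] assms by (intro mult_left_mono) auto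
        then show ?thesis using v by (simp add: distrib_right)
      qed
      then have "ln (A + v) \<le> ln ((A + 1) * real n)"
        using assms v by (intro ln_mono) auto
      also have "\<dots> = ln (A + 1) + ln (real n)"
        using assms N[OF n] by (simp add: ln_mult)
      finally have "ln (A + v) / ln (real n) \<le> (ln (A + 1) + ln (real n)) / ln (real n)"
        using ln by (intro divide_right_mono) auto
      also have "\<dots> = ln (A + 1) * (1 / ln (real n)) + 1"
        using ln by (simp add: add_divide_distrib)
      finally show ?thesis
        using 1 N[OF n] by linarith
    next
      case False
      have "g \<le> ((1 + c) * v + c / 16) / (A + v)"
        unfolding g_def using False assms v by (intro frac_le) auto
      moreover have "ln (A + v) / ln (real n) \<le> ln (A + v0) * (1 / ln (real n))"
        using False assms v ln by (simp add: divide_right_mono)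
      ultimately show ?thesis
        using N[OF n] by linarith
    qed
  qed
qed

text \<open>Comparison with the telescoping sum of ln (ln k): applying ln z \<le> z - 1 twice bounds
  each increment by 1 / (k ln k).\<close>

lemma sum_inverse_n_ln_n_diverges:
  assumes "\<kappa> > 0" "N \<ge> 3"
  shows "\<exists>n. (\<Sum>k=N..<n. \<kappa> / (real k * ln (real k))) > b"
proof -
  have ln_ln: "ln (ln (real (Suc k))) - ln (ln (real k)) \<le> 1 / (real k * ln (real k))" if "k \<ge> 3" for k
  proof -
    have k: "real k > 1" using that by simp
    then have l: "ln (real k) > 0" "ln (real (Suc k)) > 0" by simp_all
    have "ln (real (Suc k)) - ln (real k) = ln (real (Suc k) / real k)"
      using k by (simp add: ln_div)
    also have "\<dots> \<le> real (Suc k) / real k - 1"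
      using k by (intro ln_le_minus_one) simp
    also have "\<dots> = 1 / real k"
      using k by (simp add: field_simps)
    finally have d: "ln (real (Suc k)) - ln (real k) \<le> 1 / real k" .
    have "ln (ln (real (Suc k))) - ln (ln (real k)) = ln (ln (real (Suc k)) / ln (real k))"
      using l by (simp add: ln_div)
    also have "\<dots> \<le> ln (real (Suc k)) / ln (real k) - 1"
      using l by (intro ln_le_minus_one) simp
    also have "\<dots> = (ln (real (Suc k)) - ln (real k)) / ln (real k)"
      using l by (simp add: diff_divide_distrib)
    also have "\<dots> \<le> (1 / real k) / ln (real k)"
      using d l by (intro divide_right_mono) auto
    finally show ?thesis by simp
  qed
  have lower: "\<kappa> * (ln (ln (real n)) - ln (ln (real N))) \<le> (\<Sum>k=N..<n. \<kappa> / (real k * ln (real k)))" if "n \<ge> N" for n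
    using that
  proof (induction n rule: dec_induct)
    case (step n)
    have "\<kappa> * (ln (ln (real (Suc n))) - ln (ln (real n))) \<le> \<kappa> * (1 / (real n * ln (real n)))"
      using assms step by (intro mult_left_mono ln_ln) auto
    then show ?case
      using step by (simp add: right_diff_distrib)
  qed simp
  have "filterlim (\<lambda>n. \<kappa> * (ln (ln (real n)) - ln (ln (real N)))) at_top sequentially"
    using assms(1) by real_asymp
  then have "\<forall>\<^sub>F n in sequentially. \<kappa> * (ln (ln (real n)) - ln (ln (real N))) > b"
    by (simp add: filterlim_at_top_dense)
  then obtain n where "n \<ge> N" "\<kappa> * (ln (ln (real n)) - ln (ln (real N))) > b"
    using eventually_happens'[OF sequentially_bot eventually_conj[OF eventually_ge_at_top[of N]]] by blast
  then show ?thesis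
    using lower[of n] by (intro exI[of _ n]) linarith
qed

lemma eventually_mult_le:
  fixes C d :: real
  assumes "f \<longlonglongrightarrow> 0" "d > 0"
  shows "\<forall>\<^sub>F n in sequentially. C * f n \<le> d"
proof -
  have "(\<lambda>n. C * f n) \<longlonglongrightarrow> 0"
    using assms(1) by (rule tendsto_mult_right_zero)
  then have "\<forall>\<^sub>F n in sequentially. C * f n < d"
    using assms(2) by (rule order_tendstoD)
  then show ?thesis
    by eventually_elim simp
qed

text \<open>If every point away from the sinks has either a nonvanishing drift or an antisymmetric
  instability together with noise, then the potential plus the normalised logarithm above increases
  by \<open>const / (n * ln n)\<close> on average, which is not summable; so the process must come close to a sink.\<close>

lemma hits_neighbourhood_of_sinks:
  fixes s0 :: config
  assumes \<alpha>: "\<alpha> \<ge> 1" and p: "p \<in> {0..1}" and t: "balls (fst s0) \<ge> 1" "balls (snd s0) \<ge> 1"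
    and c: "0 < c" "c \<le> 1"
    and unstable: "\<And>x y. x \<in> {0..1} \<Longrightarrow> y \<in> {0..1} \<Longrightarrow> \<bar>x + y - 1\<bar> < 31/32 \<Longrightarrow>
      (drift \<alpha> p ((x + y) / 2) x)\<^sup>2 + (drift \<alpha> p ((x + y) / 2) y)\<^sup>2 \<ge> c \<or>
      (x + y - 1) * (drift \<alpha> p ((x + y) / 2) x + drift \<alpha> p ((x + y) / 2) y) \<ge> c * (x + y - 1)\<^sup>2 \<and>
      (p * share \<alpha> ((x + y) / 2) + (1 - p) * share \<alpha> x) * (1 - (p * share \<alpha> ((x + y) / 2) + (1 - p) * share \<alpha> x)) \<ge> c"
  shows "\<exists>N. \<forall>n\<ge>N. AE \<omega> in urn_law s0 \<alpha> p. \<exists>k\<ge>n. \<bar>bfrac (fst (\<omega> k)) + bfrac (snd (\<omega> k)) - 1\<bar> \<ge> 31/32"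
proof -
  define t1 t2 where "t1 = balls (fst s0)" and "t2 = balls (snd s0)"
  have \<alpha>0: "\<alpha> > 0" using \<alpha> by simp
  obtain V B where V: "\<And>x y x' y'. x \<in> {0..1} \<Longrightarrow> y \<in> {0..1} \<Longrightarrow> x' \<in> {0..1} \<Longrightarrow> y' \<in> {0..1} \<Longrightarrow>
      V x' y' \<ge> V x y + drift \<alpha> p ((x + y) / 2) x * (x' - x) + drift \<alpha> p ((x + y) / 2) y * (y' - y)
        - ((x' - x)\<^sup>2 + (y' - y)\<^sup>2) / 2"
    and B: "\<And>x y. x \<in> {0..1} \<Longrightarrow> y \<in> {0..1} \<Longrightarrow> \<bar>V x y\<bar> \<le> B" "B \<ge> 0"
    by (rule potential_exists[OF \<alpha>0 p]) (rule that)
  define D where "D = real (t1 + t2) * (1 + \<alpha>) + 1"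
  \<comment> \<open>3072 = 8 * 384, so the loss 384 / A in \<open>log_drift\<close> is at most
    c/8.\<close>
  define A where "A = 100 + 3072 / c"
  define G where "G = 16 * D\<^sup>2 / (c / 4) + 384"
  define U where "U = ln (A + 1) + 1"
  have A: "A \<ge> 100" "384 / A \<le> c / 8"
    using c by (auto simp: A_def field_simps)
  have D: "D \<ge> 1" and G: "G \<ge> 0"
    using \<alpha> c by (auto simp: D_def G_def)
  have U: "U \<ge> 1" using A by (simp add: U_def)
  obtain \<kappa> N0 where \<kappa>: "\<kappa> > 0" and gap: "\<And>n v. n \<ge> N0 \<Longrightarrow> 0 \<le> v \<Longrightarrow> v \<le> real n \<Longrightarrow>
      ((1 + c) * v + c / 16) / (A + v) - ln (A + v) / ln (real n) \<ge> \<kappa>"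
    using log_ratio_gap[of c A] c A by auto
  define \<eta> where "\<eta> = min (c / 2) (\<kappa> / 4)"
  have \<eta>: "\<eta> > 0" "\<eta> \<le> c / 2" "\<eta> \<le> \<kappa> / 4"
    using c \<kappa> by (auto simp: \<eta>_def)
  define u where "u = (\<lambda>n x y. ln (A + real n * (x + y - 1)\<^sup>2))"
  \<comment> \<open>\<open>frac_hits\<close> asks for a nonnegative function that decreases on
    average, hence the sign and the offset B + U, which dominates the potential plus the normalised
    logarithm.\<close>
  define \<Psi> where "\<Psi> = (\<lambda>n x y. (B + U) - (V x y + u n x y / ln (real n)))"
  have lim: "(\<lambda>n. 1 / real n) \<longlonglongrightarrow> 0" "(\<lambda>n. 1 / ln (real (Suc n))) \<longlonglongrightarrow> 0" "(\<lambda>n. ln (real n) / real n) \<longlonglongrightarrow> 0"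
    by real_asymp+
  have "\<forall>\<^sub>F n in sequentially. n \<ge> max (max 3 (t1 + 1)) N0 \<and> ln (real n) \<ge> 1 \<and> 8 * (1 / real n) \<le> c / 8 \<and>
      \<alpha> * real (t1 + t2) * (1 / real n) \<le> c / 2 \<and> G * (1 / real n) \<le> c / 16 \<and> (2 * D + 1) * (1 / real n) \<le> c / 4 \<and>
      (2 + G + U) * (1 / ln (real (Suc n))) \<le> c / 4 \<and> (2 * D + 1) * (ln (real n) / real n) \<le> \<kappa> / 4"
    using c \<kappa> by (intro eventually_conj eventually_mult_le lim eventually_ge_at_top) (auto intro: order_less_imp_le, real_asymp)
  then obtain N where N: "\<And>n. n \<ge> N \<Longrightarrow> n \<ge> max (max 3 (t1 + 1)) N0 \<and> ln (real n) \<ge> 1 \<and> 8 * (1 / real n) \<le> c / 8 \<and>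
      \<alpha> * real (t1 + t2) * (1 / real n) \<le> c / 2 \<and> G * (1 / real n) \<le> c / 16 \<and> (2 * D + 1) * (1 / real n) \<le> c / 4 \<and>
      (2 + G + U) * (1 / ln (real (Suc n))) \<le> c / 4 \<and> (2 * D + 1) * (ln (real n) / real n) \<le> \<kappa> / 4"
    by (auto simp: eventually_sequentially)
  have u_bounds: "0 \<le> u n x y" "u n x y / ln (real n) \<le> U" if n: "n \<ge> N" and xy: "x \<in> {0..1}" "y \<in> {0..1}" for n x y
  proof -
    have "(x + y - 1)\<^sup>2 \<le> 1"
      using xy by (auto simp: abs_square_le_1)
    then have "real n * (x + y - 1)\<^sup>2 \<le> real n * 1"
      by (intro mult_left_mono) auto
    moreover have "A * 1 \<le> A * real n"
      using N[OF n] A by (intro mult_left_mono) auto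
    ultimately have "A + real n * (x + y - 1)\<^sup>2 \<le> (A + 1) * real n"
      by (simp add: distrib_right)
    moreover have ge: "A + real n * (x + y - 1)\<^sup>2 \<ge> 1"
      using A by (auto intro: add_increasing2)
    ultimately have "u n x y \<le> ln ((A + 1) * real n)"
      unfolding u_def by (intro ln_mono) auto
    also have "\<dots> = ln (A + 1) + ln (real n)"
      using A N[OF n] by (simp add: ln_mult)
    finally have "u n x y / ln (real n) \<le> (ln (A + 1) + ln (real n)) / ln (real n)"
      using N[OF n] by (intro divide_right_mono) auto
    also have "\<dots> = ln (A + 1) / ln (real n) + 1"
    proof -
      have "n \<ge> 3" using N[OF n] by (simp only: max.bounded_iff)
      then show ?thesis by (simp add: add_divide_distrib)
    qed
    also have "ln (A + 1) / ln (real n) \<le> ln (A + 1) / 1"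
    proof (rule divide_left_mono)
      have "ln (real n) \<ge> 1" using N[OF n] by blast
      then show "1 \<le> ln (real n)" "0 < ln (real n) * 1" by linarith+
    qed (use A in simp)
    finally show "u n x y / ln (real n) \<le> U"
      by (simp add: U_def)
    show "0 \<le> u n x y"
      unfolding u_def using ge by simp
  qed
  have decrease: "expect \<alpha> p t1 t2 n (\<Psi> (Suc n)) x y + \<eta> / (real n * ln (real n)) \<le> \<Psi> n x y"
    if n: "n \<ge> N" and xy: "x \<in> {0..1}" "y \<in> {0..1}" and W: "\<bar>x + y - 1\<bar> < 31/32" for n x y
  proof -
    let ?n = "real n" and ?Fx = "drift \<alpha> p ((x + y) / 2) x" and ?Fy = "drift \<alpha> p ((x + y) / 2) y"
    let ?W = "x + y - 1"
    define s s' where "s = ln (real n)" and "s' = ln (real (Suc n))"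
    note Nn = N[OF n, folded s_def s'_def] and ub = u_bounds[OF n xy, folded s_def]
    define R where "R = A + ?n * ?W\<^sup>2"
    define EV where "EV = expect \<alpha> p t1 t2 n V x y"
    define a where "a = expect \<alpha> p t1 t2 n (u (Suc n)) x y - u n x y"
    define q where "q = p * share \<alpha> (pool t1 t2 n x y) + (1 - p) * share \<alpha> x"
    have n0: "?n \<ge> 3" "n \<ge> t1 + 1" "n \<ge> 1" and s: "s \<ge> 1"
      using Nn by auto
    have s': "s \<le> s'" "s' - s \<le> 1 / ?n"
    proof -
      show "s \<le> s'" using n0 by (simp add: s_def s'_def)
      have "s' - s = ln (real (Suc n) / ?n)"
        using n0 by (simp add: s_def s'_def ln_div)
      also have "\<dots> \<le> real (Suc n) / ?n - 1"
        using n0 by (intro ln_le_minus_one) simp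
      also have "\<dots> = 1 / ?n"
        using n0 by (simp add: field_simps)
      finally show "s' - s \<le> 1 / ?n" .
    qed
    have pos: "s > 0" "s' > 0" "?n > 0" "?n \<noteq> 0"
      using s s' n0 by linarith+
    have "1 / ?n \<le> 1" using n0 by simp
    then have s'2: "s' \<le> 2 * s" using s' s by linarith
    have W2: "?W\<^sup>2 \<le> 1" using xy by (auto simp: abs_square_le_1)
    have R: "R \<ge> A" "R \<ge> ?n * ?W\<^sup>2" "R > 0"
      using A n0 by (auto simp: R_def add_pos_nonneg)
    have uR: "u n x y = ln R" by (simp add: u_def R_def)
    have expand: "expect \<alpha> p t1 t2 n (\<Psi> (Suc n)) x y = (B + U) - (EV + (u n x y + a) / s')"
      unfolding \<Psi>_def EV_def a_def s'_def by (subst expect_combine) simp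
    \<comment> \<open>The price of changing the normaliser from ln n to ln (n + 1).\<close>
    have split: "u n x y / s \<le> u n x y / s' + (u n x y / s) / (?n * s')"
    proof -
      have "u n x y / s - u n x y / s' = (u n x y / s) * ((s' - s) / s')"
        using s s' by (simp add: field_simps pos)
      also have "\<dots> \<le> (u n x y / s) * ((1 / ?n) / s')"
        using s s' ub(1) by (intro mult_left_mono divide_right_mono) auto
      finally show ?thesis by simp
    qed
    have EV: "EV \<ge> V x y + (?Fx\<^sup>2 + ?Fy\<^sup>2) / ?n - (2 * D + 1) / ?n\<^sup>2"
      unfolding EV_def D_def by (rule potential_drift[OF \<alpha> p n0(3) xy V[OF xy]])
    have drift_a: "R * a \<ge> ?W\<^sup>2 * (1 + 2 * l - 2 * \<bar>l\<bar> / ?n - c / 4 - 6 / ?n - 384 / A) + \<sigma> / (4 * ?n) - G / ?n\<^sup>2"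
      if "?W * (?Fx + ?Fy) \<ge> l * ?W\<^sup>2" "q * (1 - q) \<ge> \<sigma>" "\<sigma> \<ge> 0" for l \<sigma>
      using log_drift[OF \<alpha> p n0(2) xy A(1), of "c / 4" l \<sigma> t2] that c
      by (simp add: R_def a_def G_def D_def q_def u_def)
    have "\<eta> / (?n * s) \<le> EV - V x y + a / s' - (u n x y / s) / (?n * s')"
      using unstable[OF xy W]
    proof
      \<comment> \<open>Away from equilibria the potential gains at least 3 c / (4 n). The logarithm
        may lose O(1 / n), but division by ln n makes this at most c / (4 n) for large n.\<close>
      assume F: "?Fx\<^sup>2 + ?Fy\<^sup>2 \<ge> c"
      have "c / ?n \<le> (?Fx\<^sup>2 + ?Fy\<^sup>2) / ?n"
        using F by (intro divide_right_mono) auto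
      moreover have "(2 * D + 1) / ?n\<^sup>2 \<le> (c / 4) / ?n"
      proof -
        have "((2 * D + 1) * (1 / ?n)) / ?n \<le> (c / 4) / ?n"
          using Nn by (intro divide_right_mono) auto
        then show ?thesis by (simp add: power2_eq_square)
      qed
      ultimately have 1: "EV - V x y \<ge> (3 * c / 4) / ?n"
        using EV by (simp add: diff_divide_distrib field_simps)
      \<comment> \<open>Increasing shares push x + y away from 1, so only the linear term -W^2 can
        be negative and the rate \<open>l = - 1\<close> is always admissible in
        \<open>drift_a\<close>.\<close>
      have "?W * (?Fx + ?Fy) \<ge> - 1 * ?W\<^sup>2"
      proof -
        have m: "?W * (share \<alpha> ((x + y) / 2) - 1/2) \<ge> 0"
        proof (cases "?W \<ge> 0")
          case True
          then show ?thesis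
            using share_mono[of \<alpha> "1/2" "(x + y) / 2"] \<alpha> xy by (intro mult_nonneg_nonneg) (auto simp: share_half)
        next
          case False
          then show ?thesis
            using share_mono[of \<alpha> "(x + y) / 2" "1/2"] \<alpha> xy by (intro mult_nonpos_nonpos) (auto simp: share_half)
        qed
        have z: "?W * (share \<alpha> x + share \<alpha> y - 1) \<ge> 0"
        proof (cases "?W \<ge> 0")
          case True
          then show ?thesis
            using share_mono[of \<alpha> "1 - y" x] \<alpha> xy by (intro mult_nonneg_nonneg) (auto simp: share_compl)
        next
          case False
          then show ?thesis
            using share_mono[of \<alpha> x "1 - y"] \<alpha> xy by (intro mult_nonpos_nonpos) (auto simp: share_compl)
        qed
        have "?W * (?Fx + ?Fy) = 2 * p * (?W * (share \<alpha> ((x + y) / 2) - 1/2)) +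
            (1 - p) * (?W * (share \<alpha> x + share \<alpha> y - 1)) - ?W\<^sup>2"
          by (simp add: drift_def power2_eq_square field_simps)
        moreover have "2 * p * (?W * (share \<alpha> ((x + y) / 2) - 1/2)) \<ge> 0"
          "(1 - p) * (?W * (share \<alpha> x + share \<alpha> y - 1)) \<ge> 0"
          using m z p by (auto intro!: mult_nonneg_nonneg)
        ultimately show ?thesis by linarith
      qed
      moreover have "q * (1 - q) \<ge> 0"
        using mixture_bounds[OF p, of \<alpha> "pool t1 t2 n x y" x] by (auto simp: q_def)
      ultimately have "R * a \<ge> ?W\<^sup>2 * (1 + 2 * (- 1) - 2 * \<bar>- 1\<bar> / ?n - c / 4 - 6 / ?n - 384 / A) + 0 / (4 * ?n) - G / ?n\<^sup>2"
        by (intro drift_a) auto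
      moreover have "?W\<^sup>2 * (1 + 2 * (- 1) - 2 * \<bar>- 1\<bar> / ?n - c / 4 - 6 / ?n - 384 / A) \<ge> ?W\<^sup>2 * (- 2)"
      proof (rule mult_left_mono)
        have "2 * \<bar>- 1\<bar> / ?n + 6 / ?n \<le> c / 8"
          using Nn by simp
        then show "- 2 \<le> 1 + 2 * (- 1) - 2 * \<bar>- 1\<bar> / ?n - c / 4 - 6 / ?n - 384 / A"
          using A(2) c by linarith
      qed simp
      ultimately have Ra: "R * a \<ge> - 2 * ?W\<^sup>2 - G / ?n\<^sup>2" by simp
      have "R * (- (2 + G) / ?n) \<le> - 2 * ?W\<^sup>2 - G / ?n\<^sup>2"
      proof -
        have "2 * (?n * ?W\<^sup>2) / ?n \<le> 2 * R / ?n"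
          using R by (intro divide_right_mono) auto
        moreover have "(1 * G) / (?n * ?n) \<le> (R * G) / (?n * 1)"
          using R A G n0 by (intro frac_le mult_right_mono mult_left_mono) auto
        moreover have "R * (- (2 + G) / ?n) = - (2 * R / ?n) - (R * G) / ?n"
          by (simp add: algebra_simps add_divide_distrib diff_divide_distrib)
        ultimately show ?thesis
          using n0 by (simp add: power2_eq_square)
      qed
      with Ra have "R * (- (2 + G) / ?n) \<le> R * a" by linarith
      then have "- (2 + G) / ?n \<le> a" using R(3) by (simp only: mult_le_cancel_left_pos)
      then have "(- (2 + G) / ?n) / s' \<le> a / s'"
        using s s' by (intro divide_right_mono) auto
      moreover have "(u n x y / s) / (?n * s') \<le> U / (?n * s')"
        using ub(2) s s' by (intro divide_right_mono) auto
      moreover have "(- (2 + G) / ?n) / s' - U / (?n * s') = - (((2 + G + U) * (1 / s')) / ?n)"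
        using n0 s s' by (simp add: field_simps pos)
      moreover have "((2 + G + U) * (1 / s')) / ?n \<le> (c / 4) / ?n"
        using Nn by (intro divide_right_mono) auto
      ultimately have 2: "a / s' - (u n x y / s) / (?n * s') \<ge> - ((c / 4) / ?n)"
        by linarith
      have "\<eta> / (?n * s) \<le> (c / 2) / (?n * 1)"
        using \<eta> c n0 s by (intro frac_le mult_left_mono) auto
      moreover have "(3 * c / 4) / ?n - (c / 4) / ?n = (c / 2) / (?n * 1)"
        by (simp add: field_simps pos)
      ultimately show ?thesis using 1 2 by linarith
    next
      \<comment> \<open>In the unstable, noisy region the potential is only known to lose at most
        O(1 / n^2); the gain has to come from the logarithm, through \<open>gap\<close>.\<close>
      assume F: "?W * (?Fx + ?Fy) \<ge> c * ?W\<^sup>2 \<and>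
        (p * share \<alpha> ((x + y) / 2) + (1 - p) * share \<alpha> x) * (1 - (p * share \<alpha> ((x + y) / 2) + (1 - p) * share \<alpha> x)) \<ge> c"
      define Q where "Q = p * share \<alpha> ((x + y) / 2) + (1 - p) * share \<alpha> x"
      \<comment> \<open>The noise hypothesis speaks of the average fraction; passing to the pooled
        one costs half of \<open>c\<close>.\<close>
      have "q * (1 - q) \<ge> c / 2"
      proof -
        have qQ: "q \<in> {0..1}" "Q \<in> {0..1}"
          unfolding q_def Q_def by (rule mixture_bounds, fact)+
        have "\<bar>q - Q\<bar> = p * \<bar>share \<alpha> (pool t1 t2 n x y) - share \<alpha> ((x + y) / 2)\<bar>"
        proof -
          have "q - Q = p * (share \<alpha> (pool t1 t2 n x y) - share \<alpha> ((x + y) / 2))"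
            by (simp add: q_def Q_def algebra_simps)
          then show ?thesis using p by (simp add: abs_mult)
        qed
        also have "\<dots> \<le> 1 * (\<alpha> * \<bar>pool t1 t2 n x y - (x + y) / 2\<bar>)"
          using p \<alpha> xy pool_approx(2)[OF n0(3) xy] by (intro mult_mono share_lipschitz) auto
        also have "\<dots> \<le> \<alpha> * (real (t1 + t2) / ?n)"
          unfolding mult_1 by (rule mult_left_mono[OF pool_approx(1)[OF n0(3) xy]]) (use \<alpha> in simp)
        also have "\<dots> \<le> c / 2"
          using Nn by simp
        finally have d: "\<bar>q - Q\<bar> \<le> c / 2" .
        have "Q * (1 - Q) - q * (1 - q) = (q - Q) * (q + Q - 1)"
          by (simp add: algebra_simps)
        also have "\<dots> \<le> \<bar>q - Q\<bar> * \<bar>q + Q - 1\<bar>"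
          by (simp add: abs_mult[symmetric])
        also have "\<dots> \<le> \<bar>q - Q\<bar> * 1"
          using qQ by (intro mult_left_mono) auto
        finally show ?thesis
          using d F by (simp add: Q_def)
      qed
      then have Ra: "R * a \<ge> ?W\<^sup>2 * (1 + 2 * c - 2 * \<bar>c\<bar> / ?n - c / 4 - 6 / ?n - 384 / A) + (c / 2) / (4 * ?n) - G / ?n\<^sup>2"
        using F c by (intro drift_a) auto
      have "?W\<^sup>2 * (1 + c) \<le> ?W\<^sup>2 * (1 + 2 * c - 2 * \<bar>c\<bar> / ?n - c / 4 - 6 / ?n - 384 / A)"
      proof (rule mult_left_mono)
        have "2 * \<bar>c\<bar> / ?n \<le> 2 / ?n"
          using c n0 by (intro divide_right_mono) auto
        moreover have "2 / ?n + 6 / ?n \<le> c / 8"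
          using Nn by simp
        ultimately show "1 + c \<le> 1 + 2 * c - 2 * \<bar>c\<bar> / ?n - c / 4 - 6 / ?n - 384 / A"
          using A(2) c by linarith
      qed simp
      moreover have "G / ?n\<^sup>2 \<le> (c / 16) / ?n"
      proof -
        have "(G * (1 / ?n)) / ?n \<le> (c / 16) / ?n"
          using Nn by (intro divide_right_mono) auto
        then show ?thesis by (simp add: power2_eq_square)
      qed
      moreover have "(c / 2) / (4 * ?n) = (c / 16) / ?n + (c / 16) / ?n"
        using n0 by (simp add: field_simps pos)
      ultimately have "?W\<^sup>2 * (1 + c) + (c / 16) / ?n \<le> R * a"
        using Ra by linarith
      then have "(?W\<^sup>2 * (1 + c) + (c / 16) / ?n) / R \<le> a"
        using R(3) by (simp add: pos_divide_le_eq mult.commute)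
      moreover have "(?W\<^sup>2 * (1 + c) + (c / 16) / ?n) / R = (((1 + c) * (?n * ?W\<^sup>2) + c / 16) / R) / ?n"
        using n0 R(3) by (simp add: field_simps pos)
      ultimately have a: "(((1 + c) * (?n * ?W\<^sup>2) + c / 16) / R) / ?n \<le> a" by simp
      have "?n * ?W\<^sup>2 \<le> ?n * 1"
        using W2 by (intro mult_left_mono) auto
      then have "((1 + c) * (?n * ?W\<^sup>2) + c / 16) / R - u n x y / s \<ge> \<kappa>"
        using gap[of n "?n * ?W\<^sup>2"] Nn by (simp add: R_def u_def s_def)
      then have "\<kappa> / ?n / s' \<le> (((1 + c) * (?n * ?W\<^sup>2) + c / 16) / R - u n x y / s) / ?n / s'"
        using s s' by (intro divide_right_mono) auto
      also have "\<dots> \<le> a / s' - (u n x y / s) / (?n * s')"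
      proof -
        have "(((1 + c) * (?n * ?W\<^sup>2) + c / 16) / R) / ?n / s' \<le> a / s'"
          using a s s' by (intro divide_right_mono) auto
        then show ?thesis by (simp add: diff_divide_distrib)
      qed
      finally have 1: "\<kappa> / ?n / s' \<le> a / s' - (u n x y / s) / (?n * s')" .
      have 2: "EV - V x y \<ge> - ((2 * D + 1) / ?n\<^sup>2)"
      proof -
        have "(?Fx\<^sup>2 + ?Fy\<^sup>2) / ?n \<ge> 0" by simp
        then show ?thesis using EV by linarith
      qed
      have 3: "(2 * D + 1) / ?n\<^sup>2 \<le> (\<kappa> / 4) / (?n * s)"
      proof -
        have "(2 * D + 1) / ?n\<^sup>2 = ((2 * D + 1) * (s / ?n)) / (?n * s)"
          using n0 s by (simp add: power2_eq_square)
        also have "\<dots> \<le> (\<kappa> / 4) / (?n * s)"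
          using Nn n0 s by (intro divide_right_mono) auto
        finally show ?thesis .
      qed
      have 4: "(\<kappa> / 2) / (?n * s) \<le> \<kappa> / ?n / s'"
      proof -
        have "\<kappa> / (?n * (2 * s)) \<le> \<kappa> / (?n * s')"
          using \<kappa> n0 s s' s'2 by (intro divide_left_mono mult_left_mono mult_pos_pos) auto
        then show ?thesis by simp
      qed
      have 5: "\<eta> / (?n * s) \<le> (\<kappa> / 4) / (?n * s)"
        using \<eta> n0 s by (intro divide_right_mono) auto
      have "(\<kappa> / 2) / (?n * s) = (\<kappa> / 4) / (?n * s) + (\<kappa> / 4) / (?n * s)"
        by (simp add: field_simps pos)
      moreover have "h \<le> e + b - v"
        if "k2 = k4 + k4" "k1 \<le> b - v" "e \<ge> - d" "d \<le> k4" "k2 \<le> k1" "h \<le> k4" for h e b v k1 k2 k4 d :: real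
        using that by linarith
      ultimately show ?thesis using 1 2 3 4 5 by blast
    qed
    then show ?thesis
      unfolding expand unfolding \<Psi>_def s_def[symmetric] using split by (simp add: add_divide_distrib)
  qed
  show ?thesis
  proof (intro exI allI impI)
    fix n assume n: "n \<ge> N"
    show "AE \<omega> in urn_law s0 \<alpha> p. \<exists>k\<ge>n. \<bar>bfrac (fst (\<omega> k)) + bfrac (snd (\<omega> k)) - 1\<bar> \<ge> 31/32"
    proof (rule frac_hits[OF p t, where \<Psi>=\<Psi> and B="2 * (B + U)" and c="\<lambda>n. \<eta> / (real n * ln (real n))"
          and U="\<lambda>x y. \<bar>x + y - 1\<bar> \<ge> 31/32"])
      fix m x y assume m: "m \<ge> n" and xy: "x \<in> {0..1::real}" "y \<in> {0..1::real}"
      have "u m x y / ln (real m) \<ge> 0"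
        using u_bounds(1)[OF _ xy, of m] N[of m] m n by auto
      then show "\<Psi> m x y \<in> {0..2 * (B + U)}"
        using B(1)[OF xy] u_bounds(2)[OF _ xy, of m] B(2) U m n by (auto simp: \<Psi>_def abs_le_iff)
    next
      fix m x y assume m: "m \<ge> n" and xy: "x \<in> {0..1::real}" "y \<in> {0..1::real}" and "\<not> \<bar>x + y - 1\<bar> \<ge> 31/32"
      then show "expect \<alpha> p (balls (fst s0)) (balls (snd s0)) m (\<Psi> (Suc m)) x y + \<eta> / (real m * ln (real m)) \<le> \<Psi> m x y"
        using decrease[of m x y] n by (simp add: t1_def t2_def)
    next
      show "\<exists>m. b < (\<Sum>k=n..<m. \<eta> / (real k * ln (real k)))" for b
        using N[OF n] by (intro sum_inverse_n_ln_n_diverges \<eta>) (simp only: max.bounded_iff)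
    next
      fix m assume "m \<ge> n"
      then show "0 \<le> \<eta> / (real m * ln (real m))"
        using \<eta> N[of m] n by simp
    qed
  qed
qed

text \<open>Compactness makes the pointwise alternative uniform. The function \<open>f\<close>
  encodes it, \<open>max\<close> standing for the disjunction and \<open>min\<close> for the
  conjunction. It is positive on \<open>K\<close>, since at an equilibrium the draw probability
  \<open>Q\<close> equals x and has variance x (1 - x) > 0.\<close>

lemma almost_surely_dominant:
  fixes H :: "real \<Rightarrow> real \<Rightarrow> real"
  assumes \<alpha>: "\<alpha> \<ge> 2" and p: "p \<in> {0..1}" and t: "balls (fst s0) \<ge> 1" "balls (snd s0) \<ge> 1"
    and cont: "continuous_on ({0..1} \<times> {0..1}) (\<lambda>z. H (fst z) (snd z))"
    and H: "\<And>x y. x \<in> {0..1} \<Longrightarrow> y \<in> {0..1} \<Longrightarrow>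
      (x + y - 1) * (drift \<alpha> p ((x + y) / 2) x + drift \<alpha> p ((x + y) / 2) y) \<ge> H x y * (x + y - 1)\<^sup>2"
    and equilibria: "\<And>x y. x \<in> {0..1} \<Longrightarrow> y \<in> {0..1} \<Longrightarrow> \<bar>x + y - 1\<bar> < 1 \<Longrightarrow>
      drift \<alpha> p ((x + y) / 2) x = 0 \<Longrightarrow> drift \<alpha> p ((x + y) / 2) y = 0 \<Longrightarrow> H x y > 0 \<and> 0 < x \<and> x < 1"
  shows "measure (urn_law s0 \<alpha> p) (dominance s0) = 1"
proof -
  define Fx Fy Q where "Fx = (\<lambda>z. drift \<alpha> p ((fst z + snd z) / 2) (fst z))"
    and "Fy = (\<lambda>z. drift \<alpha> p ((fst z + snd z) / 2) (snd z))"
    and "Q = (\<lambda>z. p * share \<alpha> ((fst z + snd z) / 2) + (1 - p) * share \<alpha> (fst z))"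
  define K where "K = ({0..1::real} \<times> {0..1::real}) \<inter> {z. \<bar>fst z + snd z - 1\<bar> \<le> 31/32}"
  define f where "f = (\<lambda>z. max ((Fx z)\<^sup>2 + (Fy z)\<^sup>2) (min (H (fst z) (snd z)) (Q z * (1 - Q z))))"
  have share: "continuous_on ({0..1} \<times> {0..1}) (\<lambda>z. share \<alpha> (g z))"
    if "continuous_on ({0..1} \<times> {0..1}) g" "\<And>z. z \<in> {0..1} \<times> {0..1} \<Longrightarrow> g z \<in> {0..1}"
    for g :: "real \<times> real \<Rightarrow> real"
    using \<alpha> that by (intro continuous_on_compose2[OF continuous_on_share]) auto
  have "continuous_on ({0..1} \<times> {0..1}) f"
    unfolding f_def Fx_def Fy_def Q_def drift_def
    by (intro continuous_intros continuous_on_max continuous_on_min cont share) auto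
  then have "continuous_on K f"
    by (rule continuous_on_subset) (auto simp: K_def)
  moreover have "compact K"
    unfolding K_def
    by (intro compact_Int_closed compact_Times compact_Icc closed_Collect_le continuous_intros)
  moreover have "(1/2, 1/2) \<in> K"
    by (simp add: K_def)
  ultimately obtain z0 where z0: "z0 \<in> K" "\<And>z. z \<in> K \<Longrightarrow> f z0 \<le> f z"
    using continuous_attains_inf[of K f] by blast
  have "f z > 0" if "z \<in> K" for z
  proof (cases "Fx z = 0 \<and> Fy z = 0")
    case True
    have z: "fst z \<in> {0..1}" "snd z \<in> {0..1}" "\<bar>fst z + snd z - 1\<bar> < 1"
      using that by (auto simp: K_def)
    have e: "H (fst z) (snd z) > 0 \<and> 0 < fst z \<and> fst z < 1"
      using True by (intro equilibria z) (auto simp: Fx_def Fy_def)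
    moreover have "Q z = fst z"
      using True by (simp add: Fx_def Q_def drift_def)
    ultimately show ?thesis
      by (simp add: f_def less_max_iff_disj)
  next
    case False
    then show ?thesis
      by (simp add: f_def less_max_iff_disj sum_power2_gt_zero_iff)
  qed
  then have pos: "f z0 > 0"
    using z0(1) by blast
  define c where "c = min 1 (f z0)"
  have "\<exists>N. \<forall>n\<ge>N. AE \<omega> in urn_law s0 \<alpha> p. \<exists>k\<ge>n. \<bar>bfrac (fst (\<omega> k)) + bfrac (snd (\<omega> k)) - 1\<bar> \<ge> 31/32"
  proof (rule hits_neighbourhood_of_sinks[where c=c])
    fix x y :: real assume xy: "x \<in> {0..1}" "y \<in> {0..1}" and W: "\<bar>x + y - 1\<bar> < 31/32"
    have "c \<le> f (x, y)"
      using z0(2)[of "(x, y)"] xy W by (simp add: c_def K_def)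
    moreover have "c * (x + y - 1)\<^sup>2 \<le> H x y * (x + y - 1)\<^sup>2" if "c \<le> H x y"
      using that by (intro mult_right_mono) auto
    ultimately show "(drift \<alpha> p ((x + y) / 2) x)\<^sup>2 + (drift \<alpha> p ((x + y) / 2) y)\<^sup>2 \<ge> c \<or>
      (x + y - 1) * (drift \<alpha> p ((x + y) / 2) x + drift \<alpha> p ((x + y) / 2) y) \<ge> c * (x + y - 1)\<^sup>2 \<and>
      (p * share \<alpha> ((x + y) / 2) + (1 - p) * share \<alpha> x) * (1 - (p * share \<alpha> ((x + y) / 2) + (1 - p) * share \<alpha> x)) \<ge> c"
      using H[OF xy] by (auto simp: f_def Fx_def Fy_def Q_def le_max_iff_disj)
  qed (use \<alpha> p t pos in \<open>auto simp: c_def\<close>)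
  then show ?thesis
    using almost_surely_dominant_if_hits[OF \<alpha> p t] by blast
qed

section \<open>Equilibria\<close>

lemma share_2_centred: "2 * share 2 m - 1 = 2 * (2 * m - 1) / (1 + (2 * m - 1)\<^sup>2)" if "m \<in> {0..1}"
proof -
  have "1 + (2 * m - 1)\<^sup>2 = 2 * (m\<^sup>2 + (1 - m)\<^sup>2)"
    by (simp add: power2_eq_square algebra_simps)
  moreover have "m\<^sup>2 + (1 - m)\<^sup>2 > 0"
    using sum_power2_gt_zero_iff[of m "1 - m"] by auto
  ultimately show ?thesis
    using that by (simp add: share_2 divide_simps) (simp add: power2_eq_square algebra_simps)
qed

text \<open>For \<alpha> \<ge> 2 the share is at least as far from 1/2 as the share with exponent 2,
  for which the outward drift is explicit: 2 W^2 / (1 + W^2) - W^2 = W^2 (1 - W^2) / (1 + W^2). An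
  equilibrium in the open strip then has W = 0 and x = y.\<close>

lemma almost_surely_dominant_if_p_1:
  assumes \<alpha>: "\<alpha> \<ge> 2" and t: "balls (fst s0) \<ge> 1" "balls (snd s0) \<ge> 1"
  shows "measure (urn_law s0 \<alpha> 1) (dominance s0) = 1"
proof (rule almost_surely_dominant[OF \<alpha> _ t])
  let ?H = "\<lambda>x y :: real. (1 - (x + y - 1)\<^sup>2) / (1 + (x + y - 1)\<^sup>2)"
  have pos: "1 + w\<^sup>2 > 0" for w :: real
    by (simp add: add_pos_nonneg)
  show "continuous_on ({0..1} \<times> {0..1}) (\<lambda>z. ?H (fst z) (snd z))"
    using pos[THEN less_imp_neq] by (intro continuous_intros) (auto simp: eq_commute[of 0])
  show H: "?H x y * (x + y - 1)\<^sup>2 \<le> (x + y - 1) * (drift \<alpha> 1 ((x + y) / 2) x + drift \<alpha> 1 ((x + y) / 2) y)"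
    if xy: "x \<in> {0..1}" "y \<in> {0..1}" for x y
  proof -
    define m where "m = (x + y) / 2"
    define W where "W = 2 * m - 1"
    have m: "m \<in> {0..1}" using xy by (auto simp: m_def)
    have W: "x + y - 1 = W" by (simp add: W_def m_def)
    have "W * (2 * share 2 m - 1) \<le> W * (2 * share \<alpha> m - 1)"
    proof (cases "m \<le> 1/2")
      case True
      then have "share \<alpha> m \<le> share 2 m"
        using \<alpha> m by (intro share_antimono_exponent) auto
      then show ?thesis
        using True by (intro mult_left_mono_neg) (auto simp: W_def)
    next
      case False
      then have "share \<alpha> (1 - m) \<le> share 2 (1 - m)"
        using \<alpha> m by (intro share_antimono_exponent) auto
      then show ?thesis
        using False by (intro mult_left_mono) (auto simp: W_def share_compl)
    qed
    also have "2 * share 2 m - 1 = 2 * W / (1 + W\<^sup>2)"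
      unfolding W_def by (rule share_2_centred[OF m])
    finally have "W * (2 * W / (1 + W\<^sup>2)) - W * W \<le> W * (2 * share \<alpha> m - 1) - W * W"
      by simp
    moreover have "W * (2 * W / (1 + W\<^sup>2)) - W * W = (1 - W\<^sup>2) / (1 + W\<^sup>2) * W\<^sup>2"
      using pos[of W] by (simp add: divide_simps) (simp add: power2_eq_square algebra_simps)
    moreover have "W * (2 * share \<alpha> m - 1) - W * W = W * (drift \<alpha> 1 m x + drift \<alpha> 1 m y)"
    proof -
      have "x + y = W + 1" using W by simp
      then have sum: "drift \<alpha> 1 m x + drift \<alpha> 1 m y = 2 * share \<alpha> m - (W + 1)"
        by (simp add: drift_def)
      show ?thesis
        unfolding sum by (simp add: algebra_simps)
    qed
    ultimately show ?thesis
      unfolding W m_def[symmetric] by simp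
  qed
  show "?H x y > 0 \<and> 0 < x \<and> x < 1"
    if xy: "x \<in> {0..1}" "y \<in> {0..1}" and W: "\<bar>x + y - 1\<bar> < 1"
      and eq: "drift \<alpha> 1 ((x + y) / 2) x = 0" "drift \<alpha> 1 ((x + y) / 2) y = 0" for x y
  proof -
    have h: "?H x y > 0"
      using W pos[of "x + y - 1"] by (simp add: abs_square_less_1)
    have "?H x y * (x + y - 1)\<^sup>2 \<le> 0"
      using H[OF xy] eq by simp
    then have "(x + y - 1)\<^sup>2 \<le> 0"
      using mult_le_cancel_left_pos[OF h, of "(x + y - 1)\<^sup>2" 0] by simp
    moreover have "x = y"
      using eq by (simp add: drift_def)
    ultimately show ?thesis
      using h by simp
  qed
qed simp

section \<open>Equilibria for exponent 3 in centred coordinates\<close>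

text \<open>The triple-argument formula tanh (3 u) = \<phi> (tanh u); in the centred coordinate 2 x
  - 1 the share with exponent 3 is this rational function.\<close>

definition \<phi> :: "real \<Rightarrow> real" where
  "\<phi> a = a * (3 + a\<^sup>2) / (1 + 3 * a\<^sup>2)"

lemma one_plus_3_square_pos: "1 + 3 * a\<^sup>2 > 0" for a :: real
  by (simp add: add_pos_nonneg)

lemma share_3: "2 * share 3 x - 1 = \<phi> (2 * x - 1)" if "x \<in> {0..1}"
proof -
  have s: "share 3 x = x^3 / (x^3 + (1 - x)^3)"
    using that by (simp add: share_def powr_numeral)
  have "4 * (x^3 + (1 - x)^3) = 1 + 3 * (2 * x - 1)\<^sup>2"
    by (simp add: power2_eq_square power3_eq_cube algebra_simps)
  then have d: "x^3 + (1 - x)^3 = (1 + 3 * (2 * x - 1)\<^sup>2) / 4"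
    by simp
  show ?thesis
    unfolding s d \<phi>_def using one_plus_3_square_pos[of "2 * x - 1"]
    by (simp add: divide_simps) (simp add: power2_eq_square power3_eq_cube algebra_simps)
qed

lemma \<phi>_add: "\<phi> a + \<phi> b = (a + b) * (3 + a\<^sup>2 + 8 * a * b + b\<^sup>2 + 3 * a\<^sup>2 * b\<^sup>2) / ((1 + 3 * a\<^sup>2) * (1 + 3 * b\<^sup>2))"
  using one_plus_3_square_pos[of a] one_plus_3_square_pos[of b] unfolding \<phi>_def
  by (simp add: divide_simps) (simp add: power2_eq_square algebra_simps)

lemma \<phi>_minus: "\<phi> (- a) = - \<phi> a"
  by (simp add: \<phi>_def)

lemma \<phi>_diff: "\<phi> a - \<phi> b = (a - b) * (3 + a\<^sup>2 - 8 * a * b + b\<^sup>2 + 3 * a\<^sup>2 * b\<^sup>2) / ((1 + 3 * a\<^sup>2) * (1 + 3 * b\<^sup>2))"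
  using \<phi>_add[of a "- b"] by (simp add: \<phi>_minus)

text \<open>With \<open>a = 2 * x - 1\<close> and \<open>b = 2 * y - 1\<close>, equilibria with \<open>a \<noteq> \<plusminus> b\<close> form a curve in the
  coordinates \<open>k = ((a + b) / 2)\<^sup>2\<close>, \<open>t = - a * b\<close>, on which \<open>p\<close> peaks just above \<open>0.307\<close>. Near the maximum
  \<open>626/1000 + k\<close> is close to the Lagrange multiplier, and \<open>913/2805\<close> minimises at \<open>k = 0\<close> the polynomial
  obtained by adding this multiple of the constraint.\<close>

lemma off_diagonal_curve:
  fixes k t p :: real
  assumes k: "k \<ge> 0" and t: "t \<ge> 0"
    and curve: "3 - 2 * t - 9 * t\<^sup>2 = k * (11 + 22 * t + 3 * t\<^sup>2) + 4 * k\<^sup>2"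
    and p: "p * ((3 + k) * (3 + 4 * k + 10 * t + 3 * t\<^sup>2)) = 16 * t * (1 + 3 * k)"
  shows "p < 309/1000"
proof (rule ccontr)
  assume "\<not> p < 309/1000"
  then have "(309/1000) * ((3 + k) * (3 + 4 * k + 10 * t + 3 * t\<^sup>2)) \<le> p * ((3 + k) * (3 + 4 * k + 10 * t + 3 * t\<^sup>2))"
    using k t by (intro mult_right_mono) auto
  then have P: "(309/1000) * ((3 + k) * (3 + 4 * k + 10 * t + 3 * t\<^sup>2)) - 16 * t * (1 + 3 * k) \<le> 0"
    using p by simp
  define w where "w = t - 913/2805"
  have t_w: "t = w + 913/2805" by (simp add: w_def)
  \<comment> \<open>The factor subtracted with the multiplier vanishes by \<open>curve\<close>. What
    results is a positive constant, a completed square mixing w and k, and further terms that are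
    nonnegative for k, t \<ge> 0.\<close>
  have "(309/1000) * ((3 + k) * (3 + 4 * k + 10 * t + 3 * t\<^sup>2)) - 16 * t * (1 + 3 * k) =
      (309/1000) * ((3 + k) * (3 + 4 * k + 10 * t + 3 * t\<^sup>2)) - 16 * t * (1 + 3 * k)
      - (626/1000 + k) * (3 - 2 * t - 9 * t\<^sup>2 - (k * (11 + 22 * t + 3 * t\<^sup>2) + 4 * k\<^sup>2))"
    using curve by simp
  also have "\<dots> = 122/10625 + (1683/200) * (w - (60784/47685) * k)\<^sup>2 +
      (72068611/67553750) * k\<^sup>2 + (62323/216750) * k + (2361/200) * w\<^sup>2 * k +
      22 * t * k\<^sup>2 + 3 * t\<^sup>2 * k\<^sup>2 + 4 * k^3"
    unfolding t_w by (simp add: power2_eq_square power3_eq_cube field_simps)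
  also have "\<dots> > 0"
    using k t by (intro add_pos_nonneg add_nonneg_nonneg mult_nonneg_nonneg) auto
  finally show False using P by simp
qed


text \<open>The sum of the doubled drifts divided by a + b, as \<open>slope_eq\<close> shows. With
  the common factor cancelled it is continuous across a + b = 0, where its value is the linear
  growth rate of W.\<close>

definition slope :: "real \<Rightarrow> real \<Rightarrow> real \<Rightarrow> real" where
  "slope p a b = p * (3 + ((a + b) / 2)\<^sup>2) / (1 + 3 * ((a + b) / 2)\<^sup>2) +
    (1 - p) * (3 + a\<^sup>2 + 8 * a * b + b\<^sup>2 + 3 * a\<^sup>2 * b\<^sup>2) / ((1 + 3 * a\<^sup>2) * (1 + 3 * b\<^sup>2)) - 1"

lemma slope_eq:
  "p * (2 * \<phi> ((a + b) / 2)) + (1 - p) * (\<phi> a + \<phi> b) - (a + b) = (a + b) * slope p a b"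
proof -
  have double: "2 * \<phi> m = (2 * m) * ((3 + m\<^sup>2) / (1 + 3 * m\<^sup>2))" for m
    by (simp only: \<phi>_def mult.assoc times_divide_eq_right)
  have "2 * ((a + b) / 2) = a + b" by simp
  note double[of "(a + b) / 2", unfolded this]
  then show ?thesis
    unfolding \<phi>_add slope_def by (simp add: algebra_simps)
qed

text \<open>There are three kinds of equilibria. On a = b only a = 0 lies in the strip. On a + b = 0
  the bound on p limits a^2 and thereby fixes the sign of the slope. Elsewhere the slope would
  vanish, and \<open>off_diagonal_curve\<close> contradicts the bound on p.\<close>

lemma slope_pos_at_equilibria:
  assumes p: "309/1000 \<le> p" "p \<le> 1" and ab: "\<bar>a + b\<bar> < 2"
    and eq: "p * \<phi> ((a + b) / 2) + (1 - p) * \<phi> a = a" "p * \<phi> ((a + b) / 2) + (1 - p) * \<phi> b = b"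
  shows "slope p a b > 0 \<and> \<bar>a\<bar> < 1"
proof (cases "a = b")
  case True
  then have "\<phi> a = a"
    using eq(1) by (simp add: algebra_simps)
  then have "a * (2 * (1 - a\<^sup>2)) = 0"
    using one_plus_3_square_pos[of a] by (simp add: \<phi>_def divide_simps)
  moreover have "a\<^sup>2 < 1"
    using ab True by (simp add: abs_square_less_1)
  ultimately have "a = 0" by auto
  then show ?thesis
    using True by (simp add: slope_def)
next
  case False
  define N E where "N = 3 + a\<^sup>2 - 8 * a * b + b\<^sup>2 + 3 * a\<^sup>2 * b\<^sup>2" and "E = (1 + 3 * a\<^sup>2) * (1 + 3 * b\<^sup>2)"
  have E: "E > 0"
    unfolding E_def by (intro mult_pos_pos one_plus_3_square_pos)
  have "(1 - p) * (\<phi> a - \<phi> b) = a - b"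
    using eq by (simp add: right_diff_distrib)
  then have "(a - b) * ((1 - p) * N) = (a - b) * E"
    unfolding \<phi>_diff N_def[symmetric] E_def[symmetric] using E by (simp add: field_simps)
  then have NE: "(1 - p) * N = E"
    using False by simp
  show ?thesis
  proof (cases "a + b = 0")
    case True
    then have b: "b = - a" by simp
    define r where "r = a\<^sup>2"
    have r0: "r \<ge> 0" by (simp add: r_def)
    have "E = (1 + 3 * r) * (1 + 3 * r)" "N = (3 + r) * (1 + 3 * r)"
      by (simp_all add: E_def N_def b r_def power2_eq_square algebra_simps)
    then have "((1 - p) * (3 + r)) * (1 + 3 * r) = (1 + 3 * r) * (1 + 3 * r)"
      using NE by (simp add: mult.assoc)
    then have pr: "(1 - p) * (3 + r) = 1 + 3 * r"
      using r0 by (subst (asm) mult_right_cancel) auto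
    have "(1 - p) * (3 + r) \<le> (691/1000) * (3 + r)"
      using p r0 by (intro mult_right_mono) auto
    \<comment> \<open>From 1 + 3 r \<le> 0.691 (3 + r). The slope changes sign at the positive root
      of 6 - 4 r - 18 r^2, about 0.477, while 1073/2309 is about 0.465.\<close>
    then have r: "r \<le> 1073/2309"
      using pr by simp
    have p_eq: "1 - p = (1 + 3 * r) / (3 + r)"
      using pr r0 by (simp add: field_simps)
    have "slope p a b = 3 * p + (1 - p) * (3 - 6 * r + 3 * r\<^sup>2) / ((1 + 3 * r) * (1 + 3 * r)) - 1"
      by (simp add: slope_def b r_def power2_eq_square algebra_simps)
    also have "\<dots> = 2 - 3 * (1 - p) + (1 - p) * (3 - 6 * r + 3 * r\<^sup>2) / ((1 + 3 * r) * (1 + 3 * r))"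
      by simp
    also have "\<dots> = (6 - 4 * r - 18 * r\<^sup>2) / ((3 + r) * (1 + 3 * r))"
    proof -
      have "3 + r \<noteq> 0" "1 + 3 * r \<noteq> 0" using r0 by auto
      then show ?thesis
        unfolding p_eq by (simp add: divide_simps) (simp add: power2_eq_square algebra_simps)
    qed
    also have "\<dots> > 0"
    proof -
      have "r * r \<le> (1073/2309) * r"
        using r r0 by (intro mult_right_mono) auto
      then have "6 - 4 * r - 18 * r\<^sup>2 > 0"
        using r by (simp add: power2_eq_square)
      then show ?thesis using r0 by simp
    qed
    finally have "slope p a b > 0" .
    moreover have "a\<^sup>2 < 1" using r by (simp add: r_def)
    ultimately show ?thesis
      by (simp add: abs_square_less_1)
  next
    case sum: False
    \<comment> \<open>Off both diagonals the sum and the difference of the two equations can be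
      divided by a + b and a - b; what remains is symmetric in a and b, hence polynomial in these
      two coordinates.\<close>
    define k t where "k = ((a + b) / 2)\<^sup>2" and "t = - (a * b)"
    have k0: "k \<ge> 0" by (simp add: k_def)
    have "(a + b) * slope p a b =
        (p * \<phi> ((a + b) / 2) + (1 - p) * \<phi> a) + (p * \<phi> ((a + b) / 2) + (1 - p) * \<phi> b) - (a + b)"
      unfolding slope_eq[symmetric] by (simp add: algebra_simps)
    then have "(a + b) * slope p a b = 0"
      unfolding eq by simp
    then have "slope p a b = 0"
      using sum by simp
    have squares: "a\<^sup>2 + b\<^sup>2 = 4 * k + 2 * t" "a\<^sup>2 * b\<^sup>2 = t\<^sup>2"
      by (simp_all add: k_def t_def power2_eq_square field_simps)
    have N: "N = 3 + 4 * k + 10 * t + 3 * t\<^sup>2"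
    proof -
      have "N = 3 + (a\<^sup>2 + b\<^sup>2) + 8 * t + 3 * (a\<^sup>2 * b\<^sup>2)"
        by (simp add: N_def t_def)
      then show ?thesis unfolding squares by simp
    qed
    have E_eq: "E = 1 + 12 * k + 6 * t + 9 * t\<^sup>2"
    proof -
      have "E = 1 + 3 * (a\<^sup>2 + b\<^sup>2) + 9 * (a\<^sup>2 * b\<^sup>2)"
        by (simp add: E_def algebra_simps)
      then show ?thesis unfolding squares by simp
    qed
    have N0: "N > 0"
      using NE E p zero_less_mult_iff[of "1 - p" N] by auto
    have "3 + a\<^sup>2 + 8 * a * b + b\<^sup>2 + 3 * a\<^sup>2 * b\<^sup>2 = N - 16 * t"
      by (simp add: N_def t_def)
    then have "p * (3 + k) / (1 + 3 * k) + (1 - p) * (N - 16 * t) / E = 1"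
      using \<open>slope p a b = 0\<close> by (simp add: slope_def k_def E_def)
    moreover have "(1 - p) * (N - 16 * t) / E = 1 - 16 * t / N"
    proof -
      have "(1 - p) * (N - 16 * t) / E = (N - 16 * t) * ((1 - p) / E)"
        by simp
      also have "(1 - p) / E = 1 / N"
        using NE E N0 by (simp add: field_simps)
      finally show ?thesis
        using N0 by (simp add: diff_divide_distrib)
    qed
    ultimately have "p * (3 + k) / (1 + 3 * k) = 16 * t / N"
      by simp
    then have pk: "p * ((3 + k) * N) = 16 * t * (1 + 3 * k)"
      using k0 N0 by (simp add: divide_simps split: if_splits)
    have "p * ((3 + k) * N) \<ge> 0"
      using p k0 N0 by simp
    then have t0: "t \<ge> 0"
      unfolding pk using k0 by (simp add: zero_le_mult_iff)
    \<comment> \<open>Elimination of p: the difference equation gives p N, the sum equation p (3 +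
      k) N.\<close>
    have "p * N = N - E"
      using NE by (simp add: algebra_simps)
    then have "(3 + k) * (N - E) = 16 * t * (1 + 3 * k)"
      using pk by (metis mult.left_commute)
    then have "3 - 2 * t - 9 * t\<^sup>2 = k * (11 + 22 * t + 3 * t\<^sup>2) + 4 * k\<^sup>2"
      unfolding N E_eq by (simp add: power2_eq_square algebra_simps)
    then have "p < 309/1000"
      using off_diagonal_curve[OF k0 t0] pk N by simp
    with p show ?thesis by simp
  qed
qed

text \<open>In the coordinates 2 x - 1 and 2 y - 1 the drift doubles and becomes a combination of
  values of \<open>\<phi>\<close>, so \<open>slope\<close> serves as the rate \<open>H\<close> of
  \<open>almost_surely_dominant\<close>.\<close>

lemma almost_surely_dominant_3:
  assumes p: "309/1000 \<le> p" "p \<le> 1" and t: "balls (fst s0) \<ge> 1" "balls (snd s0) \<ge> 1"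
  shows "measure (urn_law s0 3 p) (dominance s0) = 1"
proof (rule almost_surely_dominant[OF _ _ t])
  let ?H = "\<lambda>x y. slope p (2 * x - 1) (2 * y - 1)"
  have ne: "1 + 3 * a\<^sup>2 \<noteq> 0" for a :: real
    using one_plus_3_square_pos[of a] by simp
  show "continuous_on ({0..1} \<times> {0..1}) (\<lambda>z. ?H (fst z) (snd z))"
    unfolding slope_def by (intro continuous_intros) (auto simp: ne)
  have drift: "2 * drift 3 p ((x + y) / 2) z =
      p * \<phi> (((2 * x - 1) + (2 * y - 1)) / 2) + (1 - p) * \<phi> (2 * z - 1) - (2 * z - 1)"
    if "x \<in> {0..1}" "y \<in> {0..1}" "z \<in> {0..1}" for x y z
  proof -
    have "((2 * x - 1) + (2 * y - 1)) / 2 = 2 * ((x + y) / 2) - 1"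
      by (simp add: field_simps)
    moreover have "\<phi> (2 * ((x + y) / 2) - 1) = 2 * share 3 ((x + y) / 2) - 1"
      by (rule share_3[symmetric]) (use that in auto)
    moreover have "\<phi> (2 * z - 1) = 2 * share 3 z - 1"
      by (rule share_3[symmetric]) (rule that)
    ultimately show ?thesis
      by (simp only:) (simp add: drift_def algebra_simps)
  qed
  show "?H x y * (x + y - 1)\<^sup>2 \<le> (x + y - 1) * (drift 3 p ((x + y) / 2) x + drift 3 p ((x + y) / 2) y)"
    if xy: "x \<in> {0..1}" "y \<in> {0..1}" for x y
  proof -
    let ?a = "2 * x - 1" and ?b = "2 * y - 1"
    have "2 * drift 3 p ((x + y) / 2) x + 2 * drift 3 p ((x + y) / 2) y = (?a + ?b) * slope p ?a ?b"
      unfolding slope_eq[symmetric] drift[OF xy xy(1)] drift[OF xy xy(2)] by (simp add: algebra_simps)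
    also have "?a + ?b = 2 * (x + y - 1)" by simp
    finally have *: "2 * drift 3 p ((x + y) / 2) x + 2 * drift 3 p ((x + y) / 2) y =
        2 * (x + y - 1) * slope p ?a ?b" .
    have "u + v = w * s" if "2 * u + 2 * v = 2 * w * s" for u v w s :: real
      using that by linarith
    from this[OF *] have "drift 3 p ((x + y) / 2) x + drift 3 p ((x + y) / 2) y = (x + y - 1) * slope p ?a ?b" .
    then show ?thesis
      by (simp add: power2_eq_square)
  qed
  show "?H x y > 0 \<and> 0 < x \<and> x < 1"
    if xy: "x \<in> {0..1}" "y \<in> {0..1}" and W: "\<bar>x + y - 1\<bar> < 1"
      and eq: "drift 3 p ((x + y) / 2) x = 0" "drift 3 p ((x + y) / 2) y = 0" for x y
  proof -
    have "slope p (2 * x - 1) (2 * y - 1) > 0 \<and> \<bar>2 * x - 1\<bar> < 1"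
    proof (rule slope_pos_at_equilibria[OF p])
      show "\<bar>2 * x - 1 + (2 * y - 1)\<bar> < 2"
        using W by (simp add: abs_less_iff)
    qed (use drift[OF xy xy(1)] drift[OF xy xy(2)] eq in simp_all)
    then show ?thesis
      by (auto simp: abs_less_iff)
  qed
qed (use p in auto)

theorem proposition10p2:
  fixes s0 :: config
  assumes "red (fst s0) \<ge> 1" and "black (snd s0) \<ge> 1"
  shows "\<not> mono_on {1<..} (\<lambda>\<alpha>. p_crit s0 \<alpha>)
    \<and> p_crit s0 (5/2) > 31/100 \<and> 31/100 > p_crit s0 3"
proof -
  have t: "balls (fst s0) \<ge> 1" "balls (snd s0) \<ge> 1"
    using assms by (auto simp: balls_def)
  define S where "S = (\<lambda>\<alpha>. {q \<in> {0..1::real}. \<forall>p\<in>{q..1}. measure (urn_law s0 \<alpha> p) (dominance s0) = 1})"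
  have p_crit: "p_crit s0 \<alpha> = Inf (S \<alpha>)" for \<alpha>
    by (simp add: p_crit_def S_def)
  have "1 \<in> S (5/2)"
    using almost_surely_dominant_if_p_1[of "5/2" s0] t by (simp add: S_def)
  \<comment> \<open>3101/10000 lies in \<open>{q..1}\<close> for every smaller \<open>q\<close>, so
    the failure of dominance at this one value excludes all of them.\<close>
  moreover have "3101/10000 \<le> q" if "q \<in> S (5/2)" for q
  proof (rule ccontr)
    assume "\<not> 3101/10000 \<le> q"
    then have "measure (urn_law s0 (5/2) (3101/10000)) (dominance s0) = 1"
      using that by (auto simp: S_def)
    then show False
      using not_almost_surely_dominant_five_halves[OF assms] by simp
  qed
  ultimately have "3101/10000 \<le> Inf (S (5/2))"
    by (intro cInf_greatest) auto
  then have lower: "p_crit s0 (5/2) > 31/100"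
    by (simp add: p_crit)
  have "309/1000 \<in> S 3"
    using almost_surely_dominant_3[of _ s0] t by (simp add: S_def)
  moreover have "bdd_below (S 3)"
    by (rule bdd_belowI[of _ 0]) (simp add: S_def)
  ultimately have "Inf (S 3) \<le> 309/1000"
    by (rule cInf_lower)
  then have upper: "31/100 > p_crit s0 3"
    by (simp add: p_crit)
  have "\<not> mono_on {1<..} (p_crit s0)"
  proof
    assume "mono_on {1<..} (p_crit s0)"
    then have "p_crit s0 (5/2) \<le> p_crit s0 3"
      by (rule mono_onD) auto
    with lower upper show False by simp
  qed
  with lower upper show ?thesis by simp
qed

end
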